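(* Assume (A1) $n_i/n\to\kappa_i>0$ as $n\to\infty$ for every $i\in\{1,\dots,k\}$, and (A2) for every $i\in\{1,\dots,k\}$ and $\ell\in\{1,\dots,d\}$ the marginal distribution function $F_{i\ell}$ is continuously differentiable at $q_{i\ell}$ with positive derivative $f_{i\ell}(q_{i\ell})>0$. Let $\hat{\mathbf\Sigma}$ be a consistent estimator of $\mathbf\Sigma$ and let $\hat{\mathbf\Sigma}^*$ denote its consistent bootstrap version. Let $\alpha\in(0,1)$, let $$S_n(\mathbf T)=n(\mathbf T\hat{\mathbf q})'E(\mathbf T,\hat{\mathbf\Sigma})\mathbf T\hat{\mathbf q},\qquad S_n^*(\mathbf T)=n\left[\mathbf T(\hat{\mathbf q}^*-\hat{\mathbf q})\right]'E(\mathbf T,\hat{\mathbf\Sigma}^* )\,\mathbf T(\hat{\mathbf q}^*-\hat{\mathbf q}),$$ with $E$ either the ATS choice or the MATS choice (see context), let $b_\alpha^*(\mathbf X)$ be the $(1-\alpha)$-quantile of the conditional distribution function $x\mapsto P(S_n^*(\mathbf T)\le x\mid\mathbf X)$ given the data $\mathbf X$, and let $\varphi_n^*=\mathbf 1\{S_n(\mathbf T)>b_\alpha^*(\mathbf X)\}$. Then the test $\varphi_n^*$ is asymptotically exact for $\mathcal H_0:\mathbf T\mathbf q=\mathbf 0_{dk}$, i.e. $E_{\mathcal H_0}(\varphi_n^* )\to\alpha$ as $n\to\infty$, and it is consistent for general alternatives $\mathcal H_1:\mathbf T\mathbf q\neq\mathbf 0_{dk}$, i.e. $E_{\mathcal H_1}(\varphi_n^*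 )\to1$ as $n\to\infty$. (Here $E_{\mathcal H_0}$ and $E_{\mathcal H_1}$ denote expectation when $\mathbf T\mathbf q=\mathbf 0_{dk}$ and when $\mathbf T\mathbf q\ne\mathbf 0_{dk}$, respectively.)
   Context: Setting. Fix integers $k,d\ge1$ and $p\in(0,1)$. For each group $i\in\{1,\dots,k\}$ let $\mathbf X_{ij}=(X_{ij1},\dots,X_{ijd})'$, $j=1,\dots,n_i$, be $\mathbb R^d$-valued with joint distribution $\mathbb P_i$; all observation vectors are mutually independent. Put $n=\sum_{i=1}^kn_i$; all limits are as $n\to\infty$. $F_{i\ell}$ denotes the distribution function of $X_{i1\ell}$ (with existing density $f_{i\ell}$) and $F_{i\ell m}$ the joint distribution function of $(X_{i1\ell},X_{i1m})$. $\mathbf X$ denotes all the data. Quantiles. $q_{i\ell}=F_{i\ell}^{-1}(p)=\inf\{t\in\mathbb R: F_{i\ell}(t)\ge p\}$, $\mathbf q_i=(q_{i1},\dots,q_{id})'$, $\mathbf q=(\mathbf q_1',\dots,\mathbf q_k')'\in\mathbb R^{dk}$. Empirical versions: $\hat F_{i\ell}(t)=n_i^{-1}\sum_{j=1}^{n_i}\mathbf 1\{X_{ij\ell}\le t\}$, $\hat q_{i\ell}=\inf\{t:\hat F_{i\ell}(t)\ge p\}$, and $\hat{\mathbf q}$ is the vector of all $\hat q_{i\ell}$ stacked like $\mathbf q$. Group-wise bootstrap. For each group $i$, independently across groups, given the data, $\mathbf X_{i1}^*,\dots,\mathbf X_{in_i}^*$ are drawn independently with replacement from $\{\mathbf X_{i1},\dots,\mathbf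 X_{in_i}\}$. A superscript $^*$ means that a statistic is computed from the bootstrap sample instead of the original one; e.g. $\hat{\mathbf q}^*$ is the vector of empirical $p$-quantiles of the bootstrap sample. Consistency of $\hat{\mathbf\Sigma}$ means $\hat{\mathbf\Sigma}\to\mathbf\Sigma$ in probability. Consistency of $\hat{\mathbf\Sigma}^*$ means convergence to $\mathbf\Sigma$ given the data in probability: for every $\varepsilon>0$, $P(\|\hat{\mathbf\Sigma}^*-\mathbf\Sigma\|>\varepsilon\mid\mathbf X)\to0$ in probability. Matrix $\mathbf T$. Let $\mathbf H\in\mathbb R^{r\times dk}$ be a contrast matrix ($\mathbf H\mathbf 1_{dk}=\mathbf 0_r$) and $\mathbf T=\mathbf H'(\mathbf H\mathbf H')^+\mathbf H\in\mathbb R^{dk\times dk}$, where $^+$ denotes the Moore–Penrose inverse; $\mathbf T$ is symmetric and idempotent. Covariance matrix. $\mathbf\Sigma=\bigoplus_{i=1}^k\mathbf\Sigma^{(i)}$ (block diagonal) with $\mathbf\Sigma^{(i)}_{\ell\ell}=\kappa_i^{-1}f_{i\ell}(q_{i\ell})^{-2}(p-p^2)$ and $\mathbf\Sigma^{(i)}_{\ell m}=\kappa_i^{-1}\{f_{i\ell}(q_{i\ell})f_{im}(q_{im})\}^{-1}\left[F_{i\ell m}(q_{i\ell},q_{im})-p^2\right]$ for $\ell\ne m$. Choices of $E$. For a symmetric $dk\times dk$ matrix $\mathbf A$: ATS (ANOVA-type statistic): $E(\mathbf T,\mathbf A)=\mathrm{tr}(\mathbf T\mathbf A\mathbf T)^{-1}\mathbf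 I_{dk}$; MATS (modified ANOVA-type statistic): $E(\mathbf T,\mathbf A)=(\mathbf T\mathbf A_0\mathbf T)^+$, where $\mathbf A_0$ is the diagonal matrix containing the diagonal elements of $\mathbf A$.
   Formalization: The formal theorem also assumes TΣT ≠ 0 for the ATS and, for either statistic, under H0; without it exactness fails (e.g. X_2 = X_1 a.s. with T contrasting them, or H = 0, gives a test that never rejects) and tr(TΣT)^{-1} is undefined. *)

theory Defs
  imports "HOL-Probability.Probability"
begin

definition conv_in_prob ::
    "'a measure \<Rightarrow> (nat \<Rightarrow> 'a \<Rightarrow> 'b::metric_space) \<Rightarrow> 'b \<Rightarrow> bool" where
  "conv_in_prob M Z c \<longleftrightarrow>
     (\<forall>\<epsilon>>0. (\<lambda>\<nu>. measure M {\<omega> \<in> space M. dist (Z \<nu> \<omega>) c > \<epsilon>}) \<longlonglongrightarrow> 0)"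

definition cont_differentiable_at :: "(real \<Rightarrow> real) \<Rightarrow> real \<Rightarrow> bool" where
  "cont_differentiable_at F x \<longleftrightarrow>
     (\<forall>\<^sub>F y in nhds x. F differentiable (at y)) \<and> isCont (deriv F) x"

definition is_moore_penrose :: "real^'n^'m \<Rightarrow> real^'m^'n \<Rightarrow> bool" where
  "is_moore_penrose A B \<longleftrightarrow>
     A ** B ** A = A \<and> B ** A ** B = B \<and>
     transpose (A ** B) = A ** B \<and> transpose (B ** A) = B ** A"

definition moore_penrose :: "real^'n^'m \<Rightarrow> real^'m^'n" where
  "moore_penrose A = (THE B. is_moore_penrose A B)"

definition contrast_matrix :: "real^'n^'r \<Rightarrow> bool" where
  "contrast_matrix H \<longleftrightarrow> H *v (\<chi> _. 1) = 0"

definition projection_of :: "real^'n^'r \<Rightarrow> real^'n^'n" where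
  "projection_of H = transpose H ** moore_penrose (H ** transpose H) ** H"

definition diag_part :: "real^'n^'n \<Rightarrow> real^'n^'n" where
  "diag_part A = (\<chi> a b. if a = b then A $ a $ a else 0)"

text \<open>\<open>E_ATS T A\<close> is the zero matrix when the trace of \<open>T ** A ** T\<close> vanishes. For a
  symmetric idempotent \<open>T\<close> and a covariance matrix \<open>\<Sigma>\<close>, the trace of \<open>T ** \<Sigma> ** T\<close> vanishes
  exactly when \<open>T ** \<Sigma> ** T = 0\<close>; in that case the ATS normalisation is undefined and, under the
  null hypothesis, the limit distribution of the MATS is degenerate at zero.\<close>

definition E_ATS :: "real^'n^'n \<Rightarrow> real^'n^'n \<Rightarrow> real^'n^'n" where
  "E_ATS T A = inverse (trace (T ** A ** T)) *\<^sub>R mat 1"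

definition E_MATS :: "real^'n^'n \<Rightarrow> real^'n^'n \<Rightarrow> real^'n^'n" where
  "E_MATS T A = moore_penrose (T ** diag_part A ** T)"

text \<open>Throughout, \<open>\<mu>\<close> is a distribution on \<open>real^'d\<close>, a family \<open>P\<close> gives the distribution of
  each group, and vectors stacked over groups and components are indexed by \<open>'k \<times> 'd\<close>.\<close>

definition marginal_cdf :: "(real^'d) measure \<Rightarrow> 'd \<Rightarrow> real \<Rightarrow> real" where
  "marginal_cdf \<mu> l = cdf (distr \<mu> borel (\<lambda>x. x $ l))"

definition joint_cdf :: "(real^'d) measure \<Rightarrow> 'd \<Rightarrow> 'd \<Rightarrow> real \<Rightarrow> real \<Rightarrow> real" where
  "joint_cdf \<mu> l m s t = measure \<mu> {x \<in> space \<mu>. x $ l \<le> s \<and> x $ m \<le> t}"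

definition quantile :: "(real \<Rightarrow> real) \<Rightarrow> real \<Rightarrow> real" where
  "quantile G u = Inf {t. G t \<ge> u}"

definition pop_quantile :: "real \<Rightarrow> ('k \<Rightarrow> (real^'d) measure) \<Rightarrow> 'k \<Rightarrow> 'd \<Rightarrow> real" where
  "pop_quantile p P i l = quantile (marginal_cdf (P i) l) p"

definition pop_quantiles ::
    "real \<Rightarrow> ('k::finite \<Rightarrow> (real^'d) measure) \<Rightarrow> real^('k \<times> 'd)" where
  "pop_quantiles p P = (\<chi> a. pop_quantile p P (fst a) (snd a))"

definition asymp_cov ::
    "real \<Rightarrow> ('k::finite \<Rightarrow> real) \<Rightarrow> ('k \<Rightarrow> (real^'d) measure) \<Rightarrow> ('k \<Rightarrow> 'd \<Rightarrow> real \<Rightarrow> real)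
       \<Rightarrow> real^('k \<times> 'd)^('k \<times> 'd)" where
  "asymp_cov p \<kappa> P f =
     (\<chi> a b. let i = fst a; l = snd a; m = snd b; q = pop_quantile p P i in
        if fst b \<noteq> i then 0
        else if l = m then inverse (\<kappa> i) * inverse ((f i l (q l))\<^sup>2) * (p - p\<^sup>2)
        else inverse (\<kappa> i) * inverse (f i l (q l) * f i m (q m))
               * (joint_cdf (P i) l m (q l) (q m) - p\<^sup>2))"

text \<open>A sample with group sizes \<open>N\<close> is a function on \<open>obs_index N\<close>; the observations of
  group \<open>i\<close> are numbered \<open>0, \<dots>, N i - 1\<close>.\<close>

definition obs_index :: "('k \<Rightarrow> nat) \<Rightarrow> ('k \<times> nat) set" where
  "obs_index N = (SIGMA i:UNIV. {..<N i})"

definition sample_space :: "('k \<Rightarrow> nat) \<Rightarrow> ('k \<times> nat \<Rightarrow> real^'d) measure" where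
  "sample_space N = PiM (obs_index N) (\<lambda>_. borel)"

definition observed ::
    "('k \<Rightarrow> nat \<Rightarrow> 'a \<Rightarrow> real^'d) \<Rightarrow> ('k \<Rightarrow> nat) \<Rightarrow> 'a \<Rightarrow> ('k \<times> nat \<Rightarrow> real^'d)" where
  "observed X N \<omega> = restrict (\<lambda>(i, j). X i j \<omega>) (obs_index N)"

definition total_size :: "('k::finite \<Rightarrow> nat) \<Rightarrow> nat" where
  "total_size N = (\<Sum>i\<in>UNIV. N i)"

definition emp_cdf ::
    "('k \<Rightarrow> nat) \<Rightarrow> ('k \<times> nat \<Rightarrow> real^'d) \<Rightarrow> 'k \<Rightarrow> 'd \<Rightarrow> real \<Rightarrow> real" where
  "emp_cdf N x i l t = (\<Sum>j<N i. of_bool (x (i, j) $ l \<le> t)) / real (N i)"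

definition emp_quantiles ::
    "real \<Rightarrow> ('k::finite \<Rightarrow> nat) \<Rightarrow> ('k \<times> nat \<Rightarrow> real^'d) \<Rightarrow> real^('k \<times> 'd)" where
  "emp_quantiles p N x = (\<chi> a. quantile (emp_cdf N x (fst a) (snd a)) p)"

text \<open>The conditional distribution of the bootstrap sample given that the data equal \<open>x\<close>:
  all draws are independent, and those of group \<open>i\<close> follow the empirical distribution of
  that group. \<open>Pi_pmf\<close> is given the default value \<open>undefined\<close>, so that bootstrap samples lie
  in the same extensional function space as the data.\<close>

definition bootstrap ::
    "('k::finite \<Rightarrow> nat) \<Rightarrow> ('k \<times> nat \<Rightarrow> real^'d) \<Rightarrow> ('k \<times> nat \<Rightarrow> real^'d) pmf" where
  "bootstrap N x =
     Pi_pmf (obs_index N) undefined (\<lambda>(i, j). map_pmf (\<lambda>h. x (i, h)) (pmf_of_set {..<N i}))"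

text \<open>An estimator is a sequence \<open>S\<close> of functions of the sample, \<open>S \<nu>\<close> being applied to samples
  with group sizes \<open>N \<nu>\<close>; its bootstrap version is \<open>S \<nu>\<close> applied to the bootstrap sample.\<close>

definition consistent_estimator ::
    "'a measure \<Rightarrow> ('k \<Rightarrow> nat \<Rightarrow> 'a \<Rightarrow> real^'d) \<Rightarrow> (nat \<Rightarrow> 'k \<Rightarrow> nat)
       \<Rightarrow> (nat \<Rightarrow> ('k \<times> nat \<Rightarrow> real^'d) \<Rightarrow> 'b::metric_space) \<Rightarrow> 'b \<Rightarrow> bool" where
  "consistent_estimator M X N S \<theta> \<longleftrightarrow> conv_in_prob M (\<lambda>\<nu> \<omega>. S \<nu> (observed X (N \<nu>) \<omega>)) \<theta>"

definition bootstrap_consistent ::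
    "'a measure \<Rightarrow> ('k::finite \<Rightarrow> nat \<Rightarrow> 'a \<Rightarrow> real^'d) \<Rightarrow> (nat \<Rightarrow> 'k \<Rightarrow> nat)
       \<Rightarrow> (nat \<Rightarrow> ('k \<times> nat \<Rightarrow> real^'d) \<Rightarrow> 'b::metric_space) \<Rightarrow> 'b \<Rightarrow> bool" where
  "bootstrap_consistent M X N S \<theta> \<longleftrightarrow>
     (\<forall>\<epsilon>>0. conv_in_prob M
        (\<lambda>\<nu> \<omega>. measure_pmf.prob (bootstrap (N \<nu>) (observed X (N \<nu>) \<omega>)) {y. dist (S \<nu> y) \<theta> > \<epsilon>}) 0)"

definition quad_stat ::
    "(real^'n^'n \<Rightarrow> real^'n^'n \<Rightarrow> real^'n^'n) \<Rightarrow> nat \<Rightarrow> real^'n^'n \<Rightarrow> real^'n^'n \<Rightarrow> real^'n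
       \<Rightarrow> real" where
  "quad_stat E n T A v = real n * ((T *v v) \<bullet> (E T A *v (T *v v)))"

text \<open>In the following definitions, \<open>V\<close> is the covariance estimator for group sizes \<open>N\<close>,
  \<open>x\<close> the data and \<open>y\<close> a bootstrap sample.\<close>

definition test_stat where
  "test_stat E p N V T x = quad_stat E (total_size N) T (V x) (emp_quantiles p N x)"

definition boot_stat where
  "boot_stat E p N V T x y =
     quad_stat E (total_size N) T (V y) (emp_quantiles p N y - emp_quantiles p N x)"

definition boot_critical_value where
  "boot_critical_value E p N V T \<alpha> x =
     quantile (\<lambda>s. measure_pmf.prob (bootstrap N x) {y. boot_stat E p N V T x y \<le> s}) (1 - \<alpha>)"

definition boot_test ::
    "(real^('k \<times> 'd)^('k \<times> 'd) \<Rightarrow> real^('k \<times> 'd)^('k \<times> 'd) \<Rightarrow> real^('k \<times> 'd)^('k \<times> 'd))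
       \<Rightarrow> real \<Rightarrow> ('k::finite \<Rightarrow> nat) \<Rightarrow> (('k \<times> nat \<Rightarrow> real^'d) \<Rightarrow> real^('k \<times> 'd)^('k \<times> 'd))
       \<Rightarrow> real^('k \<times> 'd)^('k \<times> 'd) \<Rightarrow> real \<Rightarrow> ('k \<times> nat \<Rightarrow> real^'d) \<Rightarrow> real" where
  "boot_test E p N V T \<alpha> x =
     of_bool (test_stat E p N V T x > boot_critical_value E p N V T \<alpha> x)"

end

theory Submission
  imports Defs
begin

text \<open>Convergence in probability is convergence along a filter on pairs of an index and an outcome
  (an event belongs to the filter if its inner probability tends to one). Iterating the construction,
  convergence of the bootstrap given the data, in probability, is again convergence along a filter,
  so the same limit theorem for triangular arrays applies to the sample, centred at the true quantiles,
  and to the bootstrap sample, centred at the empirical quantiles.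

  In that theorem the quantile process is linearised: \<open>q\<^sub>n \<le> c + s / sqrt n\<close> means that the empirical
  distribution function at \<open>c + s / sqrt n\<close> is at least \<open>p\<close>, and the empirical process hardly varies over such
  distances. The characteristic function of the resulting vector \<open>W\<close> of averages is expanded
  uniformly on bounded sets. For a quadratic form, averaging the characteristic function over a Gaussian vector
  gives the Laplace transform of \<open>|B W|\<^sup>2\<close>, hence all moments of the bounded variable
  \<open>exp (- |B W|\<^sup>2 / 2)\<close>, and Weierstrass approximation turns these into limits of distribution functions.\<close>

section \<open>The Moore--Penrose inverse\<close>

text \<open>The obstacle is the second level of randomness: the bootstrap sample is drawn from a
  discrete law, centred at the random empirical quantile, where the empirical distribution function
  has no useful derivative. The array theorem therefore asks of a distribution function only that
  its increments over distances s / sqrt n behave linearly, and for the empirical one this follows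
  from the first-level result. The statistics depend on W through |B W|^2, so one-dimensional
  distribution functions suffice. They are compared up to a shift of the argument, which also covers
  a limit law with an atom; continuity of the limit law enters for the level. Under the alternative
  the bootstrap statistic, being centred at the empirical quantiles, stays bounded in probability
  while the test statistic grows like n.\<close>

lemma matrix_mult_diff_right:
  fixes A :: "real^'n^'m" and B C :: "real^'k^'n"
  shows "A ** (B - C) = A ** B - A ** C"
  by (simp add: matrix_matrix_mult_def vec_eq_iff sum_subtractf right_diff_distrib)

text \<open>A linear map has a linear right inverse on its range; the matrix of that map is an inner
  inverse, from which the pseudo-inverse is built below.\<close>

lemma matrix_inverse_generalized:
  fixes A :: "real^'n^'m"
  obtains X :: "real^'m^'n" where "A ** X ** A = A"
proof -
  have lin: "linear ((*v) A)" by simp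
  obtain g where g: "linear g" "\<forall>v\<in>range ((*v) A). A *v g v = v"
    using linear_exists_right_inverse_on[OF lin subspace_UNIV] by auto
  have g': "matrix g *v x = g x" for x
    using g(1) by (simp add: matrix_works linear_matrix_vector_mul_eq)
  have "A ** matrix g ** A = A"
    unfolding matrix_eq by (simp add: matrix_vector_mul_assoc[symmetric] g' g(2))
  then show thesis by (rule that)
qed

text \<open>The Gram matrix has the same kernel as \<open>A\<close>, since |A w|^2 is the inner
  product of \<open>transpose A ** A\<close> applied to w with w. This cancellation law drives the
  existence proof that follows.\<close>

lemma transpose_mult_cancel:
  fixes A :: "real^'n^'m" and Z :: "real^'k^'n"
  assumes "transpose A ** A ** Z = 0"
  shows "A ** Z = 0"
proof -
  have "A *v (Z *v x) = 0" for x
  proof -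
    have "(A *v (Z *v x)) \<bullet> (A *v (Z *v x)) = (transpose A *v (A *v (Z *v x))) \<bullet> (Z *v x)"
      by (simp add: dot_lmul_matrix)
    also have "transpose A *v (A *v (Z *v x)) = 0"
      using assms by (simp add: matrix_vector_mul_assoc matrix_mul_assoc)
    finally show ?thesis by simp
  qed
  then show ?thesis unfolding matrix_eq by (simp add: matrix_vector_mul_assoc)
qed

text \<open>With X any inner inverse of A^T A A^T, the pseudo-inverse is B = A^T X A^T. Cancelling
  twice gives B A A^T = A^T and, from the transposed equation for X, also A^T A B = A^T. Each of
  these writes a projection as the product of a matrix and its transpose, hence as a symmetric
  matrix; the remaining identities follow.\<close>

lemma is_moore_penrose_exists:
  fixes A :: "real^'n^'m"
  shows "\<exists>B. is_moore_penrose A B"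
proof -
  let ?T = "transpose A"
  obtain X where X: "(?T ** A ** ?T) ** X ** (?T ** A ** ?T) = ?T ** A ** ?T"
    by (rule matrix_inverse_generalized)
  define B where "B = ?T ** X ** ?T"
  have "?T ** A ** (?T ** X ** ?T ** A ** ?T - ?T) = 0"
    using X by (simp add: matrix_mult_diff_right matrix_mul_assoc)
  then have "A ** (?T ** X ** ?T ** A ** ?T - ?T) = 0"
    by (rule transpose_mult_cancel)
  then have "transpose ?T ** ?T ** (X ** ?T ** A ** ?T - mat 1) = 0"
    by (simp add: matrix_mult_diff_right matrix_mul_assoc)
  then have "?T ** (X ** ?T ** A ** ?T - mat 1) = 0"
    by (rule transpose_mult_cancel)
  then have 1: "B ** A ** ?T = ?T"
    by (simp add: matrix_mult_diff_right matrix_mul_assoc B_def)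
  have X': "transpose (?T ** A ** ?T) ** transpose X ** transpose (?T ** A ** ?T)
      = transpose (?T ** A ** ?T)"
    by (metis X matrix_transpose_mul matrix_mul_assoc)
  then have X': "A ** ?T ** A ** transpose X ** A ** ?T ** A = A ** ?T ** A"
    by (simp add: matrix_transpose_mul matrix_mul_assoc)
  then have "transpose ?T ** ?T ** (A ** transpose X ** A ** ?T ** A - A) = 0"
    by (simp add: matrix_mult_diff_right matrix_mul_assoc)
  then have "?T ** (A ** transpose X ** A ** ?T ** A - A) = 0"
    by (rule transpose_mult_cancel)
  then have "?T ** A ** (transpose X ** A ** ?T ** A - mat 1) = 0"
    by (simp add: matrix_mult_diff_right matrix_mul_assoc)
  then have "A ** (transpose X ** A ** ?T ** A - mat 1) = 0"
    by (rule transpose_mult_cancel)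
  then have "A ** transpose X ** A ** ?T ** A = A"
    by (simp add: matrix_mult_diff_right matrix_mul_assoc)
  then have "transpose (A ** transpose X ** A ** ?T ** A) = ?T" by simp
  then have 2: "?T ** A ** B = ?T"
    by (simp add: matrix_transpose_mul matrix_mul_assoc B_def)
  have s1: "transpose (B ** A) = B ** A"
  proof -
    have "B ** A ** transpose (B ** A) = transpose (B ** A)"
      using arg_cong[OF 1, of "\<lambda>M. M ** transpose B"]
      by (simp add: matrix_transpose_mul matrix_mul_assoc)
    then show ?thesis by (metis matrix_transpose_mul transpose_transpose)
  qed
  have s2: "transpose (A ** B) = A ** B"
  proof -
    have "transpose (A ** B) ** (A ** B) = transpose (A ** B)"
      using arg_cong[OF 2, of "\<lambda>M. transpose B ** M"]
      by (simp add: matrix_transpose_mul matrix_mul_assoc)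
    then show ?thesis by (metis matrix_transpose_mul transpose_transpose)
  qed
  have a: "A ** B ** A = A"
  proof -
    have "transpose (A ** B ** A) = ?T ** transpose (A ** B)"
      by (simp add: matrix_transpose_mul matrix_mul_assoc)
    also have "\<dots> = ?T" using s2 2 by (simp add: matrix_mul_assoc)
    finally show ?thesis by (metis transpose_transpose)
  qed
  have b: "B ** A ** B = B"
  proof -
    have "B ** A ** B = (B ** A ** ?T) ** X ** ?T" by (simp add: B_def matrix_mul_assoc)
    then show ?thesis by (simp add: 1) (simp add: B_def)
  qed
  show ?thesis using a b s1 s2 unfolding is_moore_penrose_def by blast
qed

text \<open>\<open>A ** B\<close> and \<open>A ** C\<close> are symmetric, so transposing A C A B =
  A B exchanges the two projections and thereby identifies them; likewise on the other side.\<close>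

lemma is_moore_penrose_unique:
  assumes "is_moore_penrose A B" "is_moore_penrose A C"
  shows "B = C"
proof -
  note b = assms(1)[unfolded is_moore_penrose_def]
  note c = assms(2)[unfolded is_moore_penrose_def]
  have "A ** B = transpose (A ** B)" using b by simp
  also have "\<dots> = transpose (A ** C ** A ** B)" using c by simp
  also have "\<dots> = transpose (A ** B) ** transpose (A ** C)"
    by (simp add: matrix_transpose_mul matrix_mul_assoc)
  also have "\<dots> = A ** C" using b c by (simp add: matrix_mul_assoc)
  finally have AB: "A ** B = A ** C" .
  have "B ** A = transpose (B ** A)" using b by simp
  also have "\<dots> = transpose (B ** (A ** C ** A))" using c by simp
  also have "\<dots> = transpose (C ** A) ** transpose (B ** A)"
    by (simp add: matrix_transpose_mul matrix_mul_assoc)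
  also have "\<dots> = (C ** A) ** (B ** A)" using b c by simp
  also have "\<dots> = C ** (A ** B ** A)" by (simp add: matrix_mul_assoc)
  also have "\<dots> = C ** A" using b by simp
  finally have BA: "B ** A = C ** A" .
  have "B = C ** A ** B" using b BA by metis
  also have "\<dots> = C ** (A ** C)" using AB by (metis matrix_mul_assoc)
  also have "\<dots> = C" using c by (simp add: matrix_mul_assoc)
  finally show ?thesis .
qed

lemma is_moore_penrose_moore_penrose: "is_moore_penrose A (moore_penrose A)"
  unfolding moore_penrose_def
  by (rule theI') (use is_moore_penrose_exists is_moore_penrose_unique in blast)

lemma moore_penrose_eqI: "is_moore_penrose A B \<Longrightarrow> moore_penrose A = B"
  using is_moore_penrose_moore_penrose is_moore_penrose_unique by blast

lemma moore_penrose_symmetric: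
  assumes "transpose A = A"
  shows "transpose (moore_penrose A) = moore_penrose A"
proof (rule moore_penrose_eqI[symmetric])
  show "is_moore_penrose A (transpose (moore_penrose A))"
    using is_moore_penrose_moore_penrose[of A] assms unfolding is_moore_penrose_def
    by (metis matrix_transpose_mul transpose_transpose matrix_mul_assoc)
qed

lemma projection_of_symmetric: "transpose (projection_of H) = projection_of H"
proof -
  have "transpose (moore_penrose (H ** transpose H)) = moore_penrose (H ** transpose H)"
    by (rule moore_penrose_symmetric) (simp add: matrix_transpose_mul)
  then show ?thesis
    by (simp add: projection_of_def matrix_transpose_mul matrix_mul_assoc)
qed

lemma projection_of_idempotent: "projection_of H ** projection_of H = projection_of H"
  (is "?P ** ?P = ?P")
proof -
  let ?K = "H ** transpose H"
  have "?P ** ?P = transpose H ** (moore_penrose ?K ** ?K ** moore_penrose ?K) ** H"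
    by (simp add: projection_of_def matrix_mul_assoc)
  then show ?thesis
    using is_moore_penrose_moore_penrose[of ?K] by (simp add: is_moore_penrose_def projection_of_def)
qed

section \<open>Continuity and measurability of matrix operations\<close>

lemma continuous_on_matrix_mult [continuous_intros]:
  fixes f :: "'a::topological_space \<Rightarrow> real^'n^'m" and g :: "'a \<Rightarrow> real^'k^'n"
  assumes "continuous_on S f" "continuous_on S g"
  shows "continuous_on S (\<lambda>x. f x ** g x)"
  unfolding matrix_matrix_mult_def
  by (intro continuous_on_vec_lambda continuous_on_sum continuous_on_mult
      continuous_on_component assms)

lemma continuous_on_transpose [continuous_intros]:
  fixes f :: "'a::topological_space \<Rightarrow> real^'n^'m"
  assumes "continuous_on S f"
  shows "continuous_on S (\<lambda>x. transpose (f x))"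
  unfolding transpose_def by (intro continuous_on_vec_lambda continuous_on_component assms)

lemma continuous_on_trace [continuous_intros]:
  fixes f :: "'a::topological_space \<Rightarrow> real^'n^'n"
  assumes "continuous_on S f"
  shows "continuous_on S (\<lambda>x. trace (f x))"
  unfolding trace_def by (intro continuous_on_sum continuous_on_component assms)

lemma continuous_on_diag_part [continuous_intros]:
  fixes f :: "'a::topological_space \<Rightarrow> real^'n^'n"
  assumes "continuous_on S f"
  shows "continuous_on S (\<lambda>x. diag_part (f x))"
  unfolding diag_part_def
proof (intro continuous_on_vec_lambda)
  fix i j show "continuous_on S (\<lambda>x. if i = j then f x $ i $ i else 0)"
    by (cases "i = j") (auto intro!: continuous_on_component assms)
qed

lemma continuous_on_matrix_vector_mult [continuous_intros]:
  fixes f :: "'a::topological_space \<Rightarrow> real^'n^'m" and g :: "'a \<Rightarrow> real^'n"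
  assumes "continuous_on S f" "continuous_on S g"
  shows "continuous_on S (\<lambda>x. f x *v g x)"
  unfolding matrix_vector_mult_def
  by (intro continuous_on_vec_lambda continuous_on_sum continuous_on_mult
      continuous_on_component assms)

text \<open>The graph of the Moore--Penrose inverse is closed and the space is \<open>\<sigma>\<close>-compact, so
  preimages of closed sets are countable unions of closed sets.\<close>

lemma borel_measurable_moore_penrose:
  "(moore_penrose :: real^'n^'m \<Rightarrow> real^'m^'n) \<in> borel_measurable borel"
proof (rule borel_measurableI)
  fix S :: "(real^'m^'n) set" assume S: "open S"
  define C where "C = - S"
  have C: "closed C" using S by (simp add: C_def closed_Compl)
  define \<Gamma> :: "((real^'m^'n) \<times> (real^'n^'m)) set" where "\<Gamma> = {z. is_moore_penrose (snd z) (fst z)}"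
  have \<Gamma>: "closed \<Gamma>"
    unfolding \<Gamma>_def is_moore_penrose_def
    by (intro closed_Collect_conj closed_Collect_eq continuous_intros)
  define W where "W m = {A. \<exists>B. B \<in> cball 0 (real m) \<inter> C \<and> (B, A) \<in> \<Gamma>}" for m
  have "closed (W m)" for m
    unfolding W_def
    by (rule closed_compact_projection[OF compact_Int_closed[OF compact_cball C] \<Gamma>])
  then have "(\<Union>m. W m) \<in> sets borel" by auto
  moreover have "moore_penrose -` C = (\<Union>m. W m)"
  proof (intro set_eqI iffI)
    fix A assume "A \<in> moore_penrose -` C"
    moreover obtain m where "norm (moore_penrose A) \<le> real m" using real_arch_simple by blast
    ultimately show "A \<in> (\<Union>m. W m)"
      using is_moore_penrose_moore_penrose[of A] by (auto simp: W_def \<Gamma>_def)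
  next
    fix A assume "A \<in> (\<Union>m. W m)"
    then obtain B where "B \<in> C" "is_moore_penrose A B" by (auto simp: W_def \<Gamma>_def)
    then show "A \<in> moore_penrose -` C" using moore_penrose_eqI by fastforce
  qed
  ultimately have "- (moore_penrose -` C) \<in> sets borel" by (metis borel_comp)
  then show "moore_penrose -` S \<inter> space borel \<in> sets borel"
    by (simp add: C_def vimage_Compl)
qed

section \<open>Pseudo-inverses of compressed diagonal matrices\<close>

lemma diag_part_quadratic:
  fixes A :: "real^'n^'n"
  shows "w \<bullet> (diag_part A *v w) = (\<Sum>a\<in>UNIV. A$a$a * (w$a)\<^sup>2)"
proof -
  have "(diag_part A *v w) $ a = A$a$a * w$a" for a
    by (simp add: matrix_vector_mult_def diag_part_def if_distrib if_distribR cong: if_cong)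
  then show ?thesis by (simp add: inner_vec_def power2_eq_square algebra_simps)
qed

text \<open>A diagonal bounded below by c makes T D T coercive on the range of T, so its kernel is
  that of T and R inverts it there: both products are T. The bound |R v| <= |v| / c is what makes
  the pseudo-inverse continuous here, although in general it jumps where the rank changes.\<close>

lemma moore_penrose_compression:
  fixes T A :: "real^'n^'n"
  assumes T: "transpose T = T" "T ** T = T"
    and c: "c > 0" "\<And>a. A $ a $ a \<ge> c"
  defines "R \<equiv> moore_penrose (T ** diag_part A ** T)"
  shows "T ** R = R" "R ** T = R" "(T ** diag_part A ** T) ** R = T" "R ** (T ** diag_part A ** T) = T"
    "transpose R = R" "norm (R *v v) \<le> norm v / c"
proof -
  let ?D = "diag_part A"
  let ?A = "T ** ?D ** T"
  have D: "transpose ?D = ?D"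
    by (simp add: diag_part_def transpose_def vec_eq_iff)
  have A: "transpose ?A = ?A"
    by (simp add: matrix_transpose_mul T D matrix_mul_assoc)
  note mp = is_moore_penrose_moore_penrose[of ?A, folded R_def, unfolded is_moore_penrose_def]
  show R: "transpose R = R"
    unfolding R_def using A by (rule moore_penrose_symmetric)
  have TA: "T ** ?A = ?A" "?A ** T = ?A"
    using T(2) by (metis matrix_mul_assoc)+
  have AR: "?A ** R = R ** ?A"
    using mp A R by (metis matrix_transpose_mul)
  show TR: "T ** R = R"
    using mp AR TA by (metis matrix_mul_assoc)
  show RT: "R ** T = R"
    using mp AR TA by (metis matrix_mul_assoc)
  have inj: "T *v w = 0" if "?A *v w = 0" for w
  proof -
    let ?w = "T *v w"
    have "c * (?w \<bullet> ?w) = (\<Sum>a\<in>UNIV. c * (?w$a)\<^sup>2)"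
      by (simp add: inner_vec_def power2_eq_square sum_distrib_left)
    also have "\<dots> \<le> ?w \<bullet> (?D *v ?w)"
      unfolding diag_part_quadratic by (intro sum_mono mult_right_mono c) simp
    also have "\<dots> = w \<bullet> (?A *v w)"
      by (metis T(1) dot_lmul_matrix matrix_vector_mul_assoc transpose_matrix_vector)
    also have "\<dots> = 0" using that by simp
    finally have "?w \<bullet> ?w \<le> 0" using c(1) by (simp add: mult_le_0_iff)
    then show ?thesis by (metis inner_eq_zero_iff inner_ge_zero order_antisym)
  qed
  \<comment> \<open>The difference \<open>R ** ?A - T\<close> is annihilated by \<open>?A\<close>,
    hence by T; as T fixes both of its terms from the left, it vanishes.\<close>
  have "?A ** (R ** ?A - T) = 0"
    using mp TA by (simp add: matrix_mult_diff_right matrix_mul_assoc)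
  then have "?A *v ((R ** ?A - T) *v x) = 0" for x
    by (simp add: matrix_vector_mul_assoc)
  then have "T *v ((R ** ?A - T) *v x) = 0" for x
    using inj by blast
  then have "T ** (R ** ?A - T) = 0"
    unfolding matrix_eq by (simp add: matrix_vector_mul_assoc)
  then show RA: "R ** ?A = T"
    using TR T by (simp add: matrix_mult_diff_right matrix_mul_assoc)
  show "?A ** R = T" using RA AR by simp
  \<comment> \<open>Coercivity once more, now at a vector in the range of R, which T fixes.\<close>
  let ?w = "R *v v"
  have Tw: "T *v ?w = ?w" using TR by (simp add: matrix_vector_mul_assoc)
  have "c * (?w \<bullet> ?w) = (\<Sum>a\<in>UNIV. c * (?w$a)\<^sup>2)"
    by (simp add: inner_vec_def power2_eq_square sum_distrib_left)
  also have "\<dots> \<le> ?w \<bullet> (?D *v ?w)"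
    unfolding diag_part_quadratic by (intro sum_mono mult_right_mono c) simp
  also have "\<dots> = ?w \<bullet> (?A *v ?w)"
    by (metis T(1) Tw dot_lmul_matrix matrix_vector_mul_assoc transpose_matrix_vector)
  also have "?A *v ?w = T *v v"
    using RA AR by (simp add: matrix_vector_mul_assoc)
  also have "?w \<bullet> (T *v v) = ?w \<bullet> v"
    by (metis T(1) Tw dot_lmul_matrix transpose_matrix_vector)
  also have "\<dots> \<le> norm ?w * norm v" by (rule norm_cauchy_schwarz)
  finally have "c * (norm ?w * norm ?w) \<le> norm ?w * norm v"
    by (simp add: power2_norm_eq_inner[symmetric] power2_eq_square)
  then have "norm ?w = 0 \<or> c * norm ?w \<le> norm v"
    using mult_le_cancel_left_pos[of "norm ?w" "c * norm ?w" "norm v"]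
    by (auto simp: algebra_simps)
  then show "norm ?w \<le> norm v / c"
    using c(1) by (auto simp: field_simps)
qed

section \<open>The weight matrices of the two statistics\<close>

lemma matrix_mult_diff_left:
  fixes A B :: "real^'n^'m" and C :: "real^'k^'n"
  shows "(A - B) ** C = A ** C - B ** C"
  by (simp add: matrix_matrix_mult_def vec_eq_iff sum_subtractf left_diff_distrib)

lemma isCont_E_ATS:
  fixes A :: "real^'n^'n"
  assumes "trace (T ** A ** T) \<noteq> 0"
  shows "isCont (E_ATS T) A"
proof -
  have "continuous_on UNIV (\<lambda>A. trace (T ** A ** T))" by (intro continuous_intros)
  then have "isCont (\<lambda>A. trace (T ** A ** T)) A"
    by (simp add: continuous_on_eq_continuous_at)
  then have "isCont (\<lambda>A. inverse (trace (T ** A ** T)) *\<^sub>R (mat 1 :: real^'n^'n)) A"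
    using assms by (intro continuous_intros) auto
  then show ?thesis by (simp add: E_ATS_def[abs_def])
qed

text \<open>Resolvent identity R(B) - R(A) = R(B) (K(A) - K(B)) R(A): it holds for these
  pseudo-inverses because both belong to the same projection T. Near A the factor R(B) is bounded by
  1 / c, so continuity of the compression K is enough.\<close>

lemma isCont_E_MATS:
  fixes T A :: "real^'n^'n"
  assumes T: "transpose T = T" "T ** T = T" and pos: "\<And>a. A $ a $ a > 0"
  shows "isCont (E_MATS T) A"
proof -
  define K where "K B = T ** diag_part B ** T" for B
  \<comment> \<open>Half of the smallest diagonal entry: the lower bound then persists for all
    matrices near A.\<close>
  define c where "c = Min (range (\<lambda>a. A$a$a)) / 2"
  have "Min (range (\<lambda>a. A$a$a)) > 0" using pos by simp
  then have c: "c > 0" by (simp add: c_def)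
  have cle: "c < A$a$a" for a
  proof -
    have "2 * c \<le> A$a$a" by (simp add: c_def)
    then show ?thesis using c by simp
  qed
  have Kc: "continuous_on UNIV K"
    unfolding K_def by (intro continuous_intros)
  have diag: "\<forall>\<^sub>F B in at A. \<forall>a. B$a$a \<ge> c"
    unfolding eventually_all_finite
  proof (intro eventually_all_finite allI)
    fix a
    have "((\<lambda>B. B$a$a) \<longlongrightarrow> A$a$a) (at A)" by (intro tendsto_intros)
    from order_tendstoD(1)[OF this cle[of a]] show "\<forall>\<^sub>F B in at A. B$a$a \<ge> c"
      by eventually_elim simp
  qed
  have "((\<lambda>B. E_MATS T B *v v) \<longlongrightarrow> E_MATS T A *v v) (at A)" for v
  proof (rule Lim_null[THEN iffD2], rule Lim_null_comparison)
    let ?w = "E_MATS T A *v v"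
    show "\<forall>\<^sub>F B in at A. norm (E_MATS T B *v v - ?w) \<le> norm ((K A - K B) *v ?w) / c"
      using diag
    proof eventually_elim
      fix B :: "real^'n^'n" assume B: "\<forall>a. B$a$a \<ge> c"
      note cA = moore_penrose_compression[OF T c, of A, folded E_MATS_def K_def, OF less_imp_le[OF cle]]
      note cB = moore_penrose_compression[OF T c, of B, folded E_MATS_def K_def, OF B[rule_format]]
      have "E_MATS T B ** (K A - K B) ** E_MATS T A
          = E_MATS T B ** (K A ** E_MATS T A) - E_MATS T B ** K B ** E_MATS T A"
        by (simp add: matrix_mult_diff_right matrix_mul_assoc matrix_mult_diff_left)
      also have "\<dots> = E_MATS T B - E_MATS T A" using cA cB by simp
      finally have "E_MATS T B *v v - ?w = E_MATS T B *v ((K A - K B) *v ?w)"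
        by (metis matrix_vector_mul_assoc matrix_vector_mult_diff_rdistrib)
      then show "norm (E_MATS T B *v v - ?w) \<le> norm ((K A - K B) *v ?w) / c"
        using cB(6) by simp
    qed
    have "continuous_on UNIV (\<lambda>B. norm ((K A - K B) *v ?w) / c)"
      using c by (intro continuous_intros Kc) auto
    then have "isCont (\<lambda>B. norm ((K A - K B) *v ?w) / c) A"
      by (simp add: continuous_on_eq_continuous_at)
    then show "((\<lambda>B. norm ((K A - K B) *v ?w) / c) \<longlongrightarrow> 0) (at A)"
      by (simp add: isCont_def)
  qed
  then have "((\<lambda>B. (E_MATS T B *v axis j 1) $ i) \<longlongrightarrow> (E_MATS T A *v axis j 1) $ i) (at A)" for i j
    by (intro tendsto_vec_nth)
  then have "((\<lambda>B. E_MATS T B $ i $ j) \<longlongrightarrow> E_MATS T A $ i $ j) (at A)" for i j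
    by (simp add: matrix_vector_mul_component inner_axis)
  then show ?thesis
    unfolding isCont_def by (intro vec_tendstoI)
qed

lemma borel_measurable_E_ATS: "(E_ATS T :: real^'n^'n \<Rightarrow> _) \<in> borel_measurable borel"
proof -
  have "(\<lambda>A::real^'n^'n. trace (T ** A ** T)) \<in> borel_measurable borel"
    by (intro borel_measurable_continuous_onI continuous_intros)
  then show ?thesis unfolding E_ATS_def[abs_def] by measurable
qed

lemma borel_measurable_E_MATS: "(E_MATS T :: real^'n^'n \<Rightarrow> _) \<in> borel_measurable borel"
proof -
  have "(\<lambda>A::real^'n^'n. T ** diag_part A ** T) \<in> borel_measurable borel"
    by (intro borel_measurable_continuous_onI continuous_intros)
  from measurable_compose[OF this borel_measurable_moore_penrose]
  show ?thesis unfolding E_MATS_def[abs_def] .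
qed

lemma trace_mult_transpose:
  fixes M :: "real^'n^'m"
  shows "trace (M ** transpose M) = (\<Sum>i\<in>UNIV. \<Sum>j\<in>UNIV. (M $ i $ j)\<^sup>2)"
  by (simp add: trace_def matrix_matrix_mult_def transpose_def power2_eq_square)

lemma trace_mult_transpose_pos:
  fixes M :: "real^'n^'m"
  assumes "M \<noteq> 0"
  shows "trace (M ** transpose M) > 0"
proof -
  have "trace (M ** transpose M) \<noteq> 0"
  proof
    assume "trace (M ** transpose M) = 0"
    then have "M $ i $ j = 0" for i j
      by (auto simp: trace_mult_transpose sum_nonneg_eq_0_iff sum_nonneg)
    with assms show False by (auto simp: vec_eq_iff)
  qed
  moreover have "trace (M ** transpose M) \<ge> 0"
    by (simp add: trace_mult_transpose sum_nonneg)
  ultimately show ?thesis by simp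
qed

text \<open>With D the diagonal part, R = R D R and T R T = R turn the form into |D^(1/2) R v|^2, so
  B = D^(1/2) R. As D is invertible, B has the kernel of R, which is that of T. The kernel statement
  later separates hypothesis from alternative and rules out a degenerate limit.\<close>

lemma E_MATS_quadratic:
  fixes T A :: "real^'n^'n"
  assumes T: "transpose T = T" "T ** T = T" and pos: "\<And>a. A $ a $ a > 0"
  obtains B :: "real^'n^'n"
  where "\<And>v. (T *v v) \<bullet> (E_MATS T A *v (T *v v)) = (norm (B *v v))\<^sup>2"
    and "\<And>v. B *v v = 0 \<longleftrightarrow> T *v v = 0"
proof -
  define c where "c = Min (range (\<lambda>a. A$a$a))"
  have c: "c > 0" using pos by (simp add: c_def)
  have cle: "c \<le> A$a$a" for a by (simp add: c_def)
  let ?R = "E_MATS T A"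
  note R = moore_penrose_compression[OF T c, of A, folded E_MATS_def, OF cle]
  define B :: "real^'n^'n" where "B = (\<chi> a b. sqrt (A$a$a) * ?R$a$b)"
  have Bv: "(B *v v) $ a = sqrt (A$a$a) * (?R *v v)$a" for v a
    by (simp add: B_def matrix_vector_mult_def sum_distrib_left mult.assoc)
  show thesis
  proof (rule that)
    fix v
    let ?K = "T ** diag_part A ** T"
    have RKR: "?R = ?R ** (diag_part A ** ?R)"
    proof -
      have "?R ** (diag_part A ** ?R) = ?R ** ?K ** ?R" using R by (metis matrix_mul_assoc)
      then show ?thesis using R by simp
    qed
    have "(T *v v) \<bullet> (?R *v (T *v v)) = v \<bullet> ((T ** ?R ** T) *v v)"
      by (metis T(1) dot_lmul_matrix matrix_vector_mul_assoc transpose_matrix_vector)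
    also have "\<dots> = v \<bullet> (?R *v v)" using R by simp
    also have "\<dots> = v \<bullet> (?R *v (diag_part A *v (?R *v v)))"
      using RKR by (metis matrix_vector_mul_assoc)
    also have "\<dots> = (?R *v v) \<bullet> (diag_part A *v (?R *v v))"
      by (metis R(5) dot_lmul_matrix transpose_matrix_vector)
    also have "\<dots> = (norm (B *v v))\<^sup>2"
    proof -
      have "A$a$a * (w$a)\<^sup>2 = (sqrt (A$a$a) * w$a)\<^sup>2" for a and w :: "real^'n"
        using pos[of a] by (simp add: power_mult_distrib)
      then show ?thesis
        unfolding diag_part_quadratic
        unfolding power2_norm_eq_inner inner_vec_def Bv
        by (simp only: inner_real_def power2_eq_square)
    qed
    finally show "(T *v v) \<bullet> (?R *v (T *v v)) = (norm (B *v v))\<^sup>2" .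
    have "B *v v = 0 \<longleftrightarrow> ?R *v v = 0"
      using pos by (simp add: vec_eq_iff Bv less_imp_neq[symmetric])
    also have "\<dots> \<longleftrightarrow> T *v v = 0"
      by (metis R(2,3) matrix_vector_mul_assoc matrix_vector_mult_0_right)
    finally show "B *v v = 0 \<longleftrightarrow> T *v v = 0" .
  qed
qed

lemma E_ATS_quadratic:
  fixes T A :: "real^'n^'n"
  assumes "trace (T ** A ** T) > 0"
  obtains B :: "real^'n^'n"
  where "\<And>v. (T *v v) \<bullet> (E_ATS T A *v (T *v v)) = (norm (B *v v))\<^sup>2"
    and "\<And>v. B *v v = 0 \<longleftrightarrow> T *v v = 0"
proof -
  define s where "s = inverse (trace (T ** A ** T))"
  have s: "s > 0" using assms by (simp add: s_def)
  have sm: "(a *\<^sub>R C) *v v = a *\<^sub>R (C *v v)" for a :: real and C :: "real^'n^'n" and v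
    by (simp add: vec_eq_iff matrix_vector_mult_def sum_distrib_left mult.assoc)
  show thesis
    by (rule that[of "sqrt s *\<^sub>R T"])
      (use s in \<open>simp_all add: E_ATS_def s_def[symmetric] sm power_mult_distrib power2_norm_eq_inner\<close>)
qed

section \<open>Convergence in probability as a filter\<close>

definition with_prob_to_1 :: "'x filter \<Rightarrow> ('x \<Rightarrow> 'y measure) \<Rightarrow> ('x \<times> 'y \<Rightarrow> bool) \<Rightarrow> bool" where
  "with_prob_to_1 G Q P \<longleftrightarrow> (\<forall>\<delta>>0. \<forall>\<^sub>F x in G. \<exists>B\<in>sets (Q x). 1 - \<delta> \<le> measure (Q x) B \<and> (\<forall>y\<in>B. P (x, y)))"

text \<open>\<open>Abs_filter\<close> describes this family only if it satisfies the filter axioms;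
  for probability measures \<open>Q x\<close> it does, hence the locale \<open>prob_family\<close>
  and the lemma \<open>eventually_wp\<close>.\<close>

definition wp :: "'x filter \<Rightarrow> ('x \<Rightarrow> 'y measure) \<Rightarrow> ('x \<times> 'y) filter" where
  "wp G Q = Abs_filter (with_prob_to_1 G Q)"

text \<open>Boundedness in probability. It is not an \<open>eventually\<close> statement for
  \<open>wp\<close>, since the bound C may grow as \<delta> decreases;
  \<open>eventually_wp_tight\<close> links the two notions.\<close>

definition tight_wp ::
    "'x filter \<Rightarrow> ('x \<Rightarrow> 'y measure) \<Rightarrow> ('x \<times> 'y \<Rightarrow> 'b::real_normed_vector) \<Rightarrow> bool" where
  "tight_wp G Q Z \<longleftrightarrow>
     (\<forall>\<delta>>0. \<exists>C. \<forall>\<^sub>F x in G. \<exists>B\<in>sets (Q x). 1 - \<delta> \<le> measure (Q x) B \<and> (\<forall>y\<in>B. norm (Z (x, y)) \<le> C))"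

lemma (in prob_space) prob_Int_ge:
  assumes "A \<in> events" "B \<in> events" "1 - a \<le> prob A" "1 - b \<le> prob B"
  shows "1 - (a + b) \<le> prob (A \<inter> B)"
proof -
  have "prob (A \<union> B) = prob A + prob B - prob (A \<inter> B)"
    using assms measure_Un3[of A M B] by (simp add: fmeasurable_eq_sets)
  then show ?thesis using assms prob_le_1[of "A \<union> B"] by linarith
qed

locale prob_family =
  fixes Q :: "'x \<Rightarrow> 'y measure"
  assumes prob_space_Q: "prob_space (Q x)"
begin

lemma eventually_wp: "eventually P (wp G Q) \<longleftrightarrow> with_prob_to_1 G Q P"
  unfolding wp_def
proof (rule eventually_Abs_filter, rule is_filter.intro)
  show "with_prob_to_1 G Q (\<lambda>_. True)"
    unfolding with_prob_to_1_def
    by (auto intro!: always_eventually bexI[of _ "space (Q _)"] simp: prob_space.prob_space[OF prob_space_Q])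
next
  fix P P' assume P: "with_prob_to_1 G Q P" "with_prob_to_1 G Q P'"
  show "with_prob_to_1 G Q (\<lambda>z. P z \<and> P' z)"
    unfolding with_prob_to_1_def
  proof (intro allI impI)
    fix \<delta> :: real assume "\<delta> > 0"
    then have "\<delta> / 2 > 0" by simp
    with P have "\<forall>\<^sub>F x in G. \<exists>B\<in>sets (Q x). 1 - \<delta>/2 \<le> measure (Q x) B \<and> (\<forall>y\<in>B. P (x, y))"
      "\<forall>\<^sub>F x in G. \<exists>B\<in>sets (Q x). 1 - \<delta>/2 \<le> measure (Q x) B \<and> (\<forall>y\<in>B. P' (x, y))"
      unfolding with_prob_to_1_def by blast+
    then show "\<forall>\<^sub>F x in G. \<exists>B\<in>sets (Q x). 1 - \<delta> \<le> measure (Q x) B \<and> (\<forall>y\<in>B. P (x, y) \<and> P' (x, y))"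
    proof eventually_elim
      fix x
      assume "\<exists>B\<in>sets (Q x). 1 - \<delta>/2 \<le> measure (Q x) B \<and> (\<forall>y\<in>B. P (x, y))"
        "\<exists>B\<in>sets (Q x). 1 - \<delta>/2 \<le> measure (Q x) B \<and> (\<forall>y\<in>B. P' (x, y))"
      then obtain B B' where "B \<in> sets (Q x)" "1 - \<delta>/2 \<le> measure (Q x) B" "\<forall>y\<in>B. P (x, y)"
        "B' \<in> sets (Q x)" "1 - \<delta>/2 \<le> measure (Q x) B'" "\<forall>y\<in>B'. P' (x, y)" by blast
      then show "\<exists>B\<in>sets (Q x). 1 - \<delta> \<le> measure (Q x) B \<and> (\<forall>y\<in>B. P (x, y) \<and> P' (x, y))"
        using prob_space.prob_Int_ge[OF prob_space_Q, of B x B' "\<delta>/2" "\<delta>/2"]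
        by (intro bexI[of _ "B \<inter> B'"]) auto
    qed
  qed
next
  fix P P' :: "'x \<times> 'y \<Rightarrow> bool" assume "\<forall>z. P z \<longrightarrow> P' z" "with_prob_to_1 G Q P"
  then show "with_prob_to_1 G Q P'"
    unfolding with_prob_to_1_def by (blast intro: eventually_mono)
qed

lemma eventually_wpI:
  assumes "\<And>\<delta>. \<delta> > 0 \<Longrightarrow> \<forall>\<^sub>F x in G. \<exists>B\<in>sets (Q x). 1 - \<delta> \<le> measure (Q x) B \<and> (\<forall>y\<in>B. P (x, y))"
  shows "eventually P (wp G Q)"
  using assms by (auto simp: eventually_wp with_prob_to_1_def)

lemma eventually_wpD:
  assumes "eventually P (wp G Q)" "\<delta> > 0"
  shows "\<forall>\<^sub>F x in G. \<exists>B\<in>sets (Q x). 1 - \<delta> \<le> measure (Q x) B \<and> (\<forall>y\<in>B. P (x, y))"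
  using assms by (auto simp: eventually_wp with_prob_to_1_def)

lemma eventually_wp_fst:
  assumes "eventually P G"
  shows "\<forall>\<^sub>F z in wp G Q. P (fst z)"
proof (rule eventually_wpI)
  fix \<delta> :: real assume "\<delta> > 0"
  then show "\<forall>\<^sub>F x in G. \<exists>B\<in>sets (Q x). 1 - \<delta> \<le> measure (Q x) B \<and> (\<forall>y\<in>B. P (fst (x, y)))"
    using assms
    by (auto elim!: eventually_mono intro!: bexI[of _ "space (Q _)"]
        simp: prob_space.prob_space[OF prob_space_Q])
qed

lemma filterlim_fst_wp: "filterlim fst G (wp G Q)"
  unfolding filterlim_iff using eventually_wp_fst by blast

lemma eventually_wp_prob:
  assumes "eventually P (wp G Q)" "\<And>x. {y \<in> space (Q x). P (x, y)} \<in> sets (Q x)" "\<delta> > 0"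
  shows "\<forall>\<^sub>F x in G. 1 - \<delta> \<le> measure (Q x) {y \<in> space (Q x). P (x, y)}"
  using eventually_wpD[OF assms(1,3)]
proof eventually_elim
  fix x assume "\<exists>B\<in>sets (Q x). 1 - \<delta> \<le> measure (Q x) B \<and> (\<forall>y\<in>B. P (x, y))"
  then obtain B where B: "B \<in> sets (Q x)" "1 - \<delta> \<le> measure (Q x) B" "\<forall>y\<in>B. P (x, y)" by blast
  interpret prob_space "Q x" by (rule prob_space_Q)
  have "measure (Q x) B \<le> measure (Q x) {y \<in> space (Q x). P (x, y)}"
    using B sets.sets_into_space by (intro finite_measure_mono assms(2)) auto
  then show "1 - \<delta> \<le> measure (Q x) {y \<in> space (Q x). P (x, y)}" using B by simp
qed

lemma eventually_wp_if_prob: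
  assumes "((\<lambda>x. measure (Q x) {y \<in> space (Q x). \<not> P (x, y)}) \<longlongrightarrow> 0) G"
    and meas: "\<forall>\<^sub>F x in G. {y \<in> space (Q x). P (x, y)} \<in> sets (Q x)"
  shows "eventually P (wp G Q)"
proof (rule eventually_wpI)
  fix \<delta> :: real assume "\<delta> > 0"
  from order_tendstoD(2)[OF assms(1) this] meas
  show "\<forall>\<^sub>F x in G. \<exists>B\<in>sets (Q x). 1 - \<delta> \<le> measure (Q x) B \<and> (\<forall>y\<in>B. P (x, y))"
  proof eventually_elim
    fix x assume a: "measure (Q x) {y \<in> space (Q x). \<not> P (x, y)} < \<delta>"
      and b: "{y \<in> space (Q x). P (x, y)} \<in> sets (Q x)"
    interpret prob_space "Q x" by (rule prob_space_Q)
    show "\<exists>B\<in>sets (Q x). 1 - \<delta> \<le> measure (Q x) B \<and> (\<forall>y\<in>B. P (x, y))"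
      using b a prob_neg[OF b] by (intro bexI[OF _ b]) auto
  qed
qed

lemma tight_wpI_second_moment:
  fixes Z :: "'x \<times> 'y \<Rightarrow> real"
  assumes meas: "\<And>x. (\<lambda>y. Z (x, y)) \<in> borel_measurable (Q x)"
    and int: "\<And>x. integrable (Q x) (\<lambda>y. (Z (x, y))\<^sup>2)"
    and bound: "\<forall>\<^sub>F x in G. (\<integral>y. (Z (x, y))\<^sup>2 \<partial>Q x) \<le> K"
  shows "tight_wp G Q Z"
  unfolding tight_wp_def
proof (intro allI impI)
  fix \<delta> :: real assume \<delta>: "\<delta> > 0"
  \<comment> \<open>Chebyshev bounds the exceptional probability by K / C^2; using |K| + 1 keeps C
    positive.\<close>
  define C where "C = sqrt ((\<bar>K\<bar> + 1) / \<delta>)"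
  have C: "C > 0" "C\<^sup>2 = (\<bar>K\<bar> + 1) / \<delta>" using \<delta> by (auto simp: C_def)
  show "\<exists>C. \<forall>\<^sub>F x in G. \<exists>B\<in>sets (Q x). 1 - \<delta> \<le> measure (Q x) B \<and> (\<forall>y\<in>B. norm (Z (x, y)) \<le> C)"
    using bound
  proof (intro exI[of _ C], eventually_elim)
    fix x assume K: "(\<integral>y. (Z (x, y))\<^sup>2 \<partial>Q x) \<le> K"
    interpret prob_space "Q x" by (rule prob_space_Q)
    note [measurable] = meas[of x]
    let ?B = "{y \<in> space (Q x). \<not> C \<le> \<bar>Z (x, y)\<bar>}"
    have "prob {y \<in> space (Q x). C \<le> \<bar>Z (x, y)\<bar>} \<le> (\<integral>y. (Z (x, y))\<^sup>2 \<partial>Q x) / C\<^sup>2"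
      using second_moment_method[of "\<lambda>y. Z (x, y)" C] int[of x] C(1) meas[of x] by simp
    also have "\<dots> \<le> \<delta>"
    proof -
      have "(\<integral>y. (Z (x, y))\<^sup>2 \<partial>Q x) * \<delta> \<le> (\<bar>K\<bar> + 1) * \<delta>"
        using K \<delta> by (intro mult_right_mono) auto
      then show ?thesis unfolding C(2) using \<delta> by (simp add: field_simps)
    qed
    finally have "1 - \<delta> \<le> prob ?B" by (subst prob_neg) auto
    then show "\<exists>B\<in>sets (Q x). 1 - \<delta> \<le> measure (Q x) B \<and> (\<forall>y\<in>B. norm (Z (x, y)) \<le> C)"
      by (intro bexI[of _ ?B]) auto
  qed
qed

lemma tendsto_wpI_second_moment:
  fixes Z :: "'x \<times> 'y \<Rightarrow> real"
  assumes meas: "\<And>x. (\<lambda>y. Z (x, y)) \<in> borel_measurable (Q x)"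
    and int: "\<And>x. integrable (Q x) (\<lambda>y. (Z (x, y))\<^sup>2)"
    and lim: "((\<lambda>x. \<integral>y. (Z (x, y))\<^sup>2 \<partial>Q x) \<longlongrightarrow> 0) G"
  shows "(Z \<longlongrightarrow> 0) (wp G Q)"
proof (rule tendstoI, rule eventually_wpI)
  fix e \<delta> :: real assume e: "e > 0" and \<delta>: "\<delta> > 0"
  have "\<forall>\<^sub>F x in G. (\<integral>y. (Z (x, y))\<^sup>2 \<partial>Q x) < \<delta> * e\<^sup>2"
    using lim e \<delta> by (intro order_tendstoD(2)) auto
  then show "\<forall>\<^sub>F x in G. \<exists>B\<in>sets (Q x). 1 - \<delta> \<le> measure (Q x) B \<and> (\<forall>y\<in>B. dist (Z (x, y)) 0 < e)"
  proof eventually_elim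
    fix x assume K: "(\<integral>y. (Z (x, y))\<^sup>2 \<partial>Q x) < \<delta> * e\<^sup>2"
    interpret prob_space "Q x" by (rule prob_space_Q)
    note [measurable] = meas[of x]
    let ?B = "{y \<in> space (Q x). \<not> e \<le> \<bar>Z (x, y)\<bar>}"
    have "prob {y \<in> space (Q x). e \<le> \<bar>Z (x, y)\<bar>} \<le> (\<integral>y. (Z (x, y))\<^sup>2 \<partial>Q x) / e\<^sup>2"
      using second_moment_method[of "\<lambda>y. Z (x, y)" e] int[of x] e meas[of x] by simp
    also have "\<dots> \<le> \<delta>" using K e by (simp add: field_simps)
    finally have "1 - \<delta> \<le> prob ?B" by (subst prob_neg) auto
    then show "\<exists>B\<in>sets (Q x). 1 - \<delta> \<le> measure (Q x) B \<and> (\<forall>y\<in>B. dist (Z (x, y)) 0 < e)"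
      by (intro bexI[of _ ?B]) auto
  qed
qed

text \<open>Localisation: C is fixed before the limit is taken, so it suffices to control the events
  on which Z stays in a ball. Uniformity on bounded sets is exploited through this lemma.\<close>

lemma eventually_wp_tight:
  assumes Z: "tight_wp G Q Z" and P: "\<And>C. \<forall>\<^sub>F z in wp G Q. norm (Z z) \<le> C \<longrightarrow> P z"
  shows "eventually P (wp G Q)"
proof (rule eventually_wpI)
  fix \<delta> :: real assume \<delta>: "\<delta> > 0"
  then have d2: "\<delta>/2 > 0" by simp
  obtain C where C: "\<forall>\<^sub>F x in G. \<exists>B\<in>sets (Q x). 1 - \<delta>/2 \<le> measure (Q x) B \<and> (\<forall>y\<in>B. norm (Z (x, y)) \<le> C)"
    using Z d2 unfolding tight_wp_def by blast
  from C eventually_wpD[OF P[of C] d2]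
  show "\<forall>\<^sub>F x in G. \<exists>B\<in>sets (Q x). 1 - \<delta> \<le> measure (Q x) B \<and> (\<forall>y\<in>B. P (x, y))"
  proof eventually_elim
    fix x
    assume "\<exists>B\<in>sets (Q x). 1 - \<delta>/2 \<le> measure (Q x) B \<and> (\<forall>y\<in>B. norm (Z (x, y)) \<le> C)"
      "\<exists>B\<in>sets (Q x). 1 - \<delta>/2 \<le> measure (Q x) B \<and> (\<forall>y\<in>B. norm (Z (x, y)) \<le> C \<longrightarrow> P (x, y))"
    then obtain B B' where "B \<in> sets (Q x)" "1 - \<delta>/2 \<le> measure (Q x) B" "\<forall>y\<in>B. norm (Z (x, y)) \<le> C"
      "B' \<in> sets (Q x)" "1 - \<delta>/2 \<le> measure (Q x) B'" "\<forall>y\<in>B'. norm (Z (x, y)) \<le> C \<longrightarrow> P (x, y)"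
      by blast
    then show "\<exists>B\<in>sets (Q x). 1 - \<delta> \<le> measure (Q x) B \<and> (\<forall>y\<in>B. P (x, y))"
      using prob_space.prob_Int_ge[OF prob_space_Q, of B x B' "\<delta>/2" "\<delta>/2"]
      by (intro bexI[of _ "B \<inter> B'"]) auto
  qed
qed

section \<open>Calculus of families bounded in probability\<close>

lemma tight_wp_mono:
  assumes Z: "tight_wp G Q Z" and le: "\<And>C. \<exists>C'. \<forall>z. norm (Z z) \<le> C \<longrightarrow> norm (Z' z) \<le> C'"
  shows "tight_wp G Q Z'"
  unfolding tight_wp_def
proof (intro allI impI)
  fix \<delta> :: real assume "\<delta> > 0"
  then obtain C where C: "\<forall>\<^sub>F x in G. \<exists>B\<in>sets (Q x). 1 - \<delta> \<le> measure (Q x) B \<and> (\<forall>y\<in>B. norm (Z (x, y)) \<le> C)"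
    using Z unfolding tight_wp_def by blast
  obtain C' where "\<forall>z. norm (Z z) \<le> C \<longrightarrow> norm (Z' z) \<le> C'" using le by blast
  then show "\<exists>C. \<forall>\<^sub>F x in G. \<exists>B\<in>sets (Q x). 1 - \<delta> \<le> measure (Q x) B \<and> (\<forall>y\<in>B. norm (Z' (x, y)) \<le> C)"
    using eventually_mono[OF C] by (intro exI[of _ C']) (smt (verit, best) eventually_mono C)
qed

lemma tight_wp_add:
  assumes "tight_wp G Q Z" "tight_wp G Q Z'"
  shows "tight_wp G Q (\<lambda>z. Z z + Z' z)"
  unfolding tight_wp_def
proof (intro allI impI)
  fix \<delta> :: real assume "\<delta> > 0"
  then have d2: "\<delta>/2 > 0" by simp
  obtain C C' where
    C: "\<forall>\<^sub>F x in G. \<exists>B\<in>sets (Q x). 1 - \<delta>/2 \<le> measure (Q x) B \<and> (\<forall>y\<in>B. norm (Z (x, y)) \<le> C)" and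
    C': "\<forall>\<^sub>F x in G. \<exists>B\<in>sets (Q x). 1 - \<delta>/2 \<le> measure (Q x) B \<and> (\<forall>y\<in>B. norm (Z' (x, y)) \<le> C')"
    using assms d2 unfolding tight_wp_def by blast
  from C C'
  have "\<forall>\<^sub>F x in G. \<exists>B\<in>sets (Q x). 1 - \<delta> \<le> measure (Q x) B \<and> (\<forall>y\<in>B. norm (Z (x, y) + Z' (x, y)) \<le> C + C')"
  proof eventually_elim
    fix x
    assume "\<exists>B\<in>sets (Q x). 1 - \<delta>/2 \<le> measure (Q x) B \<and> (\<forall>y\<in>B. norm (Z (x, y)) \<le> C)"
      "\<exists>B\<in>sets (Q x). 1 - \<delta>/2 \<le> measure (Q x) B \<and> (\<forall>y\<in>B. norm (Z' (x, y)) \<le> C')"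
    then obtain B B' where "B \<in> sets (Q x)" "1 - \<delta>/2 \<le> measure (Q x) B" "\<forall>y\<in>B. norm (Z (x, y)) \<le> C"
      "B' \<in> sets (Q x)" "1 - \<delta>/2 \<le> measure (Q x) B'" "\<forall>y\<in>B'. norm (Z' (x, y)) \<le> C'"
      by blast
    then show "\<exists>B\<in>sets (Q x). 1 - \<delta> \<le> measure (Q x) B \<and> (\<forall>y\<in>B. norm (Z (x, y) + Z' (x, y)) \<le> C + C')"
      using prob_space.prob_Int_ge[OF prob_space_Q, of B x B' "\<delta>/2" "\<delta>/2"]
      by (intro bexI[of _ "B \<inter> B'"]) (auto intro: norm_triangle_mono)
  qed
  then show "\<exists>C. \<forall>\<^sub>F x in G. \<exists>B\<in>sets (Q x). 1 - \<delta> \<le> measure (Q x) B \<and> (\<forall>y\<in>B. norm (Z (x, y) + Z' (x, y)) \<le> C)"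
    by blast
qed

lemma tight_wp_const: "tight_wp G Q (\<lambda>z. c)"
  unfolding tight_wp_def
  by (auto intro!: exI[of _ "norm c"] always_eventually bexI[of _ "space (Q _)"]
      simp: prob_space.prob_space[OF prob_space_Q])

lemma tight_wp_sum:
  assumes "\<And>i. i \<in> I \<Longrightarrow> tight_wp G Q (Z i)"
  shows "tight_wp G Q (\<lambda>z. \<Sum>i\<in>I. Z i z)"
  using assms
  by (induction I rule: infinite_finite_induct) (auto intro: tight_wp_add tight_wp_const)

lemma tight_wp_vec:
  fixes Z :: "'x \<times> 'y \<Rightarrow> real^'n"
  assumes "\<And>i. tight_wp G Q (\<lambda>z. Z z $ i)"
  shows "tight_wp G Q Z"
proof -
  have "tight_wp G Q (\<lambda>z. \<bar>Z z $ i\<bar>)" for i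
    by (rule tight_wp_mono[OF assms[of i]]) auto
  then have "tight_wp G Q (\<lambda>z. \<Sum>i\<in>UNIV. \<bar>Z z $ i\<bar>)"
    by (rule tight_wp_sum)
  then show ?thesis
  proof (rule tight_wp_mono)
    fix C show "\<exists>C'. \<forall>z. norm (\<Sum>i\<in>UNIV. \<bar>Z z $ i\<bar>) \<le> C \<longrightarrow> norm (Z z) \<le> C'"
      using norm_le_l1_cart[of "Z _"] by (intro exI[of _ C]) (auto intro: order_trans simp: sum_nonneg)
  qed
qed

text \<open>Slutsky: o_P(1) times O_P(1) is o_P(1).\<close>

lemma tendsto_wp_tight_mult:
  fixes a :: "'x \<times> 'y \<Rightarrow> real" and Z :: "'x \<times> 'y \<Rightarrow> 'b::real_normed_vector"
  assumes a: "(a \<longlongrightarrow> 0) (wp G Q)" and Z: "tight_wp G Q Z"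
  shows "((\<lambda>z. a z *\<^sub>R Z z) \<longlongrightarrow> 0) (wp G Q)"
proof (rule tendstoI, rule eventually_wp_tight[OF Z])
  fix e C :: real assume e: "e > 0"
  have "((\<lambda>z. \<bar>a z\<bar> * \<bar>C\<bar>) \<longlongrightarrow> 0) (wp G Q)"
    using a by (auto intro!: tendsto_mult_left_zero tendsto_rabs_zero)
  from order_tendstoD(2)[OF this e]
  show "\<forall>\<^sub>F z in wp G Q. norm (Z z) \<le> C \<longrightarrow> dist (a z *\<^sub>R Z z) 0 < e"
  proof eventually_elim
    fix z assume *: "\<bar>a z\<bar> * \<bar>C\<bar> < e"
    show "norm (Z z) \<le> C \<longrightarrow> dist (a z *\<^sub>R Z z) 0 < e"
    proof
      assume "norm (Z z) \<le> C"
      then have "\<bar>a z\<bar> * norm (Z z) \<le> \<bar>a z\<bar> * \<bar>C\<bar>" by (intro mult_left_mono) auto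
      with * show "dist (a z *\<^sub>R Z z) 0 < e" by simp
    qed
  qed
qed

text \<open>Continuous mapping for a W without a limit: tightness confines W to a ball, the ball
  enlarged by 1 also contains Z, and there f is uniformly continuous.\<close>

lemma tendsto_wp_continuous_diff:
  fixes W Z :: "'x \<times> 'y \<Rightarrow> 'b::{real_normed_vector,heine_borel}" and f :: "'b \<Rightarrow> 'c::metric_space"
  assumes W: "tight_wp G Q W" and lim: "((\<lambda>z. Z z - W z) \<longlongrightarrow> 0) (wp G Q)"
    and f: "continuous_on UNIV f"
  shows "((\<lambda>z. dist (f (Z z)) (f (W z))) \<longlongrightarrow> 0) (wp G Q)"
proof (rule tendstoI, rule eventually_wp_tight[OF W])
  fix e C :: real assume e: "e > 0"
  let ?S = "cball (0::'b) (C + 1)"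
  have "uniformly_continuous_on ?S f"
    by (intro compact_uniformly_continuous continuous_on_subset[OF f]) auto
  then obtain d where d: "d > 0" "\<And>u v. u \<in> ?S \<Longrightarrow> v \<in> ?S \<Longrightarrow> dist v u < d \<Longrightarrow> dist (f v) (f u) < e"
    using e unfolding uniformly_continuous_on_def by metis
  have "\<forall>\<^sub>F z in wp G Q. dist (Z z - W z) 0 < min d 1"
    by (rule tendstoD[OF lim]) (use d in auto)
  then show "\<forall>\<^sub>F z in wp G Q. norm (W z) \<le> C \<longrightarrow> dist (dist (f (Z z)) (f (W z))) 0 < e"
  proof eventually_elim
    fix z assume *: "dist (Z z - W z) 0 < min d 1"
    show "norm (W z) \<le> C \<longrightarrow> dist (dist (f (Z z)) (f (W z))) 0 < e"
    proof
      assume C: "norm (W z) \<le> C"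
      have "norm (Z z) \<le> norm (W z) + norm (Z z - W z)" by (metis add.commute diff_add_cancel norm_triangle_ineq)
      then show "dist (dist (f (Z z)) (f (W z))) 0 < e"
        using d(2)[of "W z" "Z z"] C * by (auto simp: dist_norm)
    qed
  qed
qed

lemma tendsto_wp_integral:
  fixes Z :: "'x \<times> 'y \<Rightarrow> 'b::{banach,second_countable_topology}"
  assumes meas: "\<And>x. (\<lambda>y. Z (x, y)) \<in> borel_measurable (Q x)"
    and bound: "\<And>z. norm (Z z) \<le> K" and lim: "(Z \<longlongrightarrow> 0) (wp G Q)"
  shows "((\<lambda>x. \<integral>y. Z (x, y) \<partial>Q x) \<longlongrightarrow> 0) G"
proof (rule tendstoI)
  fix e :: real assume e: "e > 0"
  have K: "K \<ge> 0" using bound norm_ge_zero order_trans by blast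
  \<comment> \<open>Off the good event the integrand contributes at most
    \<open>K * \<delta>\<close>; the summand 1 avoids a division by zero for K = 0.\<close>
  define \<delta> where "\<delta> = e / (4 * (K + 1))"
  have \<delta>: "\<delta> > 0" using e K by (simp add: \<delta>_def)
  have Kd: "K * \<delta> \<le> e / 4"
  proof -
    have "K * \<delta> \<le> (K + 1) * \<delta>" using \<delta> by simp
    also have "\<dots> = e / 4" using K by (simp add: \<delta>_def field_simps)
    finally show ?thesis .
  qed
  have "\<forall>\<^sub>F z in wp G Q. dist (Z z) 0 < e / 2" by (rule tendstoD[OF lim]) (use e in simp)
  from eventually_wpD[OF this \<delta>]
  show "\<forall>\<^sub>F x in G. dist (\<integral>y. Z (x, y) \<partial>Q x) 0 < e"
  proof eventually_elim
    fix x assume "\<exists>B\<in>sets (Q x). 1 - \<delta> \<le> measure (Q x) B \<and> (\<forall>y\<in>B. dist (Z (x, y)) 0 < e / 2)"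
    then obtain B where B [measurable]: "B \<in> sets (Q x)" and B': "1 - \<delta> \<le> measure (Q x) B"
      "\<And>y. y \<in> B \<Longrightarrow> norm (Z (x, y)) < e / 2" by auto
    interpret prob_space "Q x" by (rule prob_space_Q)
    have "norm (\<integral>y. Z (x, y) \<partial>Q x) \<le> (\<integral>y. norm (Z (x, y)) \<partial>Q x)"
      by (rule integral_norm_bound)
    also have "\<dots> \<le> (\<integral>y. e / 2 + K * indicator (space (Q x) - B) y \<partial>Q x)"
    proof (rule integral_mono)
      show "integrable (Q x) (\<lambda>y. norm (Z (x, y)))"
        by (rule integrable_const_bound[of _ K]) (use meas bound in auto)
      show "norm (Z (x, y)) \<le> e / 2 + K * indicator (space (Q x) - B) y" if "y \<in> space (Q x)" for y
        using that B'(2)[of y] bound[of "(x, y)"] e by (cases "y \<in> B") auto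
      show "integrable (Q x) (\<lambda>y. e / 2 + K * indicator (space (Q x) - B) y)"
        by (intro Bochner_Integration.integrable_add integrable_mult_right integrable_real_indicator)
          (auto simp: emeasure_eq_measure)
    qed
    also have "\<dots> = e / 2 + K * measure (Q x) (space (Q x) - B)"
      by (subst Bochner_Integration.integral_add)
        (auto intro!: integrable_mult_right integrable_real_indicator simp: prob_space emeasure_eq_measure)
    also have "\<dots> \<le> e / 2 + K * \<delta>"
      using B' K by (intro add_left_mono mult_left_mono) (auto simp: prob_compl)
    also have "\<dots> < e" using Kd e by simp
    finally show "dist (\<integral>y. Z (x, y) \<partial>Q x) 0 < e" by simp
  qed
qed

end

section \<open>From Laplace transforms to distribution functions of quadratic forms\<close>

lemma (in prob_space) norm_expectation_le:
  fixes f :: "'a \<Rightarrow> 'b::{banach,second_countable_topology}"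
  assumes "integrable M f" "\<And>y. norm (f y) \<le> c"
  shows "norm (expectation f) \<le> c"
proof -
  have "norm (expectation f) \<le> (\<integral>y. norm (f y) \<partial>M)" by (rule integral_norm_bound)
  also have "\<dots> \<le> (\<integral>y. c \<partial>M)" using assms by (intro integral_mono integrable_norm) auto
  finally show ?thesis by (simp add: prob_space)
qed

lemma borel_measurable_vec_lambda:
  fixes f :: "'n::finite \<Rightarrow> 'a \<Rightarrow> real"
  assumes "\<And>i. f i \<in> borel_measurable M"
  shows "(\<lambda>x. \<chi> i. f i x) \<in> borel_measurable M"
proof -
  have "(\<lambda>x. \<chi> i. f i x) = (\<lambda>x. \<Sum>i\<in>UNIV. f i x *\<^sub>R axis i 1)"
    by (auto simp: vec_eq_iff axis_def if_distrib cong: if_cong)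
  then show ?thesis using assms by simp
qed

lemma borel_measurable_vec_nth [measurable (raw)]:
  fixes f :: "'a \<Rightarrow> real^'n"
  assumes "f \<in> borel_measurable M"
  shows "(\<lambda>x. f x $ i) \<in> borel_measurable M"
  by (rule measurable_compose[OF assms])
    (intro borel_measurable_continuous_onI continuous_intros)

lemma borel_measurable_matrix_vector_mult [measurable (raw)]:
  fixes f :: "'a \<Rightarrow> real^'n" and A :: "'a \<Rightarrow> real^'n^'m"
  assumes "A \<in> borel_measurable M" "f \<in> borel_measurable M"
  shows "(\<lambda>x. A x *v f x) \<in> borel_measurable M"
proof -
  have "(\<lambda>z :: (real^'n^'m) \<times> (real^'n). fst z *v snd z) \<in> borel_measurable borel"
    by (intro borel_measurable_continuous_onI continuous_intros)
  from measurable_compose[OF borel_measurable_Pair[OF assms] this] show ?thesis by simp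
qed

definition std_gauss :: "('n::finite \<Rightarrow> real) measure" where
  "std_gauss = PiM UNIV (\<lambda>_. std_normal_distribution)"

lemma prob_space_std_gauss: "prob_space (std_gauss :: ('n::finite \<Rightarrow> real) measure)"
  unfolding std_gauss_def by (intro prob_space_PiM prob_space_normal_density) simp

lemma space_std_gauss [simp]: "space std_gauss = UNIV"
  by (simp add: std_gauss_def space_PiM)

lemma borel_measurable_std_gauss_vec [measurable]:
  "(\<lambda>g::'n::finite \<Rightarrow> real. \<chi> i. g i) \<in> borel_measurable std_gauss"
proof (rule borel_measurable_vec_lambda)
  fix i :: 'n
  have "(\<lambda>g. g i) \<in> measurable std_gauss std_normal_distribution"
    unfolding std_gauss_def by (rule measurable_component_singleton) simp
  then show "(\<lambda>g. g i) \<in> borel_measurable std_gauss" by simp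
qed

lemma char_std_gauss:
  fixes t :: "real^'n"
  shows "(CLINT g|std_gauss. iexp (t \<bullet> (\<chi> i. g i))) = complex_of_real (exp (- (norm t)\<^sup>2 / 2))"
proof -
  interpret product_sigma_finite "\<lambda>_::'n. std_normal_distribution"
    by (rule product_sigma_finite.intro)
      (intro prob_space_imp_sigma_finite prob_space_normal_density, simp)
  interpret N: prob_space std_normal_distribution by (intro prob_space_normal_density) simp
  have "iexp (t \<bullet> (\<chi> i. g i)) = (\<Prod>i\<in>UNIV. iexp (t$i * g i))" for g
    by (simp add: inner_vec_def exp_sum[symmetric] sum_distrib_left)
  then have "(CLINT g|std_gauss. iexp (t \<bullet> (\<chi> i. g i)))
      = (\<Prod>i\<in>UNIV. CLINT x|std_normal_distribution. iexp (t$i * x))"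
    unfolding std_gauss_def
    by (simp only:) (rule product_integral_prod, auto intro!: N.integrable_const_bound[of _ 1])
  also have "\<dots> = (\<Prod>i\<in>UNIV. complex_of_real (exp (- (t$i)\<^sup>2 / 2)))"
    using char_std_normal_distribution by (simp add: char_def fun_eq_iff)
  also have "\<dots> = complex_of_real (exp (\<Sum>i\<in>UNIV. - (t$i)\<^sup>2 / 2))"
    by (simp add: exp_sum)
  also have "(\<Sum>i\<in>UNIV. - (t$i)\<^sup>2 / 2) = - (norm t)\<^sup>2 / 2"
    unfolding power2_norm_eq_inner inner_vec_def
    by (simp add: power2_eq_square sum_divide_distrib sum_negf)
  finally show ?thesis .
qed

text \<open>Linearisation of the square by an auxiliary Gaussian vector (Hubbard--Stratonovich).\<close>

lemma laplace_quadratic_eq_char: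
  fixes V :: "'y \<Rightarrow> real^'n" and B :: "real^'n^'m"
  assumes M: "prob_space M" and V [measurable]: "V \<in> borel_measurable M" and r: "r \<ge> 0"
  shows "complex_of_real (\<integral>y. exp (- (r * (norm (B *v V y))\<^sup>2 / 2)) \<partial>M)
    = (CLINT g|std_gauss. CLINT y|M. iexp ((sqrt r *\<^sub>R (transpose B *v (\<chi> i. g i))) \<bullet> V y))"
proof -
  interpret M: prob_space M by (rule M)
  interpret g: prob_space "std_gauss :: ('m \<Rightarrow> real) measure" by (rule prob_space_std_gauss)
  interpret pair_prob_space M "std_gauss :: ('m \<Rightarrow> real) measure" ..
  let ?f = "\<lambda>y g. iexp ((sqrt r *\<^sub>R (transpose B *v (\<chi> i. g i))) \<bullet> V y)"
  have sw: "(sqrt r *\<^sub>R (transpose B *v u)) \<bullet> v = (sqrt r *\<^sub>R (B *v v)) \<bullet> u" for u v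
    by (metis dot_lmul_matrix inner_commute inner_scaleR_left transpose_matrix_vector transpose_transpose)
  have "complex_of_real (\<integral>y. exp (- (r * (norm (B *v V y))\<^sup>2 / 2)) \<partial>M)
      = (CLINT y|M. complex_of_real (exp (- (norm (sqrt r *\<^sub>R (B *v V y)))\<^sup>2 / 2)))"
    using r by (subst integral_complex_of_real) (simp add: power_mult_distrib)
  also have "\<dots> = (CLINT y|M. CLINT g|std_gauss. ?f y g)"
    by (simp only: char_std_gauss[symmetric] sw)
  also have "\<dots> = (CLINT g|std_gauss. CLINT y|M. ?f y g)"
  proof (rule Fubini_integral[symmetric])
    have "(\<lambda>z. ?f (fst z) (snd z)) \<in> borel_measurable (M \<Otimes>\<^sub>M (std_gauss :: ('m \<Rightarrow> real) measure))"
      by measurable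
    then show "integrable (M \<Otimes>\<^sub>M std_gauss) (\<lambda>(y, g). ?f y g)"
      unfolding case_prod_unfold by (intro P.integrable_const_bound[of _ 1]) auto
  qed
  finally show ?thesis .
qed

text \<open>A single random vector is bounded in probability, by continuity of the measure along
  growing balls. Applied to the auxiliary Gaussian vector.\<close>

lemma tight_wp_snd:
  fixes V :: "'y \<Rightarrow> 'b::real_normed_vector"
  assumes M: "prob_space M" and V [measurable]: "V \<in> borel_measurable M"
  shows "tight_wp G (\<lambda>_. M) (\<lambda>z. V (snd z))"
  unfolding tight_wp_def
proof (intro allI impI)
  fix \<delta> :: real assume \<delta>: "\<delta> > 0"
  interpret prob_space M by (rule M)
  let ?B = "\<lambda>n::nat. {y \<in> space M. norm (V y) \<le> real n}"
  have "(\<lambda>n. prob (?B n)) \<longlonglongrightarrow> prob (\<Union>n. ?B n)"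
    by (intro finite_Lim_measure_incseq) (auto simp: incseq_def)
  also have "(\<Union>n. ?B n) = space M" using real_arch_simple by auto
  finally have "(\<lambda>n. prob (?B n)) \<longlonglongrightarrow> 1" by (simp add: prob_space)
  from order_tendstoD(1)[OF this, of "1 - \<delta>"] \<delta> obtain n where "1 - \<delta> < prob (?B n)"
    by (auto simp: eventually_sequentially)
  then have "\<exists>B\<in>events. 1 - \<delta> \<le> prob B \<and> (\<forall>y\<in>B. norm (V (snd (x, y))) \<le> real n)" for x :: 'c
    by (intro bexI[of _ "?B n"]) auto
  then show "\<exists>C. \<forall>\<^sub>F x in G. \<exists>B\<in>events. 1 - \<delta> \<le> prob B \<and> (\<forall>y\<in>B. norm (V (snd (x, y))) \<le> C)"
    by (intro exI[of _ "real n"] always_eventually) auto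
qed

context prob_family
begin

text \<open>The Laplace transform is the average of the characteristic function over the random
  argument \<tau>. In place of dominated convergence, \<tau> is tight and the characteristic
  functions, bounded by 1, converge uniformly on balls. So their difference tends to 0 along the
  filter of the auxiliary measure, and its integral follows.\<close>

lemma laplace_quadratic_tendsto:
  fixes W :: "'x \<times> 'y \<Rightarrow> real^'n" and L :: "real^'h^'n" and B :: "real^'n^'m"
  assumes W [measurable]: "\<And>x. (\<lambda>y. W (x, y)) \<in> borel_measurable (Q x)"
    and char: "\<And>C e. e > 0 \<Longrightarrow> \<forall>\<^sub>F x in G. \<forall>t. norm t \<le> C \<longrightarrow>
      cmod ((CLINT y|Q x. iexp (t \<bullet> W (x, y))) - exp (- (norm (transpose L *v t))\<^sup>2 / 2)) < e"
    and r: "r \<ge> 0"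
  shows "((\<lambda>x. \<integral>y. exp (- (r * (norm (B *v W (x, y)))\<^sup>2 / 2)) \<partial>Q x)
    \<longlongrightarrow> (\<integral>h. exp (- (r * (norm (B *v (L *v (\<chi> i. h i))))\<^sup>2 / 2)) \<partial>std_gauss)) G"
proof -
  let ?\<gamma> = "std_gauss :: ('m \<Rightarrow> real) measure"
  interpret g: prob_space ?\<gamma> by (rule prob_space_std_gauss)
  interpret \<gamma>: prob_family "\<lambda>_::'x. ?\<gamma>"
    by (rule prob_family.intro) (rule prob_space_std_gauss)
  define \<tau> where "\<tau> g = sqrt r *\<^sub>R (transpose B *v (\<chi> i. g i))" for g :: "'m \<Rightarrow> real"
  have \<tau> [measurable]: "\<tau> \<in> borel_measurable ?\<gamma>" unfolding \<tau>_def by measurable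
  define \<phi> where "\<phi> x t = (CLINT y|Q x. iexp (t \<bullet> W (x, y)))" for x t
  define \<phi>0 where "\<phi>0 t = (CLINT h|std_gauss. iexp (t \<bullet> (L *v (\<chi> i. h i))))" for t
  have \<phi>0: "\<phi>0 t = complex_of_real (exp (- (norm (transpose L *v t))\<^sup>2 / 2))" for t
  proof -
    have "t \<bullet> (L *v u) = (transpose L *v t) \<bullet> u" for u
      by (simp add: dot_lmul_matrix)
    then show ?thesis unfolding \<phi>0_def by (simp only: char_std_gauss)
  qed
  have tight: "tight_wp G (\<lambda>_. ?\<gamma>) (\<lambda>z. \<tau> (snd z))"
    by (rule tight_wp_snd) (rule prob_space_std_gauss, measurable)
  have b1: "cmod (\<phi> x t) \<le> 1" for x t
  proof -
    interpret prob_space "Q x" by (rule prob_space_Q)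
    have "cmod (\<phi> x t) \<le> (\<integral>y. cmod (iexp (t \<bullet> W (x, y))) \<partial>Q x)"
      unfolding \<phi>_def by (rule integral_norm_bound)
    then show ?thesis by (simp add: prob_space)
  qed
  have b0: "cmod (\<phi>0 t) \<le> 1" for t by (simp add: \<phi>0)
  have m1: "(\<lambda>g. \<phi> x (\<tau> g)) \<in> borel_measurable ?\<gamma>" for x
  proof -
    interpret prob_space "Q x" by (rule prob_space_Q)
    show ?thesis unfolding \<phi>_def
      by (rule borel_measurable_lebesgue_integral) (simp add: case_prod_unfold)
  qed
  have m0: "(\<lambda>g. \<phi>0 (\<tau> g)) \<in> borel_measurable ?\<gamma>"
    unfolding \<phi>0 by measurable
  have "((\<lambda>x. CLINT g|?\<gamma>. \<phi> x (\<tau> g) - \<phi>0 (\<tau> g)) \<longlongrightarrow> 0) G"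
  proof -
    have "((\<lambda>x. CLINT g|?\<gamma>. (\<lambda>z. \<phi> (fst z) (\<tau> (snd z)) - \<phi>0 (\<tau> (snd z))) (x, g)) \<longlongrightarrow> 0) G"
    proof (rule \<gamma>.tendsto_wp_integral)
      fix x show "(\<lambda>y. \<phi> (fst (x, y)) (\<tau> (snd (x, y))) - \<phi>0 (\<tau> (snd (x, y)))) \<in> borel_measurable ?\<gamma>"
        using m1 m0 by simp
    next
      fix z :: "'x \<times> ('m \<Rightarrow> real)"
      show "cmod (\<phi> (fst z) (\<tau> (snd z)) - \<phi>0 (\<tau> (snd z))) \<le> 2"
        using b1[of "fst z" "\<tau> (snd z)"] b0[of "\<tau> (snd z)"]
          norm_triangle_ineq4[of "\<phi> (fst z) (\<tau> (snd z))" "\<phi>0 (\<tau> (snd z))"]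
        by linarith
    next
      show "((\<lambda>z. \<phi> (fst z) (\<tau> (snd z)) - \<phi>0 (\<tau> (snd z))) \<longlongrightarrow> 0) (wp G (\<lambda>_. ?\<gamma>))"
      proof (rule tendstoI, rule \<gamma>.eventually_wp_tight[OF tight])
        fix e C :: real assume "e > 0"
        from \<gamma>.eventually_wp_fst[OF char[OF this, of C]]
        show "\<forall>\<^sub>F z in wp G (\<lambda>_. ?\<gamma>). norm (\<tau> (snd z)) \<le> C \<longrightarrow>
            dist (\<phi> (fst z) (\<tau> (snd z)) - \<phi>0 (\<tau> (snd z))) 0 < e"
          by eventually_elim (simp add: \<phi>_def \<phi>0)
      qed
    qed
    then show ?thesis by simp
  qed
  also have "(\<lambda>x. CLINT g|?\<gamma>. \<phi> x (\<tau> g) - \<phi>0 (\<tau> g))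
      = (\<lambda>x. (CLINT g|?\<gamma>. \<phi> x (\<tau> g)) - (CLINT g|?\<gamma>. \<phi>0 (\<tau> g)))"
  proof (intro ext Bochner_Integration.integral_diff)
    show "integrable ?\<gamma> (\<lambda>g. \<phi> x (\<tau> g))" for x
      using m1 b1 by (intro g.integrable_const_bound[of _ 1]) auto
    show "integrable ?\<gamma> (\<lambda>g. \<phi>0 (\<tau> g))"
      using m0 by (intro g.integrable_const_bound[of _ 1]) (auto simp: \<phi>0)
  qed
  also have "(\<lambda>x. CLINT g|?\<gamma>. \<phi> x (\<tau> g))
      = (\<lambda>x. complex_of_real (\<integral>y. exp (- (r * (norm (B *v W (x, y)))\<^sup>2 / 2)) \<partial>Q x))"
    unfolding \<phi>_def \<tau>_def
    by (intro ext laplace_quadratic_eq_char[symmetric] prob_space_Q W r)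
  also have "(CLINT g|?\<gamma>. \<phi>0 (\<tau> g))
      = complex_of_real (\<integral>h. exp (- (r * (norm (B *v (L *v (\<chi> i. h i))))\<^sup>2 / 2)) \<partial>std_gauss)"
    unfolding \<phi>0_def \<tau>_def
    by (intro laplace_quadratic_eq_char[symmetric] prob_space_std_gauss r) measurable
  finally show ?thesis
    by (simp only: Lim_null[symmetric] tendsto_of_real_iff)
qed

text \<open>Hausdorff's moment argument: moments control polynomials, and polynomials approximate h
  uniformly on the unit interval. No mass can escape from a compact interval, so this works along
  any filter.\<close>

lemma integral_tendsto_if_moments_tendsto:
  fixes Z :: "'x \<times> 'y \<Rightarrow> real" and Z0 :: "'z \<Rightarrow> real"
  assumes Z [measurable]: "\<And>x. (\<lambda>y. Z (x, y)) \<in> borel_measurable (Q x)" and Z01: "\<And>z. Z z \<in> {0..1}"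
    and Q0: "prob_space Q0" and Z0 [measurable]: "Z0 \<in> borel_measurable Q0" and Z001: "\<And>z. Z0 z \<in> {0..1}"
    and mom: "\<And>m. ((\<lambda>x. \<integral>y. Z (x, y) ^ m \<partial>Q x) \<longlongrightarrow> (\<integral>y. Z0 y ^ m \<partial>Q0)) G"
    and h: "continuous_on UNIV (h :: real \<Rightarrow> real)"
  shows "((\<lambda>x. \<integral>y. h (Z (x, y)) \<partial>Q x) \<longlongrightarrow> (\<integral>y. h (Z0 y) \<partial>Q0)) G"
proof (rule tendstoI)
  fix e :: real assume e: "e > 0"
  interpret Q0: prob_space Q0 by (rule Q0)
  have h': "continuous_on {0..1} h" using h by (rule continuous_on_subset) simp
  have [measurable]: "h \<in> borel_measurable borel" using h by (rule borel_measurable_continuous_onI)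
  obtain P where P: "real_polynomial_function P" "\<And>u. u \<in> {0..1} \<Longrightarrow> \<bar>h u - P u\<bar> < e / 3"
    using Stone_Weierstrass_real_polynomial_function[of "{0..1}" h "e/3"] h' e by auto
  obtain a n where Pa: "P = (\<lambda>u. \<Sum>i\<le>n. a i * u ^ i)"
    using P(1) by (auto simp: real_polynomial_function_iff_sum)
  have [measurable]: "P \<in> borel_measurable borel" unfolding Pa by measurable
  \<comment> \<open>Used twice, for the array and for the limit; with the error of the polynomial
    integrals this makes three parts of e / 3.\<close>
  have close: "\<bar>(\<integral>y. h (V y) \<partial>M) - (\<integral>y. P (V y) \<partial>M)\<bar> \<le> e / 3 \<and>
      (\<integral>y. P (V y) \<partial>M) = (\<Sum>i\<le>n. a i * (\<integral>y. V y ^ i \<partial>M))"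
    if M: "prob_space M" and V [measurable]: "V \<in> borel_measurable M" and V01: "\<And>y. V y \<in> {0..1}"
    for M :: "'w measure" and V
  proof -
    interpret M: prob_space M by (rule M)
    have i1: "integrable M (\<lambda>y. V y ^ i)" for i
      using V01 by (intro M.integrable_const_bound[of _ 1]) (auto simp: power_le_one)
    have iP: "integrable M (\<lambda>y. P (V y))"
      unfolding Pa by (intro Bochner_Integration.integrable_sum integrable_mult_right i1)
    have "bounded (h ` {0..1})"
      using h' by (intro compact_imp_bounded compact_continuous_image) auto
    then obtain K where "\<And>u. u \<in> {0..1} \<Longrightarrow> norm (h u) \<le> K" unfolding bounded_iff by blast
    then have ih: "integrable M (\<lambda>y. h (V y))"
      using V01 by (intro M.integrable_const_bound[of _ K]) auto
    have "\<bar>(\<integral>y. h (V y) \<partial>M) - (\<integral>y. P (V y) \<partial>M)\<bar> = \<bar>\<integral>y. h (V y) - P (V y) \<partial>M\<bar>"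
      using ih iP by simp
    also have "\<dots> \<le> e / 3"
      using M.norm_expectation_le[of "\<lambda>y. h (V y) - P (V y)" "e / 3"] ih iP P(2)[OF V01]
      by (simp add: less_imp_le)
    finally have "\<bar>(\<integral>y. h (V y) \<partial>M) - (\<integral>y. P (V y) \<partial>M)\<bar> \<le> e / 3" .
    then show ?thesis using i1 by (simp add: Pa)
  qed
  have "((\<lambda>x. \<integral>y. P (Z (x, y)) \<partial>Q x) \<longlongrightarrow> (\<integral>y. P (Z0 y) \<partial>Q0)) G"
  proof -
    have "(\<integral>y. P (Z (x, y)) \<partial>Q x) = (\<Sum>i\<le>n. a i * (\<integral>y. Z (x, y) ^ i \<partial>Q x))" for x
      using close[OF prob_space_Q Z Z01] by blast
    moreover have "(\<integral>y. P (Z0 y) \<partial>Q0) = (\<Sum>i\<le>n. a i * (\<integral>y. Z0 y ^ i \<partial>Q0))"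
      using close[OF Q0 Z0 Z001] by blast
    ultimately show ?thesis by (simp only:) (intro tendsto_sum tendsto_mult_left mom)
  qed
  then have "\<forall>\<^sub>F x in G. dist (\<integral>y. P (Z (x, y)) \<partial>Q x) (\<integral>y. P (Z0 y) \<partial>Q0) < e / 3"
    by (rule tendstoD) (use e in simp)
  then show "\<forall>\<^sub>F x in G. dist (\<integral>y. h (Z (x, y)) \<partial>Q x) (\<integral>y. h (Z0 y) \<partial>Q0) < e"
  proof eventually_elim
    fix x assume "dist (\<integral>y. P (Z (x, y)) \<partial>Q x) (\<integral>y. P (Z0 y) \<partial>Q0) < e / 3"
    then show "dist (\<integral>y. h (Z (x, y)) \<partial>Q x) (\<integral>y. h (Z0 y) \<partial>Q0) < e"
      using close[OF prob_space_Q Z Z01, of x] close[OF Q0 Z0 Z001]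
      unfolding dist_real_def by linarith
  qed
qed

text \<open>A continuous ramp rising from a to b lies between the indicators of the two half-lines.
  Two thresholds instead of one make the comparison valid even where the limit law has an
  atom.\<close>

lemma prob_ge_eventually_if_moments_tendsto:
  fixes Z :: "'x \<times> 'y \<Rightarrow> real" and Z0 :: "'z \<Rightarrow> real"
  assumes Z [measurable]: "\<And>x. (\<lambda>y. Z (x, y)) \<in> borel_measurable (Q x)" and Z01: "\<And>z. Z z \<in> {0..1}"
    and Q0: "prob_space Q0" and Z0 [measurable]: "Z0 \<in> borel_measurable Q0" and Z001: "\<And>z. Z0 z \<in> {0..1}"
    and mom: "\<And>m. ((\<lambda>x. \<integral>y. Z (x, y) ^ m \<partial>Q x) \<longlongrightarrow> (\<integral>y. Z0 y ^ m \<partial>Q0)) G"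
    and ab: "a < b" and e: "e > 0"
  shows "\<forall>\<^sub>F x in G. measure (Q x) {y \<in> space (Q x). b \<le> Z (x, y)} < measure Q0 {y \<in> space Q0. a \<le> Z0 y} + e"
    and "\<forall>\<^sub>F x in G. measure (Q x) {y \<in> space (Q x). a \<le> Z (x, y)} > measure Q0 {y \<in> space Q0. b \<le> Z0 y} - e"
proof -
  interpret Q0: prob_space Q0 by (rule Q0)
  define h where "h u = min 1 (max 0 ((u - a) / (b - a)))" for u
  have h: "continuous_on UNIV h" unfolding h_def using ab by (intro continuous_intros) auto
  have [measurable]: "h \<in> borel_measurable borel" using h by (rule borel_measurable_continuous_onI)
  have h01: "\<bar>h u\<bar> \<le> 1" for u by (simp add: h_def)
  have hu: "indicator {b..} u \<le> h u" "h u \<le> indicator {a..} u" for u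
    using ab by (auto simp: h_def indicator_def min_def max_def field_simps)
  have sandwich: "measure M {y \<in> space M. b \<le> V y} \<le> (\<integral>y. h (V y) \<partial>M) \<and>
      (\<integral>y. h (V y) \<partial>M) \<le> measure M {y \<in> space M. a \<le> V y}"
    if M: "prob_space M" and V [measurable]: "V \<in> borel_measurable M"
    for M :: "'w measure" and V
  proof -
    interpret M: prob_space M by (rule M)
    have ind: "measure M {y \<in> space M. c \<le> V y} = (\<integral>y. (indicator {c..} (V y) :: real) \<partial>M)" for c
    proof -
      have "(\<integral>y. (indicator {c..} (V y) :: real) \<partial>M) = (\<integral>y. indicator {y \<in> space M. c \<le> V y} y \<partial>M)"
        by (intro Bochner_Integration.integral_cong) (auto simp: indicator_def)
      then show ?thesis by simp
    qed
    have i: "integrable M (\<lambda>y. indicator {c..} (V y) :: real)" for c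
      by (intro M.integrable_const_bound[of _ 1]) auto
    have ih: "integrable M (\<lambda>y. h (V y))"
      using h01 by (intro M.integrable_const_bound[of _ 1]) auto
    show ?thesis unfolding ind by (intro conjI integral_mono i ih hu)
  qed
  have lim: "((\<lambda>x. \<integral>y. h (Z (x, y)) \<partial>Q x) \<longlongrightarrow> (\<integral>y. h (Z0 y) \<partial>Q0)) G"
    by (rule integral_tendsto_if_moments_tendsto) (use assms h in auto)
  from order_tendstoD(2)[OF lim, of "(\<integral>y. h (Z0 y) \<partial>Q0) + e"] e
  have "\<forall>\<^sub>F x in G. (\<integral>y. h (Z (x, y)) \<partial>Q x) < (\<integral>y. h (Z0 y) \<partial>Q0) + e" by simp
  then show "\<forall>\<^sub>F x in G. measure (Q x) {y \<in> space (Q x). b \<le> Z (x, y)} < measure Q0 {y \<in> space Q0. a \<le> Z0 y} + e"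
  proof eventually_elim
    fix x assume "(\<integral>y. h (Z (x, y)) \<partial>Q x) < (\<integral>y. h (Z0 y) \<partial>Q0) + e"
    then show "measure (Q x) {y \<in> space (Q x). b \<le> Z (x, y)} < measure Q0 {y \<in> space Q0. a \<le> Z0 y} + e"
      using sandwich[OF prob_space_Q Z, of x] sandwich[OF Q0 Z0] by linarith
  qed
  from order_tendstoD(1)[OF lim, of "(\<integral>y. h (Z0 y) \<partial>Q0) - e"] e
  have "\<forall>\<^sub>F x in G. (\<integral>y. h (Z (x, y)) \<partial>Q x) > (\<integral>y. h (Z0 y) \<partial>Q0) - e" by simp
  then show "\<forall>\<^sub>F x in G. measure (Q x) {y \<in> space (Q x). a \<le> Z (x, y)} > measure Q0 {y \<in> space Q0. b \<le> Z0 y} - e"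
  proof eventually_elim
    fix x assume "(\<integral>y. h (Z (x, y)) \<partial>Q x) > (\<integral>y. h (Z0 y) \<partial>Q0) - e"
    then show "measure (Q x) {y \<in> space (Q x). a \<le> Z (x, y)} > measure Q0 {y \<in> space Q0. b \<le> Z0 y} - e"
      using sandwich[OF prob_space_Q Z, of x] sandwich[OF Q0 Z0] by linarith
  qed
qed

end

section \<open>The limit law: weighted sums of independent chi-square variables\<close>

definition gauss_quad_cdf :: "real^'h^'m \<Rightarrow> real \<Rightarrow> real" where
  "gauss_quad_cdf K = cdf (distr std_gauss borel (\<lambda>h. (norm (K *v (\<chi> i. h i)))\<^sup>2))"

lemma gauss_quad_cdf_eq:
  "gauss_quad_cdf K s = measure std_gauss {h. (norm (K *v (\<chi> i. h i)))\<^sup>2 \<le> s}"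
  unfolding gauss_quad_cdf_def cdf_def
  by (subst measure_distr) (auto simp: vimage_def)

lemma real_distribution_gauss_quad:
  fixes K :: "real^'h^'m"
  shows "real_distribution (distr std_gauss borel (\<lambda>h. (norm (K *v (\<chi> i. h i)))\<^sup>2))"
proof -
  interpret prob_space "std_gauss :: ('h \<Rightarrow> real) measure" by (rule prob_space_std_gauss)
  show ?thesis by (rule real_distribution_distr) measurable
qed

text \<open>Fix all coordinates but j, where column j of K is a nonzero vector k: the equation
  becomes quadratic in coordinate j with leading coefficient |k|^2 > 0, so it has finitely many
  roots. Integrating out coordinate j first gives a null set.\<close>

lemma gauss_quad_null:
  fixes K :: "real^'h^'m"
  assumes "K \<noteq> 0"
  shows "emeasure std_gauss {h. (norm (K *v (\<chi> i. h i)))\<^sup>2 = c} = 0"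
proof -
  obtain i j where "K $ i $ j \<noteq> 0" using assms by (auto simp: vec_eq_iff)
  define k where "k = K *v axis j 1"
  have k: "k \<noteq> 0"
    using \<open>K $ i $ j \<noteq> 0\<close> by (auto simp: k_def vec_eq_iff matrix_vector_mul_component inner_axis intro!: exI[of _ i])
  interpret N: prob_space std_normal_distribution by (intro prob_space_normal_density) simp
  interpret product_sigma_finite "\<lambda>_::'h. std_normal_distribution"
    by (rule product_sigma_finite.intro)
      (intro prob_space_imp_sigma_finite prob_space_normal_density, simp)
  let ?A = "{h::'h \<Rightarrow> real. (norm (K *v (\<chi> i. h i)))\<^sup>2 = c}"
  have "(\<lambda>h::'h \<Rightarrow> real. (norm (K *v (\<chi> i. h i)))\<^sup>2) \<in> borel_measurable std_gauss" by measurable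
  from borel_measurable_eq[OF this borel_measurable_const[of c]]
  have A: "?A \<in> sets std_gauss" unfolding space_std_gauss by simp
  have ins: "insert j (UNIV - {j}) = (UNIV :: 'h set)" by auto
  have sg: "std_gauss = PiM (insert j (UNIV - {j})) (\<lambda>_. std_normal_distribution)"
    unfolding std_gauss_def ins ..
  have "emeasure std_gauss ?A = (\<integral>\<^sup>+ h. indicator ?A h \<partial>PiM (insert j (UNIV - {j})) (\<lambda>_. std_normal_distribution))"
    unfolding sg[symmetric] by (rule nn_integral_indicator[OF A, symmetric])
  also have "\<dots> = (\<integral>\<^sup>+ x. (\<integral>\<^sup>+ y. indicator ?A (x(j := y)) \<partial>std_normal_distribution)
      \<partial>PiM (UNIV - {j}) (\<lambda>_. std_normal_distribution))"
    by (rule product_nn_integral_insert, simp, simp, fold sg, rule borel_measurable_indicator[OF A])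
  also have "\<dots> = (\<integral>\<^sup>+ x. 0 \<partial>PiM (UNIV - {j}) (\<lambda>_. std_normal_distribution))"
  proof (intro nn_integral_cong)
    fix x
    define u where "u = K *v (\<chi> i. (x(j := 0)) i)"
    have Ky: "K *v (\<chi> i. (x(j := y)) i) = u + y *\<^sub>R k" for y
    proof -
      have e: "(\<chi> i. (x(j := y)) i) = (\<chi> i. (x(j := 0)) i) + y *\<^sub>R axis j 1"
        by (auto simp: vec_eq_iff axis_def)
      show ?thesis
        by (subst e) (simp only: u_def k_def matrix_vector_right_distrib matrix_vector_mult_scaleR)
    qed
    have n: "(norm (K *v (\<chi> i. (x(j := y)) i)))\<^sup>2 - c = poly [:u \<bullet> u - c, 2 * (u \<bullet> k), k \<bullet> k:] y" for y
      unfolding power2_norm_eq_inner Ky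
      by (simp add: inner_add_left inner_add_right inner_commute[of k u] algebra_simps)
    have fin: "finite {y. poly [:u \<bullet> u - c, 2 * (u \<bullet> k), k \<bullet> k:] y = 0}"
      using k by (intro poly_roots_finite) auto
    have eq: "{y. x(j := y) \<in> ?A} = {y. poly [:u \<bullet> u - c, 2 * (u \<bullet> k), k \<bullet> k:] y = 0}"
      unfolding n[symmetric] by auto
    have "(\<integral>\<^sup>+ y. indicator ?A (x(j := y)) \<partial>std_normal_distribution)
        = (\<integral>\<^sup>+ y. indicator {y. x(j := y) \<in> ?A} y \<partial>std_normal_distribution)"
      by (intro nn_integral_cong) (auto simp: indicator_def)
    also have "\<dots> = emeasure std_normal_distribution {y. x(j := y) \<in> ?A}"
    proof (rule nn_integral_indicator)
      show "{y. x(j := y) \<in> ?A} \<in> sets std_normal_distribution"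
        using borel_closed[OF finite_imp_closed[OF fin]] unfolding eq by (simp only: sets_density sets_lborel)
    qed
    also have "\<dots> = 0"
    proof -
      have "{y. x(j := y) \<in> ?A} \<in> null_sets std_normal_distribution"
        unfolding eq
        by (rule subsetD[OF absolutely_continuousI_density[unfolded absolutely_continuous_def]
              finite_imp_null_set_lborel[OF fin]]) measurable
      then show ?thesis by (rule null_setsD1)
    qed
    finally show "(\<integral>\<^sup>+ y. indicator ?A (x(j := y)) \<partial>std_normal_distribution) = 0" .
  qed
  finally show ?thesis by simp
qed

lemma isCont_gauss_quad_cdf:
  assumes "K \<noteq> 0"
  shows "isCont (gauss_quad_cdf K) s"
proof -
  interpret real_distribution "distr std_gauss borel (\<lambda>h. (norm (K *v (\<chi> i. h i)))\<^sup>2)"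
    by (rule real_distribution_gauss_quad)
  have "measure (distr std_gauss borel (\<lambda>h. (norm (K *v (\<chi> i. h i)))\<^sup>2)) {s} = 0"
    using gauss_quad_null[OF assms, of s]
    by (subst measure_distr) (auto simp: vimage_def measure_def)
  then show ?thesis unfolding gauss_quad_cdf_def by (simp add: isCont_cdf)
qed

lemma gauss_quad_cdf_limits:
  shows "(gauss_quad_cdf K \<longlongrightarrow> 1) at_top" "(gauss_quad_cdf K \<longlongrightarrow> 0) at_bot"
proof -
  interpret real_distribution "distr std_gauss borel (\<lambda>h. (norm (K *v (\<chi> i. h i)))\<^sup>2)"
    by (rule real_distribution_gauss_quad)
  show "(gauss_quad_cdf K \<longlongrightarrow> 1) at_top" "(gauss_quad_cdf K \<longlongrightarrow> 0) at_bot"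
    unfolding gauss_quad_cdf_def
    by (rule cdf_lim_at_top_prob, rule cdf_lim_at_bot)
qed

section \<open>Convergence of the distribution functions of quadratic forms\<close>

context prob_family
begin

text \<open>The map v to exp (- v / 2) sends the half-line into the unit interval, and the moments
  of the image are Laplace transforms at integers. Being decreasing, it turns upper thresholds into
  lower ones. The shift by e in place of a limit keeps the bounds valid for
  \<open>B ** L = 0\<close>, where the limit law sits at 0.\<close>

theorem prob_quadratic_le_eventually:
  fixes W :: "'x \<times> 'y \<Rightarrow> real^'n" and L :: "real^'h^'n" and B :: "real^'n^'m"
  assumes W [measurable]: "\<And>x. (\<lambda>y. W (x, y)) \<in> borel_measurable (Q x)"
    and char: "\<And>C e. e > 0 \<Longrightarrow> \<forall>\<^sub>F x in G. \<forall>t. norm t \<le> C \<longrightarrow>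
      cmod ((CLINT y|Q x. iexp (t \<bullet> W (x, y))) - exp (- (norm (transpose L *v t))\<^sup>2 / 2)) < e"
    and e: "e > 0"
  shows "\<forall>\<^sub>F x in G. measure (Q x) {y \<in> space (Q x). (norm (B *v W (x, y)))\<^sup>2 \<le> s}
      < gauss_quad_cdf (B ** L) (s + e) + e"
    and "\<forall>\<^sub>F x in G. measure (Q x) {y \<in> space (Q x). (norm (B *v W (x, y)))\<^sup>2 \<le> s}
      > gauss_quad_cdf (B ** L) (s - e) - e"
proof -
  define Z where "Z z = exp (- ((norm (B *v W z))\<^sup>2 / 2))" for z
  define Z0 where "Z0 h = exp (- ((norm (B *v (L *v (\<chi> i. h i))))\<^sup>2 / 2))" for h :: "'h \<Rightarrow> real"
  have pw: "exp (- (v / 2)) ^ m = exp (- (real m * v / 2))" for v :: real and m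
    by (simp add: exp_of_nat_mult[symmetric])
  have mom: "((\<lambda>x. \<integral>y. Z (x, y) ^ m \<partial>Q x) \<longlongrightarrow> (\<integral>y. Z0 y ^ m \<partial>std_gauss)) G" for m
    unfolding Z_def Z0_def pw by (rule laplace_quadratic_tendsto[OF W char]) auto
  have Zm: "(\<lambda>y. Z (x, y)) \<in> borel_measurable (Q x)" for x unfolding Z_def by measurable
  have Z0m: "Z0 \<in> borel_measurable std_gauss" unfolding Z0_def by measurable
  have Zle: "exp (- (a / 2)) \<le> Z z \<longleftrightarrow> (norm (B *v W z))\<^sup>2 \<le> a" for a z
    by (simp add: Z_def)
  have Z0le: "measure std_gauss {y. exp (- (a / 2)) \<le> Z0 y} = gauss_quad_cdf (B ** L) a" for a
    by (simp add: Z0_def gauss_quad_cdf_eq matrix_vector_mul_assoc)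
  note main = prob_ge_eventually_if_moments_tendsto[OF Zm _ prob_space_std_gauss Z0m _ mom _ e,
      of "exp (- (a / 2))" "exp (- (b / 2))" for a b, unfolded Zle space_std_gauss]
  have 1: "exp (- ((s + e) / 2)) < exp (- (s / 2))" "exp (- (s / 2)) < exp (- ((s - e) / 2))"
    using e by (auto simp: divide_simps)
  show "\<forall>\<^sub>F x in G. measure (Q x) {y \<in> space (Q x). (norm (B *v W (x, y)))\<^sup>2 \<le> s}
      < gauss_quad_cdf (B ** L) (s + e) + e"
    using main(1)[OF _ _ 1(1)] Z0le by (simp add: Z_def Z0_def)
  show "\<forall>\<^sub>F x in G. measure (Q x) {y \<in> space (Q x). (norm (B *v W (x, y)))\<^sup>2 \<le> s}
      > gauss_quad_cdf (B ** L) (s - e) - e"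
    using main(2)[OF _ _ 1(2)] Z0le by (simp add: Z_def Z0_def)
qed

text \<open>Slutsky for distribution functions: replacing |B W|^2 by U costs e / 2 in the threshold
  and e / 2 in probability; the other halves are spent on |B W|^2 itself.\<close>

theorem prob_le_eventually_if_close_to_quadratic:
  fixes W :: "'x \<times> 'y \<Rightarrow> real^'n" and L :: "real^'h^'n" and B :: "real^'n^'m" and U :: "'x \<times> 'y \<Rightarrow> real"
  assumes W [measurable]: "\<And>x. (\<lambda>y. W (x, y)) \<in> borel_measurable (Q x)"
    and char: "\<And>C e. e > 0 \<Longrightarrow> \<forall>\<^sub>F x in G. \<forall>t. norm t \<le> C \<longrightarrow>
      cmod ((CLINT y|Q x. iexp (t \<bullet> W (x, y))) - exp (- (norm (transpose L *v t))\<^sup>2 / 2)) < e"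
    and U [measurable]: "\<And>x. (\<lambda>y. U (x, y)) \<in> borel_measurable (Q x)"
    and close: "((\<lambda>z. U z - (norm (B *v W z))\<^sup>2) \<longlongrightarrow> 0) (wp G Q)"
    and e: "e > 0"
  shows "\<forall>\<^sub>F x in G. measure (Q x) {y \<in> space (Q x). U (x, y) \<le> s} < gauss_quad_cdf (B ** L) (s + e) + e"
    and "\<forall>\<^sub>F x in G. measure (Q x) {y \<in> space (Q x). U (x, y) \<le> s} > gauss_quad_cdf (B ** L) (s - e) - e"
proof -
  define V where "V z = (norm (B *v W z))\<^sup>2" for z
  have V [measurable]: "(\<lambda>y. V (x, y)) \<in> borel_measurable (Q x)" for x unfolding V_def by measurable
  have e2: "e / 2 > 0" using e by simp
  have main: "\<forall>\<^sub>F x in G. measure (Q x) {y \<in> space (Q x). V (x, y) \<le> a} < gauss_quad_cdf (B ** L) (a + e / 2) + e / 2"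
    "\<forall>\<^sub>F x in G. measure (Q x) {y \<in> space (Q x). V (x, y) \<le> a} > gauss_quad_cdf (B ** L) (a - e / 2) - e / 2" for a
    unfolding V_def by (rule prob_quadratic_le_eventually[OF W _ e2], rule char, assumption)+
  have cl: "\<forall>\<^sub>F x in G. 1 - e / 2 \<le> measure (Q x) {y \<in> space (Q x). dist (U (x, y) - V (x, y)) 0 < e / 2}"
    using tendstoD[OF close e2] e2 unfolding V_def[symmetric]
    by (intro eventually_wp_prob) auto
  have half: "s + e / 2 + e / 2 = s + e" "s - e / 2 - e / 2 = s - e" by simp_all
  show "\<forall>\<^sub>F x in G. measure (Q x) {y \<in> space (Q x). U (x, y) \<le> s} < gauss_quad_cdf (B ** L) (s + e) + e"
    using main(1)[of "s + e / 2"] cl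
  proof eventually_elim
    fix x
    assume 1: "measure (Q x) {y \<in> space (Q x). V (x, y) \<le> s + e / 2} < gauss_quad_cdf (B ** L) (s + e / 2 + e / 2) + e / 2"
      and 2: "1 - e / 2 \<le> measure (Q x) {y \<in> space (Q x). dist (U (x, y) - V (x, y)) 0 < e / 2}"
    interpret prob_space "Q x" by (rule prob_space_Q)
    let ?D = "{y \<in> space (Q x). dist (U (x, y) - V (x, y)) 0 < e / 2}"
    have "prob {y \<in> space (Q x). U (x, y) \<le> s} \<le> prob ({y \<in> space (Q x). V (x, y) \<le> s + e / 2} \<union> (space (Q x) - ?D))"
      (is "prob ?A \<le> prob ?C")
    proof (rule finite_measure_mono)
      show "?A \<subseteq> ?C"
      proof
        fix y assume "y \<in> ?A" then show "y \<in> ?C"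
          using e abs_ge_self[of "U (x, y) - V (x, y)"] abs_ge_minus_self[of "U (x, y) - V (x, y)"]
          by (cases "y \<in> ?D") (simp_all add: dist_real_def, linarith?)
      qed
    qed measurable
    also have "\<dots> \<le> prob {y \<in> space (Q x). V (x, y) \<le> s + e / 2} + prob (space (Q x) - ?D)"
      by (intro measure_Un_le) auto
    also have "prob (space (Q x) - ?D) \<le> e / 2" using 2 by (subst prob_compl) auto
    finally show "prob {y \<in> space (Q x). U (x, y) \<le> s} < gauss_quad_cdf (B ** L) (s + e) + e"
      using 1[unfolded half] by linarith
  qed
  show "\<forall>\<^sub>F x in G. measure (Q x) {y \<in> space (Q x). U (x, y) \<le> s} > gauss_quad_cdf (B ** L) (s - e) - e"
    using main(2)[of "s - e / 2"] cl
  proof eventually_elim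
    fix x
    assume 1: "measure (Q x) {y \<in> space (Q x). V (x, y) \<le> s - e / 2} > gauss_quad_cdf (B ** L) (s - e / 2 - e / 2) - e / 2"
      and 2: "1 - e / 2 \<le> measure (Q x) {y \<in> space (Q x). dist (U (x, y) - V (x, y)) 0 < e / 2}"
    interpret prob_space "Q x" by (rule prob_space_Q)
    let ?D = "{y \<in> space (Q x). dist (U (x, y) - V (x, y)) 0 < e / 2}"
    have "prob {y \<in> space (Q x). V (x, y) \<le> s - e / 2} \<le> prob ({y \<in> space (Q x). U (x, y) \<le> s} \<union> (space (Q x) - ?D))"
      (is "prob ?A \<le> prob ?C")
    proof (rule finite_measure_mono)
      show "?A \<subseteq> ?C"
      proof
        fix y assume "y \<in> ?A" then show "y \<in> ?C"
          using e abs_ge_self[of "U (x, y) - V (x, y)"] abs_ge_minus_self[of "U (x, y) - V (x, y)"]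
          by (cases "y \<in> ?D") (simp_all add: dist_real_def, linarith?)
      qed
    qed measurable
    also have "\<dots> \<le> prob {y \<in> space (Q x). U (x, y) \<le> s} + prob (space (Q x) - ?D)"
      by (intro measure_Un_le) auto
    also have "prob (space (Q x) - ?D) \<le> e / 2" using 2 by (subst prob_compl) auto
    finally show "prob {y \<in> space (Q x). U (x, y) \<le> s} > gauss_quad_cdf (B ** L) (s - e) - e"
      using 1[unfolded half] by linarith
  qed
qed

end

section \<open>Auxiliary facts on independent sums and quantiles\<close>

lemma (in prob_space) expectation_square_sum_indep:
  fixes Z :: "'i \<Rightarrow> 'a \<Rightarrow> real"
  assumes I: "finite I" and ind: "indep_vars (\<lambda>_. borel) Z I"
    and bd: "\<And>a y. \<bar>Z a y\<bar> \<le> b" and mean: "\<And>a. a \<in> I \<Longrightarrow> expectation (Z a) = 0"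
  shows "integrable M (\<lambda>y. (\<Sum>a\<in>I. Z a y)\<^sup>2)"
    and "expectation (\<lambda>y. (\<Sum>a\<in>I. Z a y)\<^sup>2) = (\<Sum>a\<in>I. expectation (\<lambda>y. (Z a y)\<^sup>2))"
proof -
  have meas: "Z a \<in> borel_measurable M" if "a \<in> I" for a
    using ind that by (auto simp: indep_vars_def)
  have intp: "integrable M (\<lambda>y. Z a y * Z a' y)" if "a \<in> I" "a' \<in> I" for a a'
    using meas that bd
    by (intro integrable_const_bound[of _ "\<bar>b\<bar> * \<bar>b\<bar>"] AE_I2)
      (auto simp: abs_mult intro!: mult_mono bd order_trans[OF bd abs_ge_self]
        order_trans[OF abs_ge_zero bd])
  have int1: "integrable M (Z a)" if "a \<in> I" for a
    using meas that bd by (intro integrable_const_bound[of _ b]) auto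
  have cross: "expectation (\<lambda>y. Z a y * Z a' y) = (if a = a' then expectation (\<lambda>y. (Z a y)\<^sup>2) else 0)"
    if "a \<in> I" "a' \<in> I" for a a'
  proof (cases "a = a'")
    case False
    have "indep_vars (\<lambda>_. borel) Z {a, a'}"
      using ind that by (intro indep_vars_subset[OF ind]) auto
    from indep_vars_lebesgue_integral[OF _ this] int1 that False
    have "expectation (\<lambda>y. Z a y * Z a' y) = expectation (Z a) * expectation (Z a')" by auto
    with mean that False show ?thesis by simp
  qed (simp add: power2_eq_square)
  have sq: "(\<Sum>a\<in>I. Z a y)\<^sup>2 = (\<Sum>a\<in>I. \<Sum>a'\<in>I. Z a y * Z a' y)" for y
    by (simp add: power2_eq_square sum_product)
  show "integrable M (\<lambda>y. (\<Sum>a\<in>I. Z a y)\<^sup>2)"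
    unfolding sq by (intro Bochner_Integration.integrable_sum intp)
  show "expectation (\<lambda>y. (\<Sum>a\<in>I. Z a y)\<^sup>2) = (\<Sum>a\<in>I. expectation (\<lambda>y. (Z a y)\<^sup>2))"
    unfolding sq using I
    by (simp add: Bochner_Integration.integral_sum intp cross sum.delta cong: sum.cong)
qed

lemma exp_minus_bounds:
  assumes "u \<ge> (0::real)"
  shows "\<bar>exp (- u) - (1 - u)\<bar> \<le> u\<^sup>2"
proof -
  have "exp (- u) \<le> 1 / (1 + u)"
    using assms exp_ge_add_one_self[of u] by (simp add: exp_minus field_simps)
  also have "\<dots> \<le> 1 - u + u\<^sup>2"
  proof -
    \<comment> \<open>The right-hand side equals 1 + u^3.\<close>
    have "1 \<le> (1 - u + u\<^sup>2) * (1 + u)"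
      using assms by (simp add: algebra_simps power2_eq_square)
    then show ?thesis using assms by (simp add: divide_le_eq)
  qed
  finally show ?thesis using exp_ge_add_one_self[of "- u"] by simp
qed

lemma exp_minus_lipschitz:
  assumes "a \<ge> (0::real)" "b \<ge> 0"
  shows "\<bar>exp (- a) - exp (- b)\<bar> \<le> \<bar>a - b\<bar>"
proof -
  have *: "exp (- a) - exp (- b) \<le> b - a \<and> 0 \<le> exp (- a) - exp (- b)" if "0 \<le> a" "a \<le> b" for a b :: real
  proof -
    have "exp (- a) - exp (- b) = exp (- a) * (1 - exp (- (b - a)))"
      by (simp add: right_diff_distrib flip: exp_add)
    also have "\<dots> \<le> 1 * (1 - exp (- (b - a)))"
      using that by (intro mult_right_mono) auto
    also have "\<dots> \<le> b - a" using exp_ge_add_one_self[of "a - b"] unfolding minus_diff_eq mult_1 by linarith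
    finally show ?thesis using that by simp
  qed
  show ?thesis using *[of a b] *[of b a] assms by (cases "a \<le> b") auto
qed

text \<open>Second-order expansion: the linear term vanishes by the mean, Taylor's remainder gives
  b^3, and exchanging 1 - v / 2 for exp (- v / 2) costs at most v^2, hence b^4. Boundedness of the
  summands stands in for a Lindeberg condition.\<close>

lemma (in prob_space) char_small_bounded:
  fixes g :: "'a \<Rightarrow> real"
  assumes g [measurable]: "g \<in> borel_measurable M" and bd: "\<And>y. \<bar>g y\<bar> \<le> b" and mean: "expectation g = 0"
  defines "v \<equiv> expectation (\<lambda>y. (g y)\<^sup>2)"
  shows "cmod ((CLINT y|M. iexp (g y)) - exp (- v / 2)) \<le> b ^ 3 + b ^ 4" "0 \<le> v"
proof -
  have b: "0 \<le> b" using bd[of undefined] by linarith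
  have i1: "integrable M g" using bd by (intro integrable_const_bound[of _ b]) auto
  have g2: "(g y)\<^sup>2 \<le> b\<^sup>2" for y using bd[of y] b by (simp add: abs_le_square_iff[symmetric])
  have i2: "integrable M (\<lambda>y. (g y)\<^sup>2)"
    using g2 by (intro integrable_const_bound[of _ "b\<^sup>2"] AE_I2) auto
  have v: "0 \<le> v" "v \<le> b\<^sup>2"
    unfolding v_def using norm_expectation_le[OF i2, of "b\<^sup>2"] g2 by (auto simp: abs_le_iff)
  have ie: "integrable M (\<lambda>y. iexp (g y))" by (intro integrable_const_bound[of _ 1]) auto
  have ip: "integrable M (\<lambda>y. complex_of_real (1 - (g y)\<^sup>2 / 2) + \<i> * complex_of_real (g y))"
    using i1 i2 by (intro Bochner_Integration.integrable_add integrable_mult_right integrable_of_real) auto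
  have eq: "(CLINT y|M. complex_of_real (1 - (g y)\<^sup>2 / 2) + \<i> * complex_of_real (g y)) = complex_of_real (1 - v / 2)"
  proof -
    have "(CLINT y|M. complex_of_real (1 - (g y)\<^sup>2 / 2) + \<i> * complex_of_real (g y))
        = complex_of_real (\<integral>y. 1 - (g y)\<^sup>2 / 2 \<partial>M) + \<i> * complex_of_real (expectation g)"
    proof -
      have "integrable M (\<lambda>y. complex_of_real (1 - (g y)\<^sup>2 / 2))"
        using i2 by (intro integrable_of_real) simp
      moreover have "integrable M (\<lambda>y. \<i> * complex_of_real (g y))"
        using i1 by (intro integrable_mult_right integrable_of_real)
      ultimately show ?thesis
        by (simp only: Bochner_Integration.integral_add integral_complex_of_real integral_mult_right_zero)
    qed
    also have "(\<integral>y. 1 - (g y)\<^sup>2 / 2 \<partial>M) = 1 - v / 2"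
      using i2 by (simp add: prob_space v_def)
    finally show ?thesis using mean by simp
  qed
  have pt: "cmod (iexp u - (complex_of_real (1 - u\<^sup>2 / 2) + \<i> * complex_of_real u)) \<le> \<bar>u\<bar> ^ 3" for u :: real
  proof -
    have "(\<Sum>k\<le>2. (\<i> * complex_of_real u) ^ k / fact k) = complex_of_real (1 - u\<^sup>2 / 2) + \<i> * complex_of_real u"
      by (simp add: numeral_2_eq_2 power2_eq_square algebra_simps)
    moreover have "cmod (iexp u - (\<Sum>k\<le>2. (\<i> * complex_of_real u) ^ k / fact k)) \<le> \<bar>u\<bar> ^ 3 / fact 3"
      using iexp_approx1[of u 2] by (simp add: eval_nat_numeral)
    moreover have "\<bar>u\<bar> ^ 3 / fact 3 \<le> \<bar>u\<bar> ^ 3"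
    proof -
      have 6: "fact 3 = (6::real)" by (simp add: eval_nat_numeral)
      show ?thesis unfolding 6 using zero_le_power[OF abs_ge_zero, of u 3] by linarith
    qed
    ultimately show ?thesis by simp
  qed
  have "cmod ((CLINT y|M. iexp (g y)) - complex_of_real (1 - v / 2)) \<le> b ^ 3"
    unfolding eq[symmetric] Bochner_Integration.integral_diff[OF ie ip, symmetric]
  proof (rule norm_expectation_le)
    show "integrable M (\<lambda>y. iexp (g y) - (complex_of_real (1 - (g y)\<^sup>2 / 2) + \<i> * complex_of_real (g y)))"
      using ie ip by (rule Bochner_Integration.integrable_diff)
    show "cmod (iexp (g y) - (complex_of_real (1 - (g y)\<^sup>2 / 2) + \<i> * complex_of_real (g y))) \<le> b ^ 3" for y
      using pt[of "g y"] power_mono[OF bd[of y] abs_ge_zero, of 3] by linarith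
  qed
  moreover have "cmod (complex_of_real (1 - v / 2) - exp (- v / 2)) \<le> b ^ 4"
  proof -
    have "cmod (complex_of_real (1 - v / 2) - complex_of_real (exp (- (v / 2)))) = \<bar>exp (- (v / 2)) - (1 - v / 2)\<bar>"
      by (simp only: of_real_diff[symmetric] norm_of_real abs_minus_commute)
    also have "\<dots> \<le> (v / 2)\<^sup>2" using v by (intro exp_minus_bounds) simp
    also have "\<dots> \<le> v\<^sup>2" by (simp add: power2_eq_square)
    also have "\<dots> \<le> (b\<^sup>2)\<^sup>2" using v by (intro power_mono) auto
    finally show ?thesis by (simp add: power_mult[symmetric] exp_of_real[symmetric])
  qed
  ultimately show "cmod ((CLINT y|M. iexp (g y)) - exp (- v / 2)) \<le> b ^ 3 + b ^ 4"
    using norm_triangle_ineq[of "(CLINT y|M. iexp (g y)) - complex_of_real (1 - v / 2)"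
        "complex_of_real (1 - v / 2) - exp (- v / 2)"] by simp
  show "0 \<le> v" by (rule v)
qed

text \<open>Right-continuity makes the infimum a minimum, so quantile and distribution function form
  a Galois connection. It serves population quantiles, sample quantiles and the bootstrap critical
  value alike.\<close>

lemma quantile_cdf_le_iff:
  assumes "real_distribution \<mu>" "0 < u" "u < 1"
  shows "quantile (cdf \<mu>) u \<le> t \<longleftrightarrow> u \<le> cdf \<mu> t"
proof -
  interpret real_distribution \<mu> by (rule assms)
  let ?S = "{t. u \<le> cdf \<mu> t}"
  have bdd: "bdd_below ?S"
  proof -
    from order_tendstoD(2)[OF cdf_lim_at_bot assms(2)] obtain a where "\<And>x. x \<le> a \<Longrightarrow> cdf \<mu> x < u"
      by (auto simp: eventually_at_bot_linorder)
    then show ?thesis by (intro bdd_belowI[of _ a]) (metis linear mem_Collect_eq not_le)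
  qed
  have ne: "?S \<noteq> {}"
  proof -
    from order_tendstoD(1)[OF cdf_lim_at_top_prob assms(3)] obtain b where "\<And>x. b \<le> x \<Longrightarrow> u < cdf \<mu> x"
      by (auto simp: eventually_at_top_linorder)
    then show ?thesis by (auto intro!: exI[of _ b] less_imp_le)
  qed
  show ?thesis
  proof
    assume "u \<le> cdf \<mu> t" then show "quantile (cdf \<mu>) u \<le> t"
      unfolding quantile_def using bdd by (intro cInf_lower) auto
  next
    assume le: "quantile (cdf \<mu>) u \<le> t"
    have "u \<le> cdf \<mu> s" if "t < s" for s
    proof -
      have "Inf ?S < s" using le that by (simp add: quantile_def)
      then obtain r where "r \<in> ?S" "r < s" using cInf_lessD[OF ne] by blast
      then show ?thesis using cdf_nondecreasing[of r s] by simp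
    qed
    then have "\<forall>\<^sub>F s in at_right t. u \<le> cdf \<mu> s"
      by (auto simp: eventually_at_filter)
    moreover have "(cdf \<mu> \<longlongrightarrow> cdf \<mu> t) (at_right t)"
      using cdf_is_right_cont[of t] by (simp add: continuous_within)
    ultimately show "u \<le> cdf \<mu> t"
      by (intro tendsto_lowerbound) auto
  qed
qed

section \<open>Sample quantiles of triangular arrays\<close>

text \<open>One formula for all entries within a block; it agrees with \<open>asymp_cov\<close>
  because \<open>J i l l = p\<close> at the quantiles. Its arguments are limits common to the sample
  and to the bootstrap array.\<close>

definition limit_cov :: "real \<Rightarrow> ('k::finite \<Rightarrow> real) \<Rightarrow> ('k \<Rightarrow> 'd::finite \<Rightarrow> real) \<Rightarrow> ('k \<Rightarrow> 'd \<Rightarrow> 'd \<Rightarrow> real)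
    \<Rightarrow> real^('k \<times> 'd)^('k \<times> 'd)" where
  "limit_cov p \<kappa> \<phi> J = (\<chi> a b. if fst a = fst b
     then inverse (\<kappa> (fst a)) * inverse (\<phi> (fst a) (snd a) * \<phi> (fst a) (snd b)) * (J (fst a) (snd a) (snd b) - p\<^sup>2)
     else 0)"

text \<open>A common frame for the original sample (\<open>Q \<nu>\<close> is the underlying probability, \<open>c\<close> the vector of
  true quantiles) and for the bootstrap sample (\<open>Q\<close> is the conditional law given the data, indexed by
  the sample size together with the outcome, and \<open>c\<close> is the vector of empirical quantiles; the filter
  \<open>G\<close> then expresses convergence in probability).\<close>

locale array_sampling = prob_family Q
  for Q :: "'x \<Rightarrow> 'y measure" +
  fixes G :: "'x filter" and N :: "'x \<Rightarrow> 'k::finite \<Rightarrow> nat"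
    and Y :: "'x \<Rightarrow> 'y \<Rightarrow> ('k \<times> nat \<Rightarrow> real^'d)" and mu :: "'x \<Rightarrow> 'k \<Rightarrow> (real^'d) measure"
    and c :: "'x \<Rightarrow> real^('k \<times> 'd)" and p :: real and \<kappa> :: "'k \<Rightarrow> real" and \<phi> :: "'k \<Rightarrow> 'd \<Rightarrow> real"
    and J :: "'k \<Rightarrow> 'd \<Rightarrow> 'd \<Rightarrow> real"
  assumes indep: "prob_space.indep_vars (Q x) (\<lambda>_. borel) (\<lambda>a y. Y x y a) (obs_index (N x))"
    and law: "j < N x i \<Longrightarrow> distr (Q x) borel (\<lambda>y. Y x y (i, j)) = mu x i"
    and prob_space_mu: "prob_space (mu x i)" and sets_mu: "sets (mu x i) = sets borel"
    and p: "0 < p" "p < 1"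
    and size: "filterlim (\<lambda>x. total_size (N x)) at_top G"
    and ratio: "((\<lambda>x. real (N x i) / real (total_size (N x))) \<longlongrightarrow> \<kappa> i) G"
    and \<kappa>: "\<kappa> i > 0" and \<phi>: "\<phi> i l > 0"
    and local: "((\<lambda>x. sqrt (real (total_size (N x))) *
        (marginal_cdf (mu x i) l (c x $ (i, l) + s / sqrt (real (total_size (N x)))) - p)) \<longlongrightarrow> \<phi> i l * s) G"
    and joint: "((\<lambda>x. measure (mu x i) {v. v $ l \<le> c x $ (i, l) \<and> v $ m \<le> c x $ (i, m)}) \<longlongrightarrow> J i l m) G"
begin

definition "rn x = sqrt (real (total_size (N x)))"

text \<open>The empirical process of group i at g. Scaling by the total size, not by that of the
  group, produces the factor 1 / \<kappa> i in the covariance.\<close>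

definition fluct :: "'x \<Rightarrow> 'y \<Rightarrow> 'k \<Rightarrow> (real^'d \<Rightarrow> real) \<Rightarrow> real" where
  "fluct x y i g = rn x * ((\<Sum>j<N x i. g (Y x y (i, j))) / real (N x i) - integral\<^sup>L (mu x i) g)"

definition below :: "'x \<Rightarrow> 'k \<Rightarrow> 'd \<Rightarrow> real \<Rightarrow> real^'d \<Rightarrow> real" where
  "below x i l s v = of_bool (v $ l \<le> c x $ (i, l) + s / rn x)"

text \<open>\<open>W\<close> is the Bahadur linearisation of the normalised quantile error \<open>R\<close>, and
  \<open>A i l s \<ge> 0\<close> expresses that component \<open>(i, l)\<close> of \<open>R\<close> is at most \<open>s\<close>.\<close>

definition W :: "'x \<times> 'y \<Rightarrow> real^('k \<times> 'd)" where
  "W z = (\<chi> a. - fluct (fst z) (snd z) (fst a) (below (fst z) (fst a) (snd a) 0) / \<phi> (fst a) (snd a))"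

definition R :: "'x \<times> 'y \<Rightarrow> real^('k \<times> 'd)" where
  "R z = rn (fst z) *\<^sub>R (emp_quantiles p (N (fst z)) (Y (fst z) (snd z)) - c (fst z))"

definition A :: "'k \<Rightarrow> 'd \<Rightarrow> real \<Rightarrow> 'x \<times> 'y \<Rightarrow> real" where
  "A i l s z = rn (fst z) *
     (emp_cdf (N (fst z)) (Y (fst z) (snd z)) i l (c (fst z) $ (i, l) + s / rn (fst z)) - p)"

section \<open>The empirical process near the centres\<close>

lemma rn_at_top: "filterlim rn at_top G"
  unfolding rn_def using size
  by (intro filterlim_compose[OF sqrt_at_top] filterlim_compose[OF filterlim_real_sequentially])

lemma rn_pos: "\<forall>\<^sub>F x in G. rn x > 0"
  using rn_at_top by (simp add: filterlim_at_top_dense)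

lemma inverse_rn: "((\<lambda>x. s / rn x) \<longlongrightarrow> 0) G"
  by (rule tendsto_divide_0[OF tendsto_const filterlim_at_top_imp_at_infinity[OF rn_at_top]])

lemma rn_square: "rn x * rn x = real (total_size (N x))"
  by (simp add: rn_def)

lemma N_pos: "\<forall>\<^sub>F x in G. \<forall>i. N x i > 0"
proof (intro eventually_all_finite)
  fix i
  from order_tendstoD(1)[OF ratio \<kappa>, of i]
  show "\<forall>\<^sub>F x in G. N x i > 0"
    by eventually_elim (auto intro: gr0I)
qed

lemma ratio_inverse: "((\<lambda>x. real (total_size (N x)) / real (N x i)) \<longlongrightarrow> inverse (\<kappa> i)) G"
  using tendsto_inverse[OF ratio[of i]] \<kappa>[of i] by (simp add: inverse_eq_divide)

lemma measurable_Y: "j < N x i \<Longrightarrow> (\<lambda>y. Y x y (i, j)) \<in> borel_measurable (Q x)"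
  using indep[of x] prob_space.indep_vars_def2[OF prob_space_Q]
  by (auto simp: obs_index_def prob_space.indep_vars_def[OF prob_space_Q])

lemma measurable_mu: "f \<in> borel_measurable (mu x i) \<longleftrightarrow> f \<in> borel_measurable borel"
  by (rule arg_cong[of _ _ "\<lambda>S. f \<in> S"], rule measurable_cong_sets[OF sets_mu refl])

lemma space_mu: "space (mu x i) = UNIV"
  using sets_eq_imp_space_eq[OF sets_mu, of x i] by simp

lemma integral_Y:
  fixes f :: "real^'d \<Rightarrow> 'b::{banach,second_countable_topology}"
  assumes "j < N x i" "f \<in> borel_measurable borel"
  shows "(\<integral>y. f (Y x y (i, j)) \<partial>Q x) = integral\<^sup>L (mu x i) f"
  unfolding law[OF assms(1), symmetric]
  by (rule integral_distr[symmetric]) (use measurable_Y assms in auto)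

lemma measurable_below [measurable]: "below x i l s \<in> borel_measurable borel"
  unfolding below_def[abs_def] of_bool_def by measurable

lemma below_01: "0 \<le> below x i l s v" "below x i l s v \<le> 1"
  by (auto simp: below_def)

lemma measurable_fluct:
  assumes "g \<in> borel_measurable borel"
  shows "(\<lambda>y. fluct x y i g) \<in> borel_measurable (Q x)"
  unfolding fluct_def using assms measurable_Y
  by (intro borel_measurable_times borel_measurable_diff borel_measurable_divide borel_measurable_sum
      measurable_compose[OF measurable_Y assms] borel_measurable_const) auto

lemma integrable_mu:
  fixes g :: "real^'d \<Rightarrow> real"
  assumes "g \<in> borel_measurable borel" "\<And>v. \<bar>g v\<bar> \<le> b"
  shows "integrable (mu x i) g"
proof -
  interpret prob_space "mu x i" by (rule prob_space_mu)
  show ?thesis using assms by (intro integrable_const_bound[of _ b]) (auto simp: measurable_mu)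
qed

lemma fluct_eq_sum:
  assumes "N x i > 0"
  shows "fluct x y i g = (\<Sum>j<N x i. rn x / real (N x i) * (g (Y x y (i, j)) - integral\<^sup>L (mu x i) g))"
proof -
  have "(\<Sum>j<N x i. rn x / real (N x i) * (g (Y x y (i, j)) - integral\<^sup>L (mu x i) g))
      = rn x / real (N x i) * ((\<Sum>j<N x i. g (Y x y (i, j))) - real (N x i) * integral\<^sup>L (mu x i) g)"
    unfolding sum_distrib_left[symmetric] sum_subtractf by simp
  then show ?thesis using assms by (simp add: fluct_def field_simps)
qed

text \<open>Variances of independent terms add up. Bounding the variance of g by its second moment
  is enough both for tightness and for indicators of shrinking strips.\<close>

lemma fluct_square:
  assumes g: "g \<in> borel_measurable borel" "\<And>v. \<bar>g v\<bar> \<le> b"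
  shows "integrable (Q x) (\<lambda>y. (fluct x y i g)\<^sup>2)"
    and "N x i > 0 \<Longrightarrow> (\<integral>y. (fluct x y i g)\<^sup>2 \<partial>Q x)
      \<le> real (total_size (N x)) / real (N x i) * (\<integral>v. (g v)\<^sup>2 \<partial>mu x i)"
proof -
  interpret prob_space "Q x" by (rule prob_space_Q)
  interpret mu: prob_space "mu x i" by (rule prob_space_mu)
  let ?I = "{i} \<times> {..<N x i}"
  let ?m = "integral\<^sup>L (mu x i) g"
  define r where "r = rn x / real (N x i)"
  define Z where "Z a y = r * (g (Y x y a) - ?m)" for a y
  have st: "(\<Sum>a\<in>?I. F a) = (\<Sum>j<N x i. F (i, j))" for F :: "'k \<times> nat \<Rightarrow> real"
    by (rule sum.reindex_bij_witness[of _ "\<lambda>j. (i, j)" snd]) auto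
  have b: "0 \<le> b" using g(2)[of undefined] by linarith
  note ig = integrable_mu[OF g]
  have g2: "(g v)\<^sup>2 \<le> b\<^sup>2" for v using g(2)[of v] b by (simp add: abs_le_square_iff[symmetric])
  have ig2: "integrable (mu x i) (\<lambda>v. (g v)\<^sup>2)"
    using g g2 by (intro integrable_mu[of _ "b\<^sup>2"]) auto
  have m: "\<bar>?m\<bar> \<le> b" using mu.norm_expectation_le[OF ig, of b] g by simp
  have "indep_vars (\<lambda>_. borel) (\<lambda>a y. Y x y a) ?I"
    by (rule indep_vars_subset[OF indep]) (auto simp: obs_index_def)
  then have ind: "indep_vars (\<lambda>_. borel) Z ?I"
    unfolding Z_def by (rule indep_vars_compose2) (use g in auto)
  have bdZ: "\<bar>Z a y\<bar> \<le> \<bar>r\<bar> * (2 * b)" for a y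
    unfolding Z_def abs_mult using m g(2)[of "Y x y a"]
    by (intro mult_left_mono) auto
  have expZ: "expectation (\<lambda>y. f (Y x y a)) = integral\<^sup>L (mu x i) f"
    if "a \<in> ?I" "f \<in> borel_measurable borel" for a and f :: "_ \<Rightarrow> real"
    using integral_Y[of "snd a" x i f] that by auto
  have mean: "expectation (Z a) = 0" if "a \<in> ?I" for a
  proof -
    have "expectation (Z a) = (\<integral>v. r * (g v - ?m) \<partial>mu x i)"
      unfolding Z_def using g by (intro expZ[OF that]) auto
    then show ?thesis using ig by (simp add: mu.prob_space)
  qed
  note sq = expectation_square_sum_indep[OF _ ind bdZ mean]
  show "integrable (Q x) (\<lambda>y. (fluct x y i g)\<^sup>2)"
  \<comment> \<open>An empty group has average 0 / 0 = 0, so \<open>fluct\<close> is then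
    constant.\<close>
  proof (cases "N x i > 0")
    case True
    have "fluct x y i g = (\<Sum>a\<in>?I. Z a y)" for y
      using fluct_eq_sum[OF True] by (simp add: Z_def r_def st)
    then show ?thesis using sq(1) by simp
  qed (simp add: fluct_def)
  assume N: "N x i > 0"
  have fl: "fluct x y i g = (\<Sum>a\<in>?I. Z a y)" for y
    using fluct_eq_sum[OF N] by (simp add: Z_def r_def st)
  have var: "expectation (\<lambda>y. (Z a y)\<^sup>2) \<le> r\<^sup>2 * (\<integral>v. (g v)\<^sup>2 \<partial>mu x i)" if "a \<in> ?I" for a
  proof -
    have "expectation (\<lambda>y. (Z a y)\<^sup>2) = (\<integral>v. (r * (g v - ?m))\<^sup>2 \<partial>mu x i)"
      unfolding Z_def using g by (intro expZ[OF that]) auto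
    also have "\<dots> = r\<^sup>2 * (\<integral>v. (g v - ?m)\<^sup>2 \<partial>mu x i)" by (simp add: power_mult_distrib)
    also have "(\<integral>v. (g v - ?m)\<^sup>2 \<partial>mu x i) = (\<integral>v. (g v)\<^sup>2 \<partial>mu x i) - ?m\<^sup>2"
      using ig ig2 by (rule mu.variance_eq)
    also have "r\<^sup>2 * \<dots> \<le> r\<^sup>2 * (\<integral>v. (g v)\<^sup>2 \<partial>mu x i)" by (intro mult_left_mono) auto
    finally show ?thesis .
  qed
  have "expectation (\<lambda>y. (fluct x y i g)\<^sup>2) = (\<Sum>a\<in>?I. expectation (\<lambda>y. (Z a y)\<^sup>2))"
    unfolding fl using sq(2) by simp
  also have "\<dots> \<le> (\<Sum>a\<in>?I. r\<^sup>2 * (\<integral>v. (g v)\<^sup>2 \<partial>mu x i))"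
    by (intro sum_mono var)
  also have "\<dots> = real (N x i) * r\<^sup>2 * (\<integral>v. (g v)\<^sup>2 \<partial>mu x i)" by simp
  also have "real (N x i) * r\<^sup>2 = real (total_size (N x)) / real (N x i)"
    using N by (simp add: r_def power2_eq_square rn_square[symmetric])
  finally show "(\<integral>y. (fluct x y i g)\<^sup>2 \<partial>Q x)
      \<le> real (total_size (N x)) / real (N x i) * (\<integral>v. (g v)\<^sup>2 \<partial>mu x i)" .
qed

lemma fluct_diff:
  assumes "g \<in> borel_measurable borel" "\<And>v. \<bar>g v\<bar> \<le> b" "h \<in> borel_measurable borel" "\<And>v. \<bar>h v\<bar> \<le> b"
  shows "fluct x y i (\<lambda>v. g v - h v) = fluct x y i g - fluct x y i h"
  using integrable_mu[OF assms(1,2)] integrable_mu[OF assms(3,4)]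
  by (simp add: fluct_def sum_subtractf diff_divide_distrib algebra_simps)

lemma integral_below: "integral\<^sup>L (mu x i) (below x i l s) = marginal_cdf (mu x i) l (c x $ (i, l) + s / rn x)"
proof -
  interpret prob_space "mu x i" by (rule prob_space_mu)
  have [measurable_cong]: "sets (mu x i) = sets borel" by (rule sets_mu)
  let ?S = "{v. v $ l \<le> c x $ (i, l) + s / rn x}"
  have "integral\<^sup>L (mu x i) (below x i l s) = (\<integral>v. indicator ?S v \<partial>mu x i)"
    by (intro Bochner_Integration.integral_cong) (auto simp: below_def)
  also have "\<dots> = measure (mu x i) ?S"
    by (simp add: space_mu)
  also have "\<dots> = marginal_cdf (mu x i) l (c x $ (i, l) + s / rn x)"
    unfolding marginal_cdf_def cdf_def
    by (subst measure_distr) (auto simp: space_mu vimage_def)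
  finally show ?thesis .
qed

lemma local': "((\<lambda>x. rn x * (integral\<^sup>L (mu x i) (below x i l s) - p)) \<longlongrightarrow> \<phi> i l * s) G"
  using local[of i l s] unfolding integral_below rn_def[symmetric] by simp

lemma integral_below_tendsto: "((\<lambda>x. integral\<^sup>L (mu x i) (below x i l s)) \<longlongrightarrow> p) G"
proof -
  have "((\<lambda>x. 1 / rn x * (rn x * (integral\<^sup>L (mu x i) (below x i l s) - p)) + p) \<longlongrightarrow> 0 * (\<phi> i l * s) + p) G"
    by (intro tendsto_intros local' inverse_rn)
  then have "((\<lambda>x. 1 / rn x * (rn x * (integral\<^sup>L (mu x i) (below x i l s) - p)) + p) \<longlongrightarrow> p) G" by simp
  then show ?thesis
    by (rule Lim_transform_eventually) (use rn_pos in eventually_elim, simp)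
qed

text \<open>The function may move with x, as the indicators do when the centre is an empirical
  quantile; the common bound b keeps the second moments bounded.\<close>

lemma tight_fluct:
  assumes g: "\<And>x. g x \<in> borel_measurable borel" "\<And>x v. \<bar>g x v\<bar> \<le> b"
  shows "tight_wp G Q (\<lambda>z. fluct (fst z) (snd z) i (g (fst z)))"
proof (rule tight_wpI_second_moment)
  show "(\<lambda>y. fluct (fst (x, y)) (snd (x, y)) i (g (fst (x, y)))) \<in> borel_measurable (Q x)" for x
    using measurable_fluct[OF g(1)] by simp
  show "integrable (Q x) (\<lambda>y. (fluct (fst (x, y)) (snd (x, y)) i (g (fst (x, y))))\<^sup>2)" for x
    using fluct_square(1)[OF g] by simp
  have b: "0 \<le> b" using g(2)[of undefined undefined] by linarith
  have g2: "(g x v)\<^sup>2 \<le> b\<^sup>2" for x v using g(2)[of x v] b by (simp add: abs_le_square_iff[symmetric])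
  have "\<forall>\<^sub>F x in G. real (total_size (N x)) / real (N x i) < inverse (\<kappa> i) + 1"
    by (rule order_tendstoD(2)[OF ratio_inverse]) simp
  then show "\<forall>\<^sub>F x in G. (\<integral>y. (fluct (fst (x, y)) (snd (x, y)) i (g (fst (x, y))))\<^sup>2 \<partial>Q x) \<le> (inverse (\<kappa> i) + 1) * b\<^sup>2"
    using N_pos
  proof eventually_elim
    fix x assume 1: "real (total_size (N x)) / real (N x i) < inverse (\<kappa> i) + 1" and 2: "\<forall>i. 0 < N x i"
    interpret mu: prob_space "mu x i" by (rule prob_space_mu)
    have "(\<integral>v. (g x v)\<^sup>2 \<partial>mu x i) \<le> b\<^sup>2"
      using mu.norm_expectation_le[OF integrable_mu[of "\<lambda>v. (g x v)\<^sup>2" "b\<^sup>2"], of "b\<^sup>2"] g g2 by auto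
    then have "real (total_size (N x)) / real (N x i) * (\<integral>v. (g x v)\<^sup>2 \<partial>mu x i) \<le> (inverse (\<kappa> i) + 1) * b\<^sup>2"
      using 1 \<kappa>[of i] by (intro mult_mono) (auto intro: add_nonneg_nonneg)
    then show "(\<integral>y. (fluct (fst (x, y)) (snd (x, y)) i (g (fst (x, y))))\<^sup>2 \<partial>Q x) \<le> (inverse (\<kappa> i) + 1) * b\<^sup>2"
      using order_trans[OF fluct_square(2)[OF g(1)[of x] g(2)[of x], of x i]] 2 by simp
  qed
qed

lemma tight_W: "tight_wp G Q W"
proof (rule tight_wp_vec)
  fix a :: "'k \<times> 'd"
  have "tight_wp G Q (\<lambda>z. fluct (fst z) (snd z) (fst a) (below (fst z) (fst a) (snd a) 0))"
    by (rule tight_fluct[of _ 1]) (auto simp: below_def)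
  then show "tight_wp G Q (\<lambda>z. W z $ a)"
    by (rule tight_wp_mono)
      (use \<phi>[of "fst a" "snd a"] in \<open>auto simp: W_def abs_mult intro!: exI[of _ "_ / \<phi> (fst a) (snd a)"] divide_right_mono\<close>)
qed

lemma measurable_W: "(\<lambda>y. W (x, y)) \<in> borel_measurable (Q x)"
  unfolding W_def using measurable_fluct[OF measurable_below]
  by (intro borel_measurable_vec_lambda) auto

text \<open>Asymptotic equicontinuity: up to sign the difference is the indicator of a strip of
  width |s| / rn, and squaring it gives its absolute value. The second moment is thus an increment
  of the distribution function, which tends to 0.\<close>

lemma fluct_below_diff_tendsto:
  "((\<lambda>z. fluct (fst z) (snd z) i (below (fst z) i l s) - fluct (fst z) (snd z) i (below (fst z) i l 0)) \<longlongrightarrow> 0) (wp G Q)"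
proof -
  let ?g = "\<lambda>x v. below x i l s v - below x i l 0 v"
  have b1: "\<bar>?g x v\<bar> \<le> 1" for x v by (auto simp: below_def)
  have gm: "?g x \<in> borel_measurable borel" for x by measurable
  have mono: "((\<lambda>x. \<integral>v. (?g x v)\<^sup>2 \<partial>mu x i) \<longlongrightarrow> 0) G"
  proof -
    have "((\<lambda>x. \<bar>integral\<^sup>L (mu x i) (below x i l s) - integral\<^sup>L (mu x i) (below x i l 0)\<bar>) \<longlongrightarrow> \<bar>p - p\<bar>) G"
      by (intro tendsto_intros integral_below_tendsto)
    then have "((\<lambda>x. \<bar>integral\<^sup>L (mu x i) (below x i l s) - integral\<^sup>L (mu x i) (below x i l 0)\<bar>) \<longlongrightarrow> 0) G"
      by simp
    then show ?thesis
    proof (rule Lim_transform_eventually)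
      show "\<forall>\<^sub>F x in G. \<bar>integral\<^sup>L (mu x i) (below x i l s) - integral\<^sup>L (mu x i) (below x i l 0)\<bar> = (\<integral>v. (?g x v)\<^sup>2 \<partial>mu x i)"
        using rn_pos
      proof eventually_elim
        fix x assume r: "0 < rn x"
        have ib: "integrable (mu x i) (below x i l s)" for s
          by (rule integrable_mu[of _ 1]) (auto simp: below_def)
        have *: "integral\<^sup>L (mu x i) (below x i l s) - integral\<^sup>L (mu x i) (below x i l 0) = (\<integral>v. ?g x v \<partial>mu x i)"
          using ib by simp
        show "\<bar>integral\<^sup>L (mu x i) (below x i l s) - integral\<^sup>L (mu x i) (below x i l 0)\<bar> = (\<integral>v. (?g x v)\<^sup>2 \<partial>mu x i)"
        \<comment> \<open>The strip lies to the right or to the left of the centre according to the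
          sign of s.\<close>
        proof (cases "0 \<le> s")
          case True
          then have "0 \<le> s / rn x" using r by simp
          then have "(?g x v)\<^sup>2 = ?g x v" "0 \<le> ?g x v" for v by (auto simp: below_def of_bool_def)
          then show ?thesis unfolding * by simp
        next
          case False
          then have "s / rn x \<le> 0" using r by (simp add: divide_nonpos_pos)
          then have g: "(?g x v)\<^sup>2 = - ?g x v" "?g x v \<le> 0" for v by (auto simp: below_def of_bool_def)
          have "(\<integral>v. ?g x v \<partial>mu x i) = - (\<integral>v. (?g x v)\<^sup>2 \<partial>mu x i)"
            unfolding g(1) by (subst integral_minus) simp
          moreover have "0 \<le> (\<integral>v. (?g x v)\<^sup>2 \<partial>mu x i)" by simp
          ultimately show ?thesis unfolding * by simp
        qed
      qed
    qed
  qed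
  have "((\<lambda>z. fluct (fst z) (snd z) i (?g (fst z))) \<longlongrightarrow> 0) (wp G Q)"
  proof (rule tendsto_wpI_second_moment)
    show "(\<lambda>y. fluct (fst (x, y)) (snd (x, y)) i (?g (fst (x, y)))) \<in> borel_measurable (Q x)" for x
      using measurable_fluct[OF gm] by simp
    show "integrable (Q x) (\<lambda>y. (fluct (fst (x, y)) (snd (x, y)) i (?g (fst (x, y))))\<^sup>2)" for x
      using fluct_square(1)[OF gm b1] by simp
    have "((\<lambda>x. real (total_size (N x)) / real (N x i) * (\<integral>v. (?g x v)\<^sup>2 \<partial>mu x i)) \<longlongrightarrow> inverse (\<kappa> i) * 0) G"
      by (intro tendsto_mult ratio_inverse mono)
    then have "((\<lambda>x. real (total_size (N x)) / real (N x i) * (\<integral>v. (?g x v)\<^sup>2 \<partial>mu x i)) \<longlongrightarrow> 0) G" by simp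
    then show "((\<lambda>x. \<integral>y. (fluct (fst (x, y)) (snd (x, y)) i (?g (fst (x, y))))\<^sup>2 \<partial>Q x) \<longlongrightarrow> 0) G"
    proof (rule Lim_null_comparison[rotated])
      show "\<forall>\<^sub>F x in G. norm (\<integral>y. (fluct (fst (x, y)) (snd (x, y)) i (?g (fst (x, y))))\<^sup>2 \<partial>Q x)
          \<le> real (total_size (N x)) / real (N x i) * (\<integral>v. (?g x v)\<^sup>2 \<partial>mu x i)"
        using N_pos by eventually_elim (use fluct_square(2)[OF gm b1] in simp)
    qed
  qed
  also have "(\<lambda>z. fluct (fst z) (snd z) i (?g (fst z)))
      = (\<lambda>z. fluct (fst z) (snd z) i (below (fst z) i l s) - fluct (fst z) (snd z) i (below (fst z) i l 0))"
    by (intro ext fluct_diff[of _ 1]) (auto simp: below_def)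
  finally show ?thesis .
qed

lemma A_eq: "A i l s z = fluct (fst z) (snd z) i (below (fst z) i l s)
    + rn (fst z) * (integral\<^sup>L (mu (fst z) i) (below (fst z) i l s) - p)"
proof -
  have "emp_cdf (N x) y i l (c x $ (i, l) + s / rn x) = (\<Sum>j<N x i. below x i l s (y (i, j))) / real (N x i)" for x y
    by (simp add: emp_cdf_def below_def)
  then show ?thesis by (simp add: A_def fluct_def algebra_simps)
qed

text \<open>A is fluctuation plus drift. The fluctuation at s may be taken at 0, where it is -\<phi>
  W, and the drift tends to \<phi> s; so A is asymptotically affine in s with slope \<phi>.\<close>

lemma A_tendsto: "((\<lambda>z. A i l s z + \<phi> i l * (W z $ (i, l) - s)) \<longlongrightarrow> 0) (wp G Q)"
proof -
  have "((\<lambda>z. (fluct (fst z) (snd z) i (below (fst z) i l s) - fluct (fst z) (snd z) i (below (fst z) i l 0))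
      + (rn (fst z) * (integral\<^sup>L (mu (fst z) i) (below (fst z) i l s) - p) - \<phi> i l * s)) \<longlongrightarrow> 0 + (\<phi> i l * s - \<phi> i l * s)) (wp G Q)"
    by (intro tendsto_add tendsto_diff tendsto_const fluct_below_diff_tendsto
        filterlim_compose[OF local' filterlim_fst_wp])
  then show ?thesis
    using \<phi>[of i l] by (simp add: A_eq W_def algebra_simps)
qed

lemma A_mono: "s \<le> s' \<Longrightarrow> 0 < rn (fst z) \<Longrightarrow> A i l s z \<le> A i l s' z"
  unfolding A_def emp_cdf_def
  by (intro mult_left_mono diff_right_mono divide_right_mono sum_mono)
    (auto simp: of_bool_def intro: order_trans[OF _ add_left_mono[OF divide_right_mono]])

text \<open>By monotonicity of \<open>A\<close> in \<open>s\<close>, the linearisation extends to random parameters \<open>Z\<close> near \<open>W\<close>: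
  compare with a fine finite grid.\<close>

lemma A_tendsto_random:
  assumes Z: "\<forall>\<^sub>F z in wp G Q. \<bar>Z z - W z $ (i, l)\<bar> \<le> K"
  shows "((\<lambda>z. A i l (Z z) z + \<phi> i l * (W z $ (i, l) - Z z)) \<longlongrightarrow> 0) (wp G Q)"
proof (rule tendstoI, rule eventually_wp_tight[OF tight_W])
  fix e C :: real assume e: "e > 0"
  \<comment> \<open>One grid step changes the affine approximation by exactly e / 2.\<close>
  define h where "h = e / (2 * \<phi> i l)"
  have h: "h > 0" "\<phi> i l * h = e / 2" using e \<phi>[of i l] by (auto simp: h_def)
  obtain m :: int where m: "(\<bar>C\<bar> + \<bar>K\<bar>) / h \<le> of_int m" using ex_le_of_int by blast
  \<comment> \<open>The nodes cover |Z| <= |C| + |K| and leave room for the node above Z as well as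
    the one below.\<close>
  have grid: "\<forall>\<^sub>F z in wp G Q. \<forall>k\<in>{-m-1..m+1}. \<bar>A i l (h * of_int k) z + \<phi> i l * (W z $ (i, l) - h * of_int k)\<bar> < e / 2"
    using e tendstoD[OF A_tendsto[of i l "h * of_int _"], of "e / 2"]
    by (intro eventually_ball_finite) auto
  show "\<forall>\<^sub>F z in wp G Q. norm (W z) \<le> C \<longrightarrow> dist (A i l (Z z) z + \<phi> i l * (W z $ (i, l) - Z z)) 0 < e"
    using Z grid eventually_wp_fst[OF rn_pos]
  proof eventually_elim
    fix z
    assume ZK: "\<bar>Z z - W z $ (i, l)\<bar> \<le> K" and r: "0 < rn (fst z)"
      and g: "\<forall>k\<in>{-m-1..m+1}. \<bar>A i l (h * of_int k) z + \<phi> i l * (W z $ (i, l) - h * of_int k)\<bar> < e / 2"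
    show "norm (W z) \<le> C \<longrightarrow> dist (A i l (Z z) z + \<phi> i l * (W z $ (i, l) - Z z)) 0 < e"
    proof
      assume "norm (W z) \<le> C"
      then have "\<bar>W z $ (i, l)\<bar> \<le> C" using component_le_norm_cart order_trans by blast
      then have "\<bar>Z z\<bar> \<le> \<bar>C\<bar> + \<bar>K\<bar>" using ZK by linarith
      then have "\<bar>Z z\<bar> / h \<le> (\<bar>C\<bar> + \<bar>K\<bar>) / h" using h(1) by (intro divide_right_mono) auto
      then have "\<bar>Z z / h\<bar> \<le> of_int m" using m h(1) by (simp add: abs_divide)
      define k where "k = \<lfloor>Z z / h\<rfloor>"
      have k: "of_int k \<le> Z z / h" "Z z / h < of_int (k + 1)" by (simp_all add: k_def)
      have "of_int k \<le> (of_int m :: real)" "- of_int m < (of_int (k + 1) :: real)"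
        using k \<open>\<bar>Z z / h\<bar> \<le> of_int m\<close> by linarith+
      then have km: "k \<in> {-m-1..m+1}" "k + 1 \<in> {-m-1..m+1}" by auto
      have kl: "h * of_int k \<le> Z z" "Z z \<le> h * of_int (k + 1)"
        using k h by (simp_all add: field_simps)
      have kp: "h * of_int (k + 1) = h * of_int k + h" by (simp add: algebra_simps)
      have "A i l (h * of_int k) z \<le> A i l (Z z) z" "A i l (Z z) z \<le> A i l (h * of_int (k + 1)) z"
        using A_mono kl r by blast+
      moreover have "\<phi> i l * (h * of_int k) \<le> \<phi> i l * Z z" "\<phi> i l * Z z \<le> \<phi> i l * (h * of_int (k + 1))"
        using kl \<phi>[of i l] by (auto intro!: mult_left_mono)
      moreover have "\<phi> i l * (h * of_int (k + 1)) = \<phi> i l * (h * of_int k) + e / 2"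
        unfolding kp distrib_left h(2) ..
      moreover have "\<bar>A i l (h * of_int k) z + \<phi> i l * W z $ (i, l) - \<phi> i l * (h * of_int k)\<bar> < e / 2"
        "\<bar>A i l (h * of_int (k + 1)) z + \<phi> i l * W z $ (i, l) - \<phi> i l * (h * of_int (k + 1))\<bar> < e / 2"
        using g[rule_format, OF km(1)] g[rule_format, OF km(2)] by (simp_all only: right_diff_distrib add_diff_eq)
      ultimately have "\<bar>A i l (Z z) z + \<phi> i l * W z $ (i, l) - \<phi> i l * Z z\<bar> < e"
        unfolding abs_less_iff by linarith
      then show "dist (A i l (Z z) z + \<phi> i l * (W z $ (i, l) - Z z)) 0 < e"
        by (simp add: algebra_simps)
    qed
  qed
qed

end

text \<open>The law of a single bootstrap draw. As the image of the uniform law on indices it counts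
  tied observations with multiplicity.\<close>

definition emp_measure :: "('k \<Rightarrow> nat) \<Rightarrow> ('k \<times> nat \<Rightarrow> real^'d) \<Rightarrow> 'k \<Rightarrow> (real^'d) measure" where
  "emp_measure N x i = distr (measure_pmf (pmf_of_set {..<N i})) borel (\<lambda>h. x (i, h))"

lemma prob_space_emp_measure: "prob_space (emp_measure N x i)"
  unfolding emp_measure_def by (rule prob_space.prob_space_distr[OF prob_space_measure_pmf]) simp

lemma sets_emp_measure: "sets (emp_measure N x i) = sets borel"
  by (simp add: emp_measure_def)

lemma measure_emp_measure:
  assumes "N i > 0" "S \<in> sets borel"
  shows "measure (emp_measure N x i) S = (\<Sum>j<N i. of_bool (x (i, j) \<in> S)) / real (N i)"
proof -
  have "measure (emp_measure N x i) S = measure_pmf.prob (pmf_of_set {..<N i}) ((\<lambda>h. x (i, h)) -` S)"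
    unfolding emp_measure_def using assms by (subst measure_distr) auto
  also have "\<dots> = real (card ({..<N i} \<inter> (\<lambda>h. x (i, h)) -` S)) / real (N i)"
    using assms by (subst measure_pmf_of_set) (auto simp: lessThan_empty_iff)
  also have "real (card ({..<N i} \<inter> (\<lambda>h. x (i, h)) -` S)) = (\<Sum>j<N i. of_bool (x (i, j) \<in> S))"
    by (simp add: sum_of_bool_eq) (simp add: Int_def vimage_def)
  finally show ?thesis .
qed

lemma marginal_cdf_eq:
  assumes "sets \<mu> = sets borel"
  shows "marginal_cdf \<mu> l t = measure \<mu> {v. v $ l \<le> t}"
proof -
  have [measurable_cong]: "sets \<mu> = sets borel" by (rule assms)
  have "space \<mu> = UNIV" using sets_eq_imp_space_eq[OF assms] by simp
  then show ?thesis
    unfolding marginal_cdf_def cdf_def by (subst measure_distr) (auto simp: vimage_def)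
qed

lemma real_distribution_marginal:
  assumes "prob_space \<mu>" "sets \<mu> = sets borel"
  shows "real_distribution (distr \<mu> borel (\<lambda>x. x $ l))"
proof -
  have [measurable_cong]: "sets \<mu> = sets borel" by (rule assms)
  show ?thesis by (rule prob_space.real_distribution_distr[OF assms(1)]) measurable
qed

lemma emp_cdf_eq_marginal_cdf:
  assumes "N i > 0"
  shows "emp_cdf N x i l = marginal_cdf (emp_measure N x i) l"
proof
  fix t
  have "{v :: real^'b. v $ l \<le> t} \<in> sets borel" by measurable
  then show "emp_cdf N x i l t = marginal_cdf (emp_measure N x i) l t"
    unfolding marginal_cdf_eq[OF sets_emp_measure] emp_cdf_def
    using assms by (subst measure_emp_measure) auto
qed

lemma emp_quantiles_le_iff:
  assumes "N i > 0" "0 < p" "p < 1"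
  shows "emp_quantiles p N x $ (i, l) \<le> t \<longleftrightarrow> p \<le> emp_cdf N x i l t"
  unfolding emp_quantiles_def
  using quantile_cdf_le_iff[OF real_distribution_marginal[OF prob_space_emp_measure sets_emp_measure] assms(2,3), of N x i l t]
  by (simp add: emp_cdf_eq_marginal_cdf[of N i, OF assms(1)] marginal_cdf_def)

section \<open>Bahadur representation of the sample quantiles\<close>

context array_sampling
begin

lemma R_le_iff:
  assumes "N (fst z) i > 0" "rn (fst z) > 0"
  shows "R z $ (i, l) \<le> s \<longleftrightarrow> 0 \<le> A i l s z"
proof -
  have "R z $ (i, l) \<le> s \<longleftrightarrow> emp_quantiles p (N (fst z)) (Y (fst z) (snd z)) $ (i, l) \<le> c (fst z) $ (i, l) + s / rn (fst z)"
    using assms(2) by (simp add: R_def field_simps)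
  also have "\<dots> \<longleftrightarrow> 0 \<le> A i l s z"
    using assms p by (simp add: emp_quantiles_le_iff A_def zero_le_mult_iff)
  finally show ?thesis .
qed

text \<open>Evaluate A at the random arguments W + h and W - h: there it is close to \<phi> h and to
  -\<phi> h, so its sign is known and the inversion \<open>R_le_iff\<close> traps R between the two
  arguments.\<close>

lemma R_minus_W_tendsto: "((\<lambda>z. R z - W z) \<longlongrightarrow> 0) (wp G Q)"
proof (rule vec_tendstoI)
  fix a :: "'k \<times> 'd"
  obtain i l where a: "a = (i, l)" by (cases a)
  show "((\<lambda>z. (R z - W z) $ a) \<longlongrightarrow> 0 $ a) (wp G Q)"
  proof (rule tendstoI)
    fix e :: real assume e: "e > 0"
    define h where "h = e / 2"
    have h: "h > 0" "h < e" using e by (auto simp: h_def)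
    have ph: "\<phi> i l * h > 0" using \<phi>[of i l] h by simp
    have "\<forall>\<^sub>F z in wp G Q. dist (A i l (W z $ (i, l) + h) z + \<phi> i l * (W z $ (i, l) - (W z $ (i, l) + h))) 0 < \<phi> i l * h"
      by (rule tendstoD[OF A_tendsto_random[of _ _ _ h] ph]) (use h in \<open>auto intro!: always_eventually\<close>)
    moreover have "\<forall>\<^sub>F z in wp G Q. dist (A i l (W z $ (i, l) - h) z + \<phi> i l * (W z $ (i, l) - (W z $ (i, l) - h))) 0 < \<phi> i l * h"
      by (rule tendstoD[OF A_tendsto_random[of _ _ _ h] ph]) (use h in \<open>auto intro!: always_eventually\<close>)
    ultimately show "\<forall>\<^sub>F z in wp G Q. dist ((R z - W z) $ a) (0 $ a) < e"
      using eventually_wp_fst[OF rn_pos] eventually_wp_fst[OF N_pos]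
    proof eventually_elim
      fix z
      assume 1: "dist (A i l (W z $ (i, l) + h) z + \<phi> i l * (W z $ (i, l) - (W z $ (i, l) + h))) 0 < \<phi> i l * h"
        and 2: "dist (A i l (W z $ (i, l) - h) z + \<phi> i l * (W z $ (i, l) - (W z $ (i, l) - h))) 0 < \<phi> i l * h"
        and r: "0 < rn (fst z)" and N: "\<forall>i. 0 < N (fst z) i"
      have "\<bar>A i l (W z $ (i, l) + h) z - \<phi> i l * h\<bar> < \<phi> i l * h"
        using 1 by simp
      then have "0 \<le> A i l (W z $ (i, l) + h) z" by linarith
      then have "R z $ (i, l) \<le> W z $ (i, l) + h" using R_le_iff[of z i] N r by blast
      moreover have "\<bar>A i l (W z $ (i, l) - h) z + \<phi> i l * h\<bar> < \<phi> i l * h"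
        using 2 by simp
      then have "\<not> 0 \<le> A i l (W z $ (i, l) - h) z" by linarith
      then have "\<not> R z $ (i, l) \<le> W z $ (i, l) - h" using R_le_iff[of z i] N r by blast
      ultimately show "dist ((R z - W z) $ a) (0 $ a) < e"
        using h by (simp add: a dist_real_def)
    qed
  qed
qed

lemma quantiles_tendsto:
  "((\<lambda>z. emp_quantiles p (N (fst z)) (Y (fst z) (snd z)) - c (fst z)) \<longlongrightarrow> 0) (wp G Q)"
proof -
  have i: "((\<lambda>z. 1 / rn (fst z)) \<longlongrightarrow> 0) (wp G Q)"
    by (rule filterlim_compose[OF inverse_rn filterlim_fst_wp])
  have "((\<lambda>z. (1 / rn (fst z)) *\<^sub>R (R z - W z) + (1 / rn (fst z)) *\<^sub>R W z) \<longlongrightarrow> 0 *\<^sub>R 0 + 0) (wp G Q)"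
    by (intro tendsto_add tendsto_scaleR i R_minus_W_tendsto tendsto_wp_tight_mult tight_W)
  then have "((\<lambda>z. (1 / rn (fst z)) *\<^sub>R (R z - W z) + (1 / rn (fst z)) *\<^sub>R W z) \<longlongrightarrow> 0) (wp G Q)" by simp
  then show ?thesis
  proof (rule Lim_transform_eventually)
    show "\<forall>\<^sub>F z in wp G Q. (1 / rn (fst z)) *\<^sub>R (R z - W z) + (1 / rn (fst z)) *\<^sub>R W z
        = emp_quantiles p (N (fst z)) (Y (fst z) (snd z)) - c (fst z)"
      using eventually_wp_fst[OF rn_pos]
      by eventually_elim (simp add: scaleR_right_diff_distrib R_def)
  qed
qed

section \<open>Central limit theorem for the linearised quantiles\<close>

definition summand :: "'x \<Rightarrow> real^('k \<times> 'd) \<Rightarrow> 'k \<Rightarrow> real^'d \<Rightarrow> real" where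
  "summand x t i v = (\<Sum>l\<in>UNIV. (- t $ (i, l) / \<phi> i l * (rn x / real (N x i))) *
     (below x i l 0 v - integral\<^sup>L (mu x i) (below x i l 0)))"

definition "array_cov x i l m = real (total_size (N x)) / real (N x i) * (inverse (\<phi> i l * \<phi> i m) *
     ((\<integral>v. below x i l 0 v * below x i m 0 v \<partial>mu x i)
       - integral\<^sup>L (mu x i) (below x i l 0) * integral\<^sup>L (mu x i) (below x i m 0)))"

definition "lim_cov i l m = inverse (\<kappa> i) * (inverse (\<phi> i l * \<phi> i m) * (J i l m - p\<^sup>2))"

definition "Kphi = (\<Sum>i\<in>UNIV. \<Sum>l\<in>UNIV. 1 / \<phi> i l)"

lemma measurable_summand: "summand x t i \<in> borel_measurable borel"
  unfolding summand_def[abs_def] by measurable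

lemma sum_prod_index:
  fixes F :: "'k \<times> 'd \<Rightarrow> real"
  shows "(\<Sum>a\<in>UNIV. F a) = (\<Sum>i\<in>UNIV. \<Sum>l\<in>UNIV. F (i, l))"
  unfolding UNIV_Times_UNIV[symmetric] by (simp add: sum.cartesian_product)

lemma inner_W:
  assumes N: "\<forall>i. N x i > 0"
  shows "t \<bullet> W (x, y) = (\<Sum>a\<in>obs_index (N x). summand x t (fst a) (Y x y a))"
proof -
  have "t \<bullet> W (x, y) = (\<Sum>i\<in>UNIV. \<Sum>l\<in>UNIV. - t $ (i, l) / \<phi> i l * fluct x y i (below x i l 0))"
    by (simp add: inner_vec_def sum_prod_index W_def)
  also have "\<dots> = (\<Sum>i\<in>UNIV. \<Sum>l\<in>UNIV. \<Sum>j<N x i. (- t $ (i, l) / \<phi> i l * (rn x / real (N x i))) *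
     (below x i l 0 (Y x y (i, j)) - integral\<^sup>L (mu x i) (below x i l 0)))"
    using N by (simp only: fluct_eq_sum sum_distrib_left mult.assoc)
  also have "\<dots> = (\<Sum>i\<in>UNIV. \<Sum>j<N x i. summand x t i (Y x y (i, j)))"
    unfolding summand_def by (intro sum.cong refl sum.swap)
  also have "\<dots> = (\<Sum>a\<in>obs_index (N x). summand x t (fst a) (Y x y a))"
    unfolding obs_index_def by (subst sum.Sigma) (auto simp: case_prod_unfold)
  finally show ?thesis .
qed

lemma char_W_eq:
  assumes N: "\<forall>i. N x i > 0"
  shows "(CLINT y|Q x. iexp (t \<bullet> W (x, y))) = (\<Prod>i\<in>UNIV. (CLINT v|mu x i. iexp (summand x t i v)) ^ N x i)"
proof -
  interpret prob_space "Q x" by (rule prob_space_Q)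
  have fin: "finite (obs_index (N x))" by (simp add: obs_index_def)
  have "iexp (t \<bullet> W (x, y)) = (\<Prod>a\<in>obs_index (N x). iexp (summand x t (fst a) (Y x y a)))" for y
    by (simp add: inner_W[OF N] exp_sum[OF fin, symmetric] sum_distrib_left)
  then have "(CLINT y|Q x. iexp (t \<bullet> W (x, y))) = (CLINT y|Q x. (\<Prod>a\<in>obs_index (N x). iexp (summand x t (fst a) (Y x y a))))"
    by simp
  also have "\<dots> = (\<Prod>a\<in>obs_index (N x). CLINT y|Q x. iexp (summand x t (fst a) (Y x y a)))"
  proof (rule indep_vars_lebesgue_integral[OF fin])
    show "indep_vars (\<lambda>_. borel) (\<lambda>a y. iexp (summand x t (fst a) (Y x y a))) (obs_index (N x))"
      by (rule indep_vars_compose2[OF indep]) (use measurable_summand in measurable)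
    fix a assume "a \<in> obs_index (N x)"
    then have "(\<lambda>y. Y x y a) \<in> borel_measurable (Q x)"
      using measurable_Y by (auto simp: obs_index_def)
    then have "(\<lambda>y. summand x t (fst a) (Y x y a)) \<in> borel_measurable (Q x)"
      by (rule measurable_compose[OF _ measurable_summand])
    then show "integrable (Q x) (\<lambda>y. iexp (summand x t (fst a) (Y x y a)))"
      by (intro integrable_const_bound[of _ 1]) auto
  qed
  also have "\<dots> = (\<Prod>a\<in>obs_index (N x). CLINT v|mu x (fst a). iexp (summand x t (fst a) v))"
  proof (rule prod.cong[OF refl])
    fix a assume "a \<in> obs_index (N x)"
    then show "(CLINT y|Q x. iexp (summand x t (fst a) (Y x y a))) = (CLINT v|mu x (fst a). iexp (summand x t (fst a) v))"
      using integral_Y[of "snd a" x "fst a" "\<lambda>v. iexp (summand x t (fst a) v)"] measurable_summand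
      by (auto simp: obs_index_def)
  qed
  also have "\<dots> = (\<Prod>i\<in>UNIV. \<Prod>j<N x i. CLINT v|mu x i. iexp (summand x t i v))"
    unfolding obs_index_def by (subst prod.Sigma) (auto simp: case_prod_unfold)
  finally show ?thesis by simp
qed

lemma integrable_below: "integrable (mu x i) (below x i l s)"
  by (rule integrable_mu[of _ 1]) (auto simp: below_def)

lemma integrable_below_mult: "integrable (mu x i) (\<lambda>v. below x i l s v * below x i m s' v)"
  by (rule integrable_mu[of _ 1]) (auto simp: below_def)

lemma summand_mean: "integral\<^sup>L (mu x i) (summand x t i) = 0"
proof -
  interpret prob_space "mu x i" by (rule prob_space_mu)
  have "integral\<^sup>L (mu x i) (summand x t i) = (\<Sum>l\<in>UNIV. (- t $ (i, l) / \<phi> i l * (rn x / real (N x i))) *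
     (\<integral>v. below x i l 0 v - integral\<^sup>L (mu x i) (below x i l 0) \<partial>mu x i))"
    unfolding summand_def using integrable_below
    by (subst Bochner_Integration.integral_sum) auto
  then show ?thesis using integrable_below by (simp add: prob_space)
qed

lemma summand_variance:
  assumes N: "N x i > 0"
  shows "real (N x i) * (\<integral>v. (summand x t i v)\<^sup>2 \<partial>mu x i) = (\<Sum>l\<in>UNIV. \<Sum>m\<in>UNIV. t $ (i, l) * t $ (i, m) * array_cov x i l m)"
proof -
  interpret prob_space "mu x i" by (rule prob_space_mu)
  define r where "r = rn x / real (N x i)"
  define w where "w l = - t $ (i, l) / \<phi> i l * r" for l
  let ?m = "\<lambda>l. integral\<^sup>L (mu x i) (below x i l 0)"
  have cov: "(\<integral>v. (below x i l 0 v - ?m l) * (below x i m 0 v - ?m m) \<partial>mu x i)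
      = (\<integral>v. below x i l 0 v * below x i m 0 v \<partial>mu x i) - ?m l * ?m m"
    and icov: "integrable (mu x i) (\<lambda>v. (below x i l 0 v - ?m l) * (below x i m 0 v - ?m m))" for l m
  proof -
    have e: "(below x i l 0 v - ?m l) * (below x i m 0 v - ?m m)
        = below x i l 0 v * below x i m 0 v - ?m m * below x i l 0 v - ?m l * below x i m 0 v + ?m l * ?m m" for v
      by (simp add: algebra_simps)
    show "(\<integral>v. (below x i l 0 v - ?m l) * (below x i m 0 v - ?m m) \<partial>mu x i)
        = (\<integral>v. below x i l 0 v * below x i m 0 v \<partial>mu x i) - ?m l * ?m m"
      unfolding e using integrable_below[of x i] integrable_below_mult[of x i] by (simp add: prob_space)
    show "integrable (mu x i) (\<lambda>v. (below x i l 0 v - ?m l) * (below x i m 0 v - ?m m))"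
      unfolding e using integrable_below[of x i] integrable_below_mult[of x i] by simp
  qed
  have sq: "(summand x t i v)\<^sup>2 = (\<Sum>l\<in>UNIV. \<Sum>m\<in>UNIV. (w l * w m) * ((below x i l 0 v - ?m l) * (below x i m 0 v - ?m m)))" for v
    unfolding summand_def power2_eq_square sum_product w_def r_def by (intro sum.cong refl) (simp add: algebra_simps)
  have "(\<integral>v. (summand x t i v)\<^sup>2 \<partial>mu x i)
      = (\<Sum>l\<in>UNIV. \<Sum>m\<in>UNIV. (w l * w m) * ((\<integral>v. below x i l 0 v * below x i m 0 v \<partial>mu x i) - ?m l * ?m m))"
    unfolding sq using icov by (simp add: Bochner_Integration.integral_sum cov)
  then have "real (N x i) * (\<integral>v. (summand x t i v)\<^sup>2 \<partial>mu x i)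
      = (\<Sum>l\<in>UNIV. \<Sum>m\<in>UNIV. real (N x i) * ((w l * w m) * ((\<integral>v. below x i l 0 v * below x i m 0 v \<partial>mu x i) - ?m l * ?m m)))"
    by (simp only: sum_distrib_left)
  also have "\<dots> = (\<Sum>l\<in>UNIV. \<Sum>m\<in>UNIV. t $ (i, l) * t $ (i, m) * array_cov x i l m)"
  proof (intro sum.cong refl)
    fix l m
    have "real (N x i) * (r * r) = real (total_size (N x)) / real (N x i)"
      using N by (simp add: r_def rn_square[symmetric])
    then have array_cov: "t $ (i, l) * t $ (i, m) * array_cov x i l m = t $ (i, l) * t $ (i, m) * (real (N x i) * (r * r) * (inverse (\<phi> i l * \<phi> i m) *
        ((\<integral>v. below x i l 0 v * below x i m 0 v \<partial>mu x i) - ?m l * ?m m)))"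
      by (simp add: array_cov_def)
    show "real (N x i) * ((w l * w m) * ((\<integral>v. below x i l 0 v * below x i m 0 v \<partial>mu x i) - ?m l * ?m m))
        = t $ (i, l) * t $ (i, m) * array_cov x i l m"
      unfolding array_cov w_def divide_inverse by (simp add: mult_ac)
  qed
  finally show ?thesis .
qed

lemma array_cov_tendsto: "((\<lambda>x. array_cov x i l m) \<longlongrightarrow> lim_cov i l m) G"
proof -
  have "(\<integral>v. below x i l 0 v * below x i m 0 v \<partial>mu x i) = measure (mu x i) {v. v $ l \<le> c x $ (i, l) \<and> v $ m \<le> c x $ (i, m)}" for x
  proof -
    interpret prob_space "mu x i" by (rule prob_space_mu)
    have [measurable_cong]: "sets (mu x i) = sets borel" by (rule sets_mu)
    have "(\<integral>v. below x i l 0 v * below x i m 0 v \<partial>mu x i)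
        = (\<integral>v. indicator {v. v $ l \<le> c x $ (i, l) \<and> v $ m \<le> c x $ (i, m)} v \<partial>mu x i)"
      by (intro Bochner_Integration.integral_cong) (auto simp: below_def)
    then show ?thesis by (simp add: space_mu)
  qed
  then have j: "((\<lambda>x. \<integral>v. below x i l 0 v * below x i m 0 v \<partial>mu x i) \<longlongrightarrow> J i l m) G"
    using joint by simp
  show ?thesis unfolding array_cov_def lim_cov_def power2_eq_square
    by (intro tendsto_mult tendsto_diff tendsto_const ratio_inverse j integral_below_tendsto)
qed

lemma summand_bound:
  assumes "norm t \<le> C"
  shows "\<bar>summand x t i v\<bar> \<le> rn x / real (N x i) * (Kphi * C)"
proof -
  interpret prob_space "mu x i" by (rule prob_space_mu)
  have r: "0 \<le> rn x / real (N x i)" by (simp add: rn_def)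
  have C: "0 \<le> C" using assms norm_ge_zero order_trans by blast
  have "\<bar>summand x t i v\<bar> \<le> (\<Sum>l\<in>UNIV. \<bar>(- t $ (i, l) / \<phi> i l * (rn x / real (N x i))) *
     (below x i l 0 v - integral\<^sup>L (mu x i) (below x i l 0))\<bar>)"
    unfolding summand_def by (rule sum_abs)
  also have "\<dots> \<le> (\<Sum>l\<in>UNIV. rn x / real (N x i) * (1 / \<phi> i l * C))"
  proof (rule sum_mono)
    fix l
    have "0 \<le> integral\<^sup>L (mu x i) (below x i l 0)"
      by (intro Bochner_Integration.integral_nonneg) (simp add: below_01)
    moreover have "norm (integral\<^sup>L (mu x i) (below x i l 0)) \<le> 1"
      by (rule norm_expectation_le[OF integrable_below]) (auto simp: below_def)
    ultimately have 1: "\<bar>below x i l 0 v - integral\<^sup>L (mu x i) (below x i l 0)\<bar> \<le> 1"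
      using below_01[of x i l 0 v] by (auto simp: abs_le_iff)
    have 2: "\<bar>t $ (i, l)\<bar> \<le> C" using component_le_norm_cart[of t "(i, l)"] assms by simp
    have "\<bar>(- t $ (i, l) / \<phi> i l * (rn x / real (N x i))) * (below x i l 0 v - integral\<^sup>L (mu x i) (below x i l 0))\<bar>
        = rn x / real (N x i) * (1 / \<phi> i l * \<bar>t $ (i, l)\<bar>) * \<bar>below x i l 0 v - integral\<^sup>L (mu x i) (below x i l 0)\<bar>"
    proof -
      have "\<bar>(- a / b * q) * d\<bar> = q * (1 / b * \<bar>a\<bar>) * \<bar>d\<bar>" if "0 \<le> q" "0 < b" for a b q d :: real
        using that by (simp add: abs_mult)
      from this[OF r \<phi>] show ?thesis .
    qed
    also have "\<dots> \<le> rn x / real (N x i) * (1 / \<phi> i l * C) * 1"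
      using \<phi>[of i l] C
      by (intro mult_mono[OF mult_left_mono[OF mult_left_mono[OF 2] r] 1] mult_nonneg_nonneg r) auto
    finally show "\<bar>(- t $ (i, l) / \<phi> i l * (rn x / real (N x i))) * (below x i l 0 v - integral\<^sup>L (mu x i) (below x i l 0))\<bar>
        \<le> rn x / real (N x i) * (1 / \<phi> i l * C)" by simp
  qed
  also have "\<dots> = rn x / real (N x i) * ((\<Sum>l\<in>UNIV. 1 / \<phi> i l) * C)"
    by (simp only: sum_distrib_left sum_distrib_right)
  also have "\<dots> \<le> rn x / real (N x i) * (Kphi * C)"
  proof (intro mult_left_mono mult_right_mono r C)
    show "(\<Sum>l\<in>UNIV. 1 / \<phi> i l) \<le> Kphi"
      unfolding Kphi_def using less_imp_le[OF \<phi>] by (intro member_le_sum[of i UNIV "\<lambda>i. \<Sum>l\<in>UNIV. 1 / \<phi> i l"]) (auto intro!: sum_nonneg)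
  qed
  finally show ?thesis .
qed

text \<open>Write n for the total size. Then N i (rn / N i)^3 = (n / N i)^2 / rn and N i (rn / N
  i)^4 = (n / N i)^3 / rn^2, where n / N i converges and rn tends to infinity.\<close>

lemma remainder_tendsto:
  "((\<lambda>x. \<Sum>i\<in>UNIV. real (N x i) * ((rn x / real (N x i) * K) ^ 3 + (rn x / real (N x i) * K) ^ 4)) \<longlongrightarrow> 0) G"
proof (rule tendsto_null_sum)
  fix i
  let ?q = "\<lambda>x. real (total_size (N x)) / real (N x i)"
  have "((\<lambda>x. K ^ 3 * ((?q x) ^ 2 * (1 / rn x)) + K ^ 4 * ((?q x) ^ 3 * ((1 / rn x) * (1 / rn x))))
      \<longlongrightarrow> K ^ 3 * ((inverse (\<kappa> i)) ^ 2 * 0) + K ^ 4 * ((inverse (\<kappa> i)) ^ 3 * (0 * 0))) G"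
    by (intro tendsto_intros ratio_inverse inverse_rn)
  then have "((\<lambda>x. K ^ 3 * ((?q x) ^ 2 * (1 / rn x)) + K ^ 4 * ((?q x) ^ 3 * ((1 / rn x) * (1 / rn x)))) \<longlongrightarrow> 0) G"
    by simp
  then show "((\<lambda>x. real (N x i) * ((rn x / real (N x i) * K) ^ 3 + (rn x / real (N x i) * K) ^ 4)) \<longlongrightarrow> 0) G"
  proof (rule Lim_transform_eventually)
    show "\<forall>\<^sub>F x in G. K ^ 3 * ((?q x) ^ 2 * (1 / rn x)) + K ^ 4 * ((?q x) ^ 3 * ((1 / rn x) * (1 / rn x)))
      = real (N x i) * ((rn x / real (N x i) * K) ^ 3 + (rn x / real (N x i) * K) ^ 4)"
      using rn_pos N_pos
    proof eventually_elim
      fix x assume r: "0 < rn x" and N: "\<forall>i. 0 < N x i"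
      have "real (N x i) > 0" using N by simp
      then show "K ^ 3 * ((?q x) ^ 2 * (1 / rn x)) + K ^ 4 * ((?q x) ^ 3 * ((1 / rn x) * (1 / rn x)))
          = real (N x i) * ((rn x / real (N x i) * K) ^ 3 + (rn x / real (N x i) * K) ^ 4)"
        unfolding rn_square[symmetric] using r
        by (simp add: field_simps power2_eq_square power3_eq_cube power4_eq_xxxx)
    qed
  qed
qed

lemma inner_limit_cov: "t \<bullet> (limit_cov p \<kappa> \<phi> J *v t) = (\<Sum>i\<in>UNIV. \<Sum>l\<in>UNIV. \<Sum>m\<in>UNIV. t $ (i, l) * t $ (i, m) * lim_cov i l m)"
proof -
  have "(limit_cov p \<kappa> \<phi> J *v t) $ (i, l) = (\<Sum>m\<in>UNIV. t $ (i, m) * lim_cov i l m)" for i l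
  proof -
    have "(limit_cov p \<kappa> \<phi> J *v t) $ (i, l) = (\<Sum>i'\<in>UNIV. if i = i' then (\<Sum>m\<in>UNIV. t $ (i, m) * lim_cov i l m) else 0)"
      unfolding matrix_vector_mult_def vec_lambda_beta sum_prod_index
      by (intro sum.cong refl) (auto simp: limit_cov_def lim_cov_def mult_ac)
    then show ?thesis by simp
  qed
  then show ?thesis
    by (simp add: inner_vec_def sum_prod_index sum_distrib_left mult.assoc)
qed

text \<open>Lindeberg's comparison: replace every factor by the Gaussian one of equal variance, then
  the total variance s by its limit s0. All errors are bounded by \<open>rem x\<close>, where t has
  been replaced by the bound C on its norm; this gives uniformity on the ball.\<close>

theorem char_W_tendsto:
  fixes L :: "real^'h^('k \<times> 'd)"
  assumes L: "limit_cov p \<kappa> \<phi> J = L ** transpose L" and e: "e > 0"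
  shows "\<forall>\<^sub>F x in G. \<forall>t. norm t \<le> C \<longrightarrow>
      cmod ((CLINT y|Q x. iexp (t \<bullet> W (x, y))) - exp (- (norm (transpose L *v t))\<^sup>2 / 2)) < e"
proof -
  define rem where "rem x = (\<Sum>i\<in>UNIV. real (N x i) * ((rn x / real (N x i) * (Kphi * C)) ^ 3 + (rn x / real (N x i) * (Kphi * C)) ^ 4))
    + C\<^sup>2 * (\<Sum>i\<in>UNIV. \<Sum>l\<in>UNIV. \<Sum>m\<in>UNIV. \<bar>array_cov x i l m - lim_cov i l m\<bar>)" for x
  have "(rem \<longlongrightarrow> 0 + C\<^sup>2 * (\<Sum>i\<in>UNIV. \<Sum>l\<in>UNIV. \<Sum>m\<in>UNIV. \<bar>lim_cov i l m - lim_cov i l m\<bar>)) G"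
    unfolding rem_def by (intro tendsto_intros remainder_tendsto array_cov_tendsto)
  then have "(rem \<longlongrightarrow> 0) G" by simp
  from order_tendstoD(2)[OF this e] N_pos show ?thesis
  proof eventually_elim
    fix x assume rem: "rem x < e" and N: "\<forall>i. 0 < N x i"
    show "\<forall>t. norm t \<le> C \<longrightarrow> cmod ((CLINT y|Q x. iexp (t \<bullet> W (x, y))) - exp (- (norm (transpose L *v t))\<^sup>2 / 2)) < e"
    proof (intro allI impI)
      fix t :: "real^('k \<times> 'd)" assume t: "norm t \<le> C"
      define v where "v i = (\<integral>u. (summand x t i u)\<^sup>2 \<partial>mu x i)" for i
      define \<psi> where "\<psi> i = (CLINT u|mu x i. iexp (summand x t i u))" for i
      define \<eta> where "\<eta> i = complex_of_real (exp (- (v i / 2)))" for i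
      define b where "b i = rn x / real (N x i) * (Kphi * C)" for i
      have small: "cmod (\<psi> i - \<eta> i) \<le> b i ^ 3 + b i ^ 4" and v0: "0 \<le> v i" for i
      proof -
        interpret prob_space "mu x i" by (rule prob_space_mu)
        have "summand x t i \<in> borel_measurable (mu x i)" using measurable_summand by (simp add: measurable_mu)
        note * = char_small_bounded[OF this summand_bound[OF t] summand_mean]
        show "cmod (\<psi> i - \<eta> i) \<le> b i ^ 3 + b i ^ 4" "0 \<le> v i"
          using * by (simp_all add: \<psi>_def \<eta>_def v_def b_def exp_of_real[symmetric])
      qed
      have \<psi>1: "cmod (\<psi> i) \<le> 1" for i
      proof -
        interpret prob_space "mu x i" by (rule prob_space_mu)
        have "summand x t i \<in> borel_measurable (mu x i)" using measurable_summand by (simp add: measurable_mu)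
        then show ?thesis unfolding \<psi>_def
          by (intro norm_expectation_le integrable_const_bound[of _ 1]) auto
      qed
      have \<eta>1: "cmod (\<eta> i) \<le> 1" for i using v0[of i] by (simp add: \<eta>_def)
      define s where "s = (\<Sum>i\<in>UNIV. real (N x i) * v i)"
      define s0 where "s0 = t \<bullet> (limit_cov p \<kappa> \<phi> J *v t)"
      have s0: "s0 = (norm (transpose L *v t))\<^sup>2"
        unfolding s0_def L power2_norm_eq_inner
        by (metis dot_lmul_matrix inner_commute matrix_vector_mul_assoc transpose_matrix_vector)
      \<comment> \<open>Telescoping: as all factors have modulus at most 1, products differ by no
        more than the sum of the differences of their factors.\<close>
      have "cmod ((\<Prod>i\<in>UNIV. \<psi> i ^ N x i) - (\<Prod>i\<in>UNIV. \<eta> i ^ N x i)) \<le> (\<Sum>i\<in>UNIV. cmod (\<psi> i ^ N x i - \<eta> i ^ N x i))"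
        using \<psi>1 \<eta>1 by (intro norm_prod_diff) (auto simp: norm_power power_le_one)
      also have "\<dots> \<le> (\<Sum>i\<in>UNIV. real (N x i) * (b i ^ 3 + b i ^ 4))"
      proof (rule sum_mono)
        fix i
        have "cmod (\<psi> i ^ N x i - \<eta> i ^ N x i) \<le> real (N x i) * cmod (\<psi> i - \<eta> i)"
          by (rule norm_power_diff[OF \<psi>1 \<eta>1])
        also have "\<dots> \<le> real (N x i) * (b i ^ 3 + b i ^ 4)" by (intro mult_left_mono small) simp
        finally show "cmod (\<psi> i ^ N x i - \<eta> i ^ N x i) \<le> real (N x i) * (b i ^ 3 + b i ^ 4)" .
      qed
      finally have 1: "cmod ((\<Prod>i\<in>UNIV. \<psi> i ^ N x i) - (\<Prod>i\<in>UNIV. \<eta> i ^ N x i)) \<le> (\<Sum>i\<in>UNIV. real (N x i) * (b i ^ 3 + b i ^ 4))" .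
      have \<eta>p: "(\<Prod>i\<in>UNIV. \<eta> i ^ N x i) = complex_of_real (exp (- (s / 2)))"
      proof -
        have "\<eta> i ^ N x i = complex_of_real (exp (- (real (N x i) * v i / 2)))" for i
          by (simp add: \<eta>_def flip: of_real_power exp_of_nat_mult)
        then have "(\<Prod>i\<in>UNIV. \<eta> i ^ N x i) = complex_of_real (exp (\<Sum>i\<in>UNIV. - (real (N x i) * v i / 2)))"
          by (simp add: exp_sum)
        also have "(\<Sum>i\<in>UNIV. - (real (N x i) * v i / 2)) = - (s / 2)"
          by (simp add: s_def sum_negf sum_divide_distrib)
        finally show ?thesis .
      qed
      have "\<bar>exp (- (s / 2)) - exp (- (s0 / 2))\<bar> \<le> \<bar>s / 2 - s0 / 2\<bar>"
        using v0 by (intro exp_minus_lipschitz) (auto simp: s_def s0 intro!: sum_nonneg)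
      also have "\<dots> \<le> \<bar>s - s0\<bar>" by (simp add: diff_divide_distrib[symmetric])
      also have "s - s0 = (\<Sum>i\<in>UNIV. \<Sum>l\<in>UNIV. \<Sum>m\<in>UNIV. t $ (i, l) * t $ (i, m) * (array_cov x i l m - lim_cov i l m))"
        unfolding s_def s0_def v_def inner_limit_cov using N
        by (simp add: summand_variance right_diff_distrib sum_subtractf)
      also have "\<bar>\<dots>\<bar> \<le> (\<Sum>i\<in>UNIV. \<Sum>l\<in>UNIV. \<Sum>m\<in>UNIV. \<bar>t $ (i, l) * t $ (i, m) * (array_cov x i l m - lim_cov i l m)\<bar>)"
        by (intro order_trans[OF sum_abs] sum_mono)+ simp
      also have "\<dots> \<le> (\<Sum>i\<in>UNIV. \<Sum>l\<in>UNIV. \<Sum>m\<in>UNIV. C\<^sup>2 * \<bar>array_cov x i l m - lim_cov i l m\<bar>)"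
      proof (intro sum_mono)
        fix i l m
        have "\<bar>t $ a\<bar> \<le> C" for a using component_le_norm_cart[of t a] t by simp
        then have "\<bar>t $ (i, l)\<bar> * \<bar>t $ (i, m)\<bar> \<le> C * C"
          by (intro mult_mono) (auto intro: order_trans[OF abs_ge_zero])
        then show "\<bar>t $ (i, l) * t $ (i, m) * (array_cov x i l m - lim_cov i l m)\<bar> \<le> C\<^sup>2 * \<bar>array_cov x i l m - lim_cov i l m\<bar>"
          by (simp add: abs_mult power2_eq_square mult_right_mono)
      qed
      also have "\<dots> = C\<^sup>2 * (\<Sum>i\<in>UNIV. \<Sum>l\<in>UNIV. \<Sum>m\<in>UNIV. \<bar>array_cov x i l m - lim_cov i l m\<bar>)"
        by (simp only: sum_distrib_left)
      finally have 2: "\<bar>exp (- (s / 2)) - exp (- (s0 / 2))\<bar> \<le> C\<^sup>2 * (\<Sum>i\<in>UNIV. \<Sum>l\<in>UNIV. \<Sum>m\<in>UNIV. \<bar>array_cov x i l m - lim_cov i l m\<bar>)" .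
      have 3: "cmod (complex_of_real (exp (- (s / 2))) - complex_of_real (exp (- (s0 / 2)))) = \<bar>exp (- (s / 2)) - exp (- (s0 / 2))\<bar>"
        by (simp only: of_real_diff[symmetric] norm_of_real)
      have "cmod ((\<Prod>i\<in>UNIV. \<psi> i ^ N x i) - complex_of_real (exp (- (s0 / 2)))) \<le> rem x"
        using 1 2 norm_triangle_ineq[of "(\<Prod>i\<in>UNIV. \<psi> i ^ N x i) - (\<Prod>i\<in>UNIV. \<eta> i ^ N x i)"
            "complex_of_real (exp (- (s / 2))) - complex_of_real (exp (- (s0 / 2)))"]
        unfolding 3 rem_def b_def[symmetric] \<eta>p by simp
      moreover have "complex_of_real (exp (- (s0 / 2))) = exp (- (norm (transpose L *v t))\<^sup>2 / 2)"
        by (simp add: s0 del: transpose_matrix_vector)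
      ultimately show "cmod ((CLINT y|Q x. iexp (t \<bullet> W (x, y))) - exp (- (norm (transpose L *v t))\<^sup>2 / 2)) < e"
        unfolding char_W_eq[OF N] \<psi>_def[symmetric] using rem by simp
    qed
  qed
qed

text \<open>U is a fixed continuous function of the pair (R, V); the pair differs from (W, E0) by a
  term tending to 0, and (W, E0) is tight. Centre and weight matrix are left general so that both
  the sample and the bootstrap statistic are covered.\<close>

theorem quadratic_statistic_tendsto:
  fixes L :: "real^'h^('k \<times> 'd)" and T E0 B :: "real^('k \<times> 'd)^('k \<times> 'd)" and V :: "'x \<times> 'y \<Rightarrow> real^('k \<times> 'd)^('k \<times> 'd)"
  assumes L: "limit_cov p \<kappa> \<phi> J = L ** transpose L"
    and V: "(V \<longlongrightarrow> E0) (wp G Q)"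
    and B: "\<And>v. (T *v v) \<bullet> (E0 *v (T *v v)) = (norm (B *v v))\<^sup>2"
    and U: "\<And>z. U z = real (total_size (N (fst z))) *
       ((T *v (emp_quantiles p (N (fst z)) (Y (fst z) (snd z)) - c (fst z))) \<bullet>
        (V z *v (T *v (emp_quantiles p (N (fst z)) (Y (fst z) (snd z)) - c (fst z)))))"
    and meas: "\<And>x. (\<lambda>y. U (x, y)) \<in> borel_measurable (Q x)" and e: "e > 0"
  shows "\<forall>\<^sub>F x in G. measure (Q x) {y \<in> space (Q x). U (x, y) \<le> s} < gauss_quad_cdf (B ** L) (s + e) + e"
    and "\<forall>\<^sub>F x in G. measure (Q x) {y \<in> space (Q x). U (x, y) \<le> s} > gauss_quad_cdf (B ** L) (s - e) - e"
proof -
  define f :: "(real^('k \<times> 'd)) \<times> (real^('k \<times> 'd)^('k \<times> 'd)) \<Rightarrow> real"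
    where "f u = (T *v fst u) \<bullet> (snd u *v (T *v fst u))" for u
  have f: "continuous_on UNIV f" unfolding f_def by (intro continuous_intros)
  have tight: "tight_wp G Q (\<lambda>z. (W z, E0))"
  proof (rule tight_wp_mono[OF tight_W])
    fix C
    show "\<exists>C'. \<forall>z. norm (W z) \<le> C \<longrightarrow> norm (W z, E0) \<le> C'"
      using norm_Pair_le[of _ E0] by (intro exI[of _ "C + norm E0"]) (auto intro: order_trans add_right_mono)
  qed
  have "((\<lambda>z. (R z, V z) - (W z, E0)) \<longlongrightarrow> (0, 0)) (wp G Q)"
    unfolding diff_Pair using V by (intro tendsto_Pair R_minus_W_tendsto) (simp add: Lim_null[symmetric])
  then have "((\<lambda>z. (R z, V z) - (W z, E0)) \<longlongrightarrow> 0) (wp G Q)" by (simp add: zero_prod_def)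
  from tendsto_wp_continuous_diff[OF tight this f]
  have lim: "((\<lambda>z. dist (f (R z, V z)) (f (W z, E0))) \<longlongrightarrow> 0) (wp G Q)" .
  have "U z = f (R z, V z)" for z
  proof -
    have "f (R z, V z) = (rn (fst z) * rn (fst z)) *
       ((T *v (emp_quantiles p (N (fst z)) (Y (fst z) (snd z)) - c (fst z))) \<bullet>
        (V z *v (T *v (emp_quantiles p (N (fst z)) (Y (fst z) (snd z)) - c (fst z)))))"
      by (simp add: f_def R_def matrix_vector_mult_scaleR)
    then show ?thesis by (simp add: U rn_square)
  qed
  with lim have close: "((\<lambda>z. U z - (norm (B *v W z))\<^sup>2) \<longlongrightarrow> 0) (wp G Q)"
    by (simp add: f_def B dist_real_def tendsto_rabs_zero_iff)
  show "\<forall>\<^sub>F x in G. measure (Q x) {y \<in> space (Q x). U (x, y) \<le> s} < gauss_quad_cdf (B ** L) (s + e) + e"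
    and "\<forall>\<^sub>F x in G. measure (Q x) {y \<in> space (Q x). U (x, y) \<le> s} > gauss_quad_cdf (B ** L) (s - e) - e"
    by (rule prob_le_eventually_if_close_to_quadratic[OF measurable_W _ meas close e], rule char_W_tendsto[OF L], assumption)+
qed

end

section \<open>The bootstrap\<close>

text \<open>The randomness is moved to index functions h, whose law does not depend on the data. A
  bootstrap probability thus becomes a finite sum over h of terms that are measurable in the
  data.\<close>

definition resample :: "('k \<Rightarrow> nat) \<Rightarrow> ('k \<times> nat \<Rightarrow> real^'d) \<Rightarrow> ('k \<times> nat \<Rightarrow> nat) \<Rightarrow> ('k \<times> nat \<Rightarrow> real^'d)" where
  "resample N x h = (\<lambda>a\<in>obs_index N. x (fst a, h a))"

definition resample_pmf :: "('k::finite \<Rightarrow> nat) \<Rightarrow> ('k \<times> nat \<Rightarrow> nat) pmf" where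
  "resample_pmf N = Pi_pmf (obs_index N) 0 (\<lambda>a. pmf_of_set {..<N (fst a)})"

lemma finite_obs_index [simp]: "finite (obs_index (N :: 'k::finite \<Rightarrow> nat))"
  by (simp add: obs_index_def)

lemma bootstrap_eq_map_resample: "bootstrap N x = map_pmf (resample N x) (resample_pmf N)"
proof -
  have "bootstrap N x = Pi_pmf (obs_index N) undefined
      (\<lambda>a. bind_pmf (pmf_of_set {..<N (fst a)}) (\<lambda>h. return_pmf (x (fst a, h))))"
    unfolding bootstrap_def by (intro Pi_pmf_cong refl) (auto simp: map_pmf_def case_prod_unfold)
  \<comment> \<open>Off \<open>obs_index N\<close> the index functions have the default 0, while
    \<open>resample\<close> restricts and so returns \<open>undefined\<close>, the default of
    \<open>bootstrap\<close>.\<close>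
  also have "\<dots> = bind_pmf (resample_pmf N) (\<lambda>h. return_pmf (resample N x h))"
    unfolding resample_pmf_def
    by (subst Pi_pmf_bind[where d' = 0]) (simp_all add: resample_def restrict_def)
  finally show ?thesis by (simp add: map_pmf_def)
qed

lemma set_resample_pmf:
  assumes "h \<in> set_pmf (resample_pmf N)" "a \<in> obs_index N"
  shows "h a < N (fst a)"
proof -
  \<comment> \<open>\<open>pmf_of_set\<close> has the expected support for nonempty sets; the
    membership of a provides this.\<close>
  have "{..<N (fst a)} \<noteq> {}" using assms(2) by (auto simp: obs_index_def)
  moreover have "h a \<in> set_pmf (pmf_of_set {..<N (fst a)})"
    using assms set_Pi_pmf[of "obs_index N" 0 "\<lambda>a. pmf_of_set {..<N (fst a)}"]
    by (cases a) (auto simp: resample_pmf_def PiE_dflt_def)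
  ultimately show ?thesis by (simp add: set_pmf_of_set)
qed

lemma finite_set_resample_pmf: "finite (set_pmf (resample_pmf N))"
proof -
  have "set_pmf (resample_pmf N) \<subseteq> PiE_dflt (obs_index N) 0 (\<lambda>a. {..<N (fst a)})"
    using set_resample_pmf[of _ N] set_Pi_pmf_subset[of "obs_index N" 0 "\<lambda>a. pmf_of_set {..<N (fst a)}"]
    unfolding PiE_dflt_def resample_pmf_def by fastforce
  then show ?thesis by (rule finite_subset) (intro finite_PiE_dflt, auto)
qed

section \<open>Measurability of bootstrap probabilities and critical values\<close>

lemma measurable_resample:
  assumes "h \<in> set_pmf (resample_pmf N)"
  shows "(\<lambda>x. resample N x h) \<in> measurable (sample_space N) (sample_space N)"
  unfolding resample_def sample_space_def
proof (rule measurable_restrict)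
  fix a assume "a \<in> obs_index N"
  then have "(fst a, h a) \<in> obs_index N" using set_resample_pmf[OF assms, of a] by (simp add: obs_index_def)
  then show "(\<lambda>x. x (fst a, h a)) \<in> borel_measurable (PiM (obs_index N) (\<lambda>_. borel))"
    by (rule measurable_component_singleton)
qed

lemma borel_measurable_prob_bootstrap:
  assumes "\<And>h. h \<in> set_pmf (resample_pmf N) \<Longrightarrow> {x \<in> space (sample_space N). D x (resample N x h)} \<in> sets (sample_space N)"
  shows "(\<lambda>x. measure_pmf.prob (bootstrap N x) {y. D x y}) \<in> borel_measurable (sample_space N)"
proof -
  let ?H = "set_pmf (resample_pmf N)"
  have "measure_pmf.prob (bootstrap N x) {y. D x y} = (\<Sum>h\<in>?H. of_bool (D x (resample N x h)) * pmf (resample_pmf N) h)" for x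
  proof -
    have "measure_pmf.prob (bootstrap N x) {y. D x y} = measure_pmf.prob (resample_pmf N) {h. D x (resample N x h)}"
      unfolding bootstrap_eq_map_resample by (simp add: vimage_def)
    also have "\<dots> = measure_pmf.expectation (resample_pmf N) (indicator {h. D x (resample N x h)})" by simp
    also have "\<dots> = (\<Sum>h\<in>?H. indicator {h. D x (resample N x h)} h * pmf (resample_pmf N) h)"
      by (rule integral_measure_pmf_real[OF finite_set_resample_pmf]) auto
    finally show ?thesis by (simp add: indicator_def)
  qed
  moreover have "(\<lambda>x. of_bool (D x (resample N x h)) :: real) \<in> borel_measurable (sample_space N)" if "h \<in> ?H" for h
    unfolding of_bool_def using assms[OF that] by (intro measurable_If) auto
  ultimately show ?thesis by simp
qed

lemma measurable_observation: "a \<in> obs_index N \<Longrightarrow> (\<lambda>x. x a) \<in> borel_measurable (sample_space N)"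
  unfolding sample_space_def by (rule measurable_component_singleton)

lemma borel_measurable_emp_cdf: "(\<lambda>x. emp_cdf N x i l t) \<in> borel_measurable (sample_space N)"
  unfolding emp_cdf_def
proof (intro borel_measurable_divide borel_measurable_sum borel_measurable_const)
  fix j assume "j \<in> {..<N i}"
  then have "(\<lambda>x. x (i, j)) \<in> borel_measurable (sample_space N)"
    by (intro measurable_observation) (auto simp: obs_index_def)
  then have "(\<lambda>x. x (i, j) $ l) \<in> borel_measurable (sample_space N)" by (rule borel_measurable_vec_nth)
  then show "(\<lambda>x. of_bool (x (i, j) $ l \<le> t) :: real) \<in> borel_measurable (sample_space N)"
    unfolding of_bool_def by measurable
qed

text \<open>For an empty group the empirical quantile is the constant \<open>Inf {}\<close>.\<close>

lemma borel_measurable_emp_quantiles: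
  assumes "0 < p" "p < 1"
  shows "emp_quantiles p N \<in> borel_measurable (sample_space N)"
proof -
  have "(\<lambda>x. quantile (emp_cdf N x i l) p) \<in> borel_measurable (sample_space N)" for i l
  proof (cases "N i > 0")
    case True
    show ?thesis
    proof (rule borel_measurableI_le)
      fix t
      have "quantile (emp_cdf N x i l) p \<le> t \<longleftrightarrow> p \<le> emp_cdf N x i l t" for x
        using emp_quantiles_le_iff[of N i p x l t, OF True assms] by (simp add: emp_quantiles_def)
      moreover have "{x \<in> space (sample_space N). p \<le> emp_cdf N x i l t} \<in> sets (sample_space N)"
        using borel_measurable_emp_cdf by (intro borel_measurable_le) auto
      ultimately show "{x \<in> space (sample_space N). quantile (emp_cdf N x i l) p \<le> t} \<in> sets (sample_space N)" by simp
    qed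
  next
    case False
    then have "emp_cdf N x i l t = 0" for x t by (simp add: emp_cdf_def)
    then show ?thesis by (simp add: quantile_def)
  qed
  then show ?thesis unfolding emp_quantiles_def[abs_def] by (intro borel_measurable_vec_lambda)
qed

lemma borel_measurable_quad_stat:
  assumes "E T \<in> borel_measurable borel" "A \<in> borel_measurable K" "v \<in> borel_measurable K"
  shows "(\<lambda>x. quad_stat E n T (A x) (v x)) \<in> borel_measurable K"
proof -
  have [measurable]: "(\<lambda>x. E T (A x)) \<in> borel_measurable K" by (rule measurable_compose[OF assms(2,1)])
  note [measurable] = assms(3)
  show ?thesis unfolding quad_stat_def by measurable
qed

lemma borel_measurable_test_stat:
  assumes "0 < p" "p < 1" "E T \<in> borel_measurable borel" "V \<in> borel_measurable (sample_space N)"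
  shows "test_stat E p N V T \<in> borel_measurable (sample_space N)"
  unfolding test_stat_def[abs_def]
  by (intro borel_measurable_quad_stat assms borel_measurable_emp_quantiles)

lemma borel_measurable_boot_cdf:
  assumes "0 < p" "p < 1" "E T \<in> borel_measurable borel" "V \<in> borel_measurable (sample_space N)"
  shows "(\<lambda>x. measure_pmf.prob (bootstrap N x) {y. boot_stat E p N V T x y \<le> s}) \<in> borel_measurable (sample_space N)"
proof (rule borel_measurable_prob_bootstrap)
  fix h assume "h \<in> set_pmf (resample_pmf N)"
  note r = measurable_resample[OF this]
  have "(\<lambda>x. boot_stat E p N V T x (resample N x h)) \<in> borel_measurable (sample_space N)"
    unfolding boot_stat_def
    by (intro borel_measurable_quad_stat borel_measurable_diff assms borel_measurable_emp_quantiles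
        measurable_compose[OF r])
  then show "{x \<in> space (sample_space N). boot_stat E p N V T x (resample N x h) \<le> s} \<in> sets (sample_space N)"
    by (intro borel_measurable_le) auto
qed

text \<open>For fixed data the bootstrap statistic has a real distribution, so events about the
  random critical value become events about the bootstrap distribution function at a fixed
  s.\<close>

lemma boot_critical_value_le_iff:
  assumes "0 < \<alpha>" "\<alpha> < 1"
  shows "boot_critical_value E p N V T \<alpha> x \<le> s \<longleftrightarrow>
    1 - \<alpha> \<le> measure_pmf.prob (bootstrap N x) {y. boot_stat E p N V T x y \<le> s}"
proof -
  let ?\<mu> = "distr (measure_pmf (bootstrap N x)) borel (boot_stat E p N V T x)"
  have rd: "real_distribution ?\<mu>"
    by (rule prob_space.real_distribution_distr[OF prob_space_measure_pmf]) simp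
  have "cdf ?\<mu> = (\<lambda>s. measure_pmf.prob (bootstrap N x) {y. boot_stat E p N V T x y \<le> s})"
    unfolding cdf_def by (subst measure_distr) (auto simp: vimage_def)
  then show ?thesis
    using quantile_cdf_le_iff[OF rd, of "1 - \<alpha>" s] assms by (simp add: boot_critical_value_def)
qed

lemma borel_measurable_boot_critical_value:
  assumes "0 < p" "p < 1" "E T \<in> borel_measurable borel" "V \<in> borel_measurable (sample_space N)" "0 < \<alpha>" "\<alpha> < 1"
  shows "boot_critical_value E p N V T \<alpha> \<in> borel_measurable (sample_space N)"
proof (rule borel_measurableI_le)
  fix s
  show "{x \<in> space (sample_space N). boot_critical_value E p N V T \<alpha> x \<le> s} \<in> sets (sample_space N)"
    unfolding boot_critical_value_le_iff[OF assms(5,6)]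
    using borel_measurable_boot_cdf[where E = E and T = T, OF assms(1-4)] by (intro borel_measurable_le) auto
qed

section \<open>From distribution functions to the level of the test\<close>

lemma tendsto_if_shifted_bounds:
  fixes F :: "real \<Rightarrow> real"
  assumes F: "isCont F s"
    and up: "\<And>e. e > 0 \<Longrightarrow> \<forall>\<^sub>F x in G. H x < F (s + e) + e"
    and lo: "\<And>e. e > 0 \<Longrightarrow> \<forall>\<^sub>F x in G. H x > F (s - e) - e"
  shows "(H \<longlongrightarrow> F s) G"
proof (rule tendstoI)
  fix e :: real assume e: "e > 0"
  from F e obtain d where d: "d > 0" "\<And>u. dist u s < d \<Longrightarrow> dist (F u) (F s) < e / 2"
    unfolding continuous_at_eps_delta by (metis half_gt_zero)
  define h where "h = min (d / 2) (e / 2)"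
  have h: "h > 0" "h < d" "h \<le> e / 2" using d e by (auto simp: h_def min_def)
  have "dist (F (s + h)) (F s) < e / 2" "dist (F (s - h)) (F s) < e / 2"
    by (rule d(2), use h in \<open>simp add: dist_real_def\<close>)+
  then have *: "F (s + h) + h < F s + e" "F s - e < F (s - h) - h"
    using h unfolding dist_real_def abs_less_iff by linarith+
  from up[OF h(1)] lo[OF h(1)]
  show "\<forall>\<^sub>F x in G. dist (H x) (F s) < e"
    by eventually_elim (use * in \<open>simp add: dist_real_def abs_less_iff\<close>)
qed

lemma cdf_value_exists:
  fixes F :: "real \<Rightarrow> real"
  assumes "\<And>s. isCont F s" "(F \<longlongrightarrow> 1) at_top" "(F \<longlongrightarrow> 0) at_bot" "0 < v" "v < 1"
  obtains s where "F s = v"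
proof -
  from order_tendstoD(2)[OF assms(3,4)] obtain a where a: "\<And>x. x \<le> a \<Longrightarrow> F x < v"
    by (auto simp: eventually_at_bot_linorder)
  from order_tendstoD(1)[OF assms(2,5)] obtain b where b: "\<And>x. b \<le> x \<Longrightarrow> v < F x"
    by (auto simp: eventually_at_top_linorder)
  have "\<exists>x\<ge>min a b. x \<le> max a b \<and> F x = v"
    by (intro IVT) (use a[of "min a b"] b[of "max a b"] assms(1) in \<open>auto intro: less_imp_le\<close>)
  then show thesis using that by blast
qed

text \<open>The random critical value lies between two fixed numbers at which the
  limit distribution function is close to \<open>1 - \<alpha>\<close>.\<close>

lemma test_level_tendsto:
  fixes M :: "'a measure" and U b :: "nat \<Rightarrow> 'a \<Rightarrow> real" and H :: "nat \<times> 'a \<Rightarrow> real \<Rightarrow> real"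
  assumes M: "prob_space M"
    and Um [measurable]: "\<And>n. U n \<in> borel_measurable M" and bm [measurable]: "\<And>n. b n \<in> borel_measurable M"
    and F: "\<And>s. isCont F s" "(F \<longlongrightarrow> 1) at_top" "(F \<longlongrightarrow> 0) at_bot"
    and U: "\<And>s. (\<lambda>n. measure M {\<omega> \<in> space M. U n \<omega> \<le> s}) \<longlonglongrightarrow> F s"
    and H: "\<And>s. ((\<lambda>z. H z s) \<longlongrightarrow> F s) (wp sequentially (\<lambda>_. M))"
    and b: "\<And>n \<omega> s. b n \<omega> \<le> s \<longleftrightarrow> 1 - \<alpha> \<le> H (n, \<omega>) s"
    and \<alpha>: "0 < \<alpha>" "\<alpha> < 1"
  shows "(\<lambda>n. measure M {\<omega> \<in> space M. U n \<omega> > b n \<omega>}) \<longlonglongrightarrow> \<alpha>"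
proof (rule tendstoI)
  fix e :: real assume e: "e > 0"
  interpret prob_space M by (rule M)
  interpret prob_family "\<lambda>_::nat. M" by (rule prob_family.intro) (rule M)
  \<comment> \<open>Three errors of size d add up in the final estimate; d < \<alpha> and d < 1 -
    \<alpha> keep both levels 1 - \<alpha> - d and 1 - \<alpha> + d inside (0, 1).\<close>
  define d where "d = min (e / 4) (min (\<alpha> / 2) ((1 - \<alpha>) / 2))"
  have d: "d > 0" "3 * d < e" "d < \<alpha>" "d < 1 - \<alpha>" using e \<alpha> by (auto simp: d_def min_def)
  obtain s1 where s1: "F s1 = 1 - \<alpha> - d"
    by (rule cdf_value_exists[OF F, of "1 - \<alpha> - d"]) (use d \<alpha> in auto)
  obtain s2 where s2: "F s2 = 1 - \<alpha> + d"
    by (rule cdf_value_exists[OF F, of "1 - \<alpha> + d"]) (use d \<alpha> in auto)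
  have "\<forall>\<^sub>F z in wp sequentially (\<lambda>_. M). H z s1 < 1 - \<alpha>"
    by (rule order_tendstoD(2)[OF H]) (use s1 d in auto)
  then have "\<forall>\<^sub>F z in wp sequentially (\<lambda>_. M). \<not> b (fst z) (snd z) \<le> s1"
    by eventually_elim (simp add: b)
  from eventually_wp_prob[OF this _ d(1)]
  have 1: "\<forall>\<^sub>F n in sequentially. 1 - d \<le> prob {\<omega> \<in> space M. \<not> b n \<omega> \<le> s1}" by simp
  have "\<forall>\<^sub>F z in wp sequentially (\<lambda>_. M). H z s2 > 1 - \<alpha>"
    by (rule order_tendstoD(1)[OF H]) (use s2 d in auto)
  then have "\<forall>\<^sub>F z in wp sequentially (\<lambda>_. M). b (fst z) (snd z) \<le> s2"
    by eventually_elim (simp add: b)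
  from eventually_wp_prob[OF this _ d(1)]
  have 2: "\<forall>\<^sub>F n in sequentially. 1 - d \<le> prob {\<omega> \<in> space M. b n \<omega> \<le> s2}" by simp
  have 3: "\<forall>\<^sub>F n in sequentially. dist (prob {\<omega> \<in> space M. U n \<omega> \<le> s1}) (F s1) < d"
    "\<forall>\<^sub>F n in sequentially. dist (prob {\<omega> \<in> space M. U n \<omega> \<le> s2}) (F s2) < d"
    by (rule tendstoD[OF U d(1)])+
  from 1 2 3 show "\<forall>\<^sub>F n in sequentially. dist (prob {\<omega> \<in> space M. U n \<omega> > b n \<omega>}) \<alpha> < e"
  proof eventually_elim
    fix n
    assume 1: "1 - d \<le> prob {\<omega> \<in> space M. \<not> b n \<omega> \<le> s1}"
      and 2: "1 - d \<le> prob {\<omega> \<in> space M. b n \<omega> \<le> s2}"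
      and 3: "dist (prob {\<omega> \<in> space M. U n \<omega> \<le> s1}) (F s1) < d" "dist (prob {\<omega> \<in> space M. U n \<omega> \<le> s2}) (F s2) < d"
    let ?T = "{\<omega> \<in> space M. U n \<omega> > b n \<omega>}"
    \<comment> \<open>Rejection forces U above s1 or a critical value of at most s1.\<close>
    have "prob ?T \<le> prob ({\<omega> \<in> space M. \<not> U n \<omega> \<le> s1} \<union> {\<omega> \<in> space M. b n \<omega> \<le> s1})"
      by (intro finite_measure_mono) auto
    also have "\<dots> \<le> prob {\<omega> \<in> space M. \<not> U n \<omega> \<le> s1} + prob {\<omega> \<in> space M. b n \<omega> \<le> s1}"
      by (intro measure_Un_le) auto
    also have "prob {\<omega> \<in> space M. \<not> U n \<omega> \<le> s1} = 1 - prob {\<omega> \<in> space M. U n \<omega> \<le> s1}"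
      by (intro prob_neg) measurable
    finally have up: "prob ?T \<le> 1 - prob {\<omega> \<in> space M. U n \<omega> \<le> s1} + prob {\<omega> \<in> space M. b n \<omega> \<le> s1}" .
    have c1: "prob {\<omega> \<in> space M. \<not> b n \<omega> \<le> s1} = 1 - prob {\<omega> \<in> space M. b n \<omega> \<le> s1}"
      by (intro prob_neg) measurable
    \<comment> \<open>Conversely, U above s2 and a critical value of at most s2 force
      rejection.\<close>
    have "prob {\<omega> \<in> space M. \<not> U n \<omega> \<le> s2} \<le> prob (?T \<union> {\<omega> \<in> space M. \<not> b n \<omega> \<le> s2})"
      by (intro finite_measure_mono) auto
    also have "\<dots> \<le> prob ?T + prob {\<omega> \<in> space M. \<not> b n \<omega> \<le> s2}"
      by (intro measure_Un_le) auto
    also have "prob {\<omega> \<in> space M. \<not> b n \<omega> \<le> s2} = 1 - prob {\<omega> \<in> space M. b n \<omega> \<le> s2}"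
      by (intro prob_neg) measurable
    finally have lo: "prob {\<omega> \<in> space M. \<not> U n \<omega> \<le> s2} \<le> prob ?T + (1 - prob {\<omega> \<in> space M. b n \<omega> \<le> s2})" .
    have c2: "prob {\<omega> \<in> space M. \<not> U n \<omega> \<le> s2} = 1 - prob {\<omega> \<in> space M. U n \<omega> \<le> s2}"
      by (intro prob_neg) measurable
    show "dist (prob ?T) \<alpha> < e"
      using up lo c1 c2 1 2 3 d(2) s1 s2 unfolding dist_real_def abs_less_iff by linarith
  qed
qed

section \<open>The sample and its bootstrap as two sampling arrays\<close>

locale quantile_bootstrap = prob_space M
  for M :: "'a measure" +
  fixes X :: "'k::finite \<Rightarrow> nat \<Rightarrow> 'a \<Rightarrow> real^'d" and P :: "'k \<Rightarrow> (real^'d) measure"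
    and N :: "nat \<Rightarrow> 'k \<Rightarrow> nat" and \<kappa> :: "'k \<Rightarrow> real" and p :: real and \<phi> :: "'k \<Rightarrow> 'd \<Rightarrow> real"
    and q :: "real^('k \<times> 'd)" and J :: "'k \<Rightarrow> 'd \<Rightarrow> 'd \<Rightarrow> real"
  assumes indep_X: "indep_vars (\<lambda>_. borel) (\<lambda>(i, j). X i j) UNIV"
    and law_X: "distr M borel (X i j) = P i"
    and p01: "0 < p" "p < 1"
    and q_def: "q = pop_quantiles p P"
    and size_N: "filterlim (\<lambda>\<nu>. total_size (N \<nu>)) at_top sequentially"
    and ratio_N: "(\<lambda>\<nu>. real (N \<nu> i) / real (total_size (N \<nu>))) \<longlonglongrightarrow> \<kappa> i" and \<kappa>_pos: "\<kappa> i > 0"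
    and deriv_q: "(marginal_cdf (P i) l has_real_derivative \<phi> i l) (at (q $ (i, l)))" and \<phi>_pos: "\<phi> i l > 0"
    and J_def: "J i l m = joint_cdf (P i) l m (q $ (i, l)) (q $ (i, m))"
begin

lemma measurable_X: "X i j \<in> borel_measurable M"
  using indep_X by (auto simp: indep_vars_def)

lemma prob_space_P: "prob_space (P i)"
  using prob_space_distr[OF measurable_X[of i 0]] by (simp add: law_X)

lemma sets_P: "sets (P i) = sets borel"
  using sets_distr[of M borel "X i 0"] by (simp only: law_X)

text \<open>The infimum gives values below p to the left of q and at least p at q itself; continuity
  closes the gap.\<close>

lemma cdf_q: "marginal_cdf (P i) l (q $ (i, l)) = p"
proof -
  note rd = real_distribution_marginal[OF prob_space_P sets_P, of i l]
  have q: "q $ (i, l) = quantile (marginal_cdf (P i) l) p"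
    by (simp add: q_def pop_quantiles_def pop_quantile_def)
  note le = quantile_cdf_le_iff[OF rd p01, folded marginal_cdf_def, folded q]
  have "isCont (marginal_cdf (P i) l) (q $ (i, l))"
    using deriv_q by (rule DERIV_isCont)
  then have "(marginal_cdf (P i) l \<longlongrightarrow> marginal_cdf (P i) l (q $ (i, l))) (at_left (q $ (i, l)))"
    by (simp add: isCont_def filterlim_at_split)
  moreover have "marginal_cdf (P i) l t \<le> p" if "t < q $ (i, l)" for t
    using le[of t] that by linarith
  then have "\<forall>\<^sub>F t in at_left (q $ (i, l)). marginal_cdf (P i) l t \<le> p"
    by (auto simp: eventually_at_filter)
  ultimately have "marginal_cdf (P i) l (q $ (i, l)) \<le> p"
    by (intro tendsto_upperbound) auto
  with le[of "q $ (i, l)"] show ?thesis by simp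
qed

lemma measurable_observed: "observed X (N \<nu>) \<in> measurable M (sample_space (N \<nu>))"
  unfolding observed_def sample_space_def
  by (rule measurable_restrict) (auto simp: measurable_X split: prod.splits)

lemma observed_apply: "a \<in> obs_index (N \<nu>) \<Longrightarrow> observed X (N \<nu>) \<omega> a = X (fst a) (snd a) \<omega>"
  by (simp add: observed_def case_prod_unfold)

sublocale U: array_sampling "\<lambda>_. M" sequentially N "\<lambda>\<nu> \<omega>. observed X (N \<nu>) \<omega>" "\<lambda>_. P" "\<lambda>_. q" p \<kappa> \<phi> J
proof (intro array_sampling.intro prob_family.intro array_sampling_axioms.intro)
  fix \<nu>
  have "indep_vars (\<lambda>_. borel) (\<lambda>(i, j). X i j) (obs_index (N \<nu>))"
    by (rule indep_vars_subset[OF indep_X]) simp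
  then show "indep_vars (\<lambda>_. borel) (\<lambda>a \<omega>. observed X (N \<nu>) \<omega> a) (obs_index (N \<nu>))"
    by (rule indep_vars_cong[THEN iffD1, rotated 3]) (auto simp: observed_apply fun_eq_iff)
next
  fix j \<nu> i assume "j < N \<nu> i"
  then have "(i, j) \<in> obs_index (N \<nu>)" by (simp add: obs_index_def)
  then have "(\<lambda>\<omega>. observed X (N \<nu>) \<omega> (i, j)) = X i j" by (simp add: observed_apply fun_eq_iff)
  then show "distr M borel (\<lambda>\<omega>. observed X (N \<nu>) \<omega> (i, j)) = P i" by (simp add: law_X)
next
  fix i l s
  let ?F = "marginal_cdf (P i) l" and ?q = "q $ (i, l)" and ?r = "\<lambda>\<nu>. sqrt (real (total_size (N \<nu>)))"
  have r: "filterlim ?r at_top sequentially"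
    using size_N by (intro filterlim_compose[OF sqrt_at_top] filterlim_compose[OF filterlim_real_sequentially])
  show "(\<lambda>\<nu>. ?r \<nu> * (?F (?q + s / ?r \<nu>) - p)) \<longlonglongrightarrow> \<phi> i l * s"
  \<comment> \<open>The difference quotient converges along \<open>at 0\<close>, which excludes a
    zero increment.\<close>
  proof (cases "s = 0")
    case True then show ?thesis by (simp add: cdf_q)
  next
    case False
    have rp: "\<forall>\<^sub>F \<nu> in sequentially. ?r \<nu> > 0" using r unfolding filterlim_at_top_dense by blast
    have "(\<lambda>\<nu>. s / ?r \<nu>) \<longlonglongrightarrow> 0"
      by (rule tendsto_divide_0[OF tendsto_const filterlim_at_top_imp_at_infinity[OF r]])
    then have h: "filterlim (\<lambda>\<nu>. s / ?r \<nu>) (at 0) sequentially"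
      unfolding filterlim_at using rp False by (auto elim!: eventually_mono)
    have "((\<lambda>h. (?F (?q + h) - ?F ?q) / h) \<longlongrightarrow> \<phi> i l) (at 0)"
      using deriv_q by (simp add: DERIV_def)
    from tendsto_mult[OF filterlim_compose[OF this h] tendsto_const[of s]]
    have "(\<lambda>\<nu>. (?F (?q + s / ?r \<nu>) - ?F ?q) / (s / ?r \<nu>) * s) \<longlonglongrightarrow> \<phi> i l * s" .
    then show ?thesis
    proof (rule Lim_transform_eventually)
      show "\<forall>\<^sub>F \<nu> in sequentially. (?F (?q + s / ?r \<nu>) - ?F ?q) / (s / ?r \<nu>) * s = ?r \<nu> * (?F (?q + s / ?r \<nu>) - p)"
        using rp by eventually_elim (use False in \<open>simp add: cdf_q\<close>)
    qed
  qed
next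
  fix i l m
  show "(\<lambda>\<nu>. measure (P i) {v. v $ l \<le> q $ (i, l) \<and> v $ m \<le> q $ (i, m)}) \<longlonglongrightarrow> J i l m"
    using sets_eq_imp_space_eq[OF sets_P] by (simp add: J_def joint_cdf_def)
qed (rule prob_space_P sets_P p01 size_N ratio_N \<kappa>_pos \<phi>_pos prob_space_axioms)+

abbreviation obs :: "nat \<times> 'a \<Rightarrow> 'k \<times> nat \<Rightarrow> real^'d" where
  "obs z \<equiv> observed X (N (fst z)) (snd z)"

abbreviation in_prob :: "(nat \<times> 'a) filter" where
  "in_prob \<equiv> wp sequentially (\<lambda>_. M)"

text \<open>Weak law of large numbers: the deviation from p is A at s = 0 divided by rn, and A is
  close to the tight variable -\<phi> W there.\<close>

lemma emp_cdf_at_q_tendsto: "((\<lambda>z. emp_cdf (N (fst z)) (obs z) i l (q $ (i, l))) \<longlongrightarrow> p) in_prob"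
proof -
  have i: "((\<lambda>z. 1 / U.rn (fst z)) \<longlongrightarrow> 0) in_prob"
    by (rule filterlim_compose[OF U.inverse_rn U.filterlim_fst_wp])
  have t: "tight_wp sequentially (\<lambda>_. M) (\<lambda>z. U.W z $ (i, l))"
  proof (rule U.tight_wp_mono[OF U.tight_W])
    fix C show "\<exists>C'. \<forall>z. norm (U.W z) \<le> C \<longrightarrow> norm (U.W z $ (i, l)) \<le> C'"
      by (intro exI[of _ C] allI impI) (metis component_le_norm_cart order_trans real_norm_def)
  qed
  note tm = U.tendsto_wp_tight_mult[OF i t]
  have "((\<lambda>z. 1 / U.rn (fst z) * (U.A i l 0 z + \<phi> i l * (U.W z $ (i, l) - 0))
      - \<phi> i l * ((1 / U.rn (fst z)) *\<^sub>R U.W z $ (i, l)) + p) \<longlongrightarrow> 0 * 0 - \<phi> i l * 0 + p) in_prob"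
    by (intro tendsto_add tendsto_diff tendsto_mult tendsto_const i U.A_tendsto tm)
  then have "((\<lambda>z. 1 / U.rn (fst z) * (U.A i l 0 z + \<phi> i l * (U.W z $ (i, l) - 0))
      - \<phi> i l * ((1 / U.rn (fst z)) *\<^sub>R U.W z $ (i, l)) + p) \<longlongrightarrow> p) in_prob" by simp
  then show ?thesis
  proof (rule Lim_transform_eventually)
    show "\<forall>\<^sub>F z in in_prob. 1 / U.rn (fst z) * (U.A i l 0 z + \<phi> i l * (U.W z $ (i, l) - 0))
      - \<phi> i l * ((1 / U.rn (fst z)) *\<^sub>R U.W z $ (i, l)) + p = emp_cdf (N (fst z)) (obs z) i l (q $ (i, l))"
      using U.eventually_wp_fst[OF U.rn_pos]
      by eventually_elim (simp add: U.A_def distrib_left)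
  qed
qed

text \<open>The substitute for differentiability at a random centre: moving s / rn away from the
  empirical quantile means evaluating A at the random argument R + s. There A is close to \<phi> (R
  + s - W), and R - W tends to 0.\<close>

lemma emp_local:
  "((\<lambda>z. U.rn (fst z) * (emp_cdf (N (fst z)) (obs z) i l (emp_quantiles p (N (fst z)) (obs z) $ (i, l) + s / U.rn (fst z)) - p))
    \<longlongrightarrow> \<phi> i l * s) in_prob"
proof -
  have RW: "((\<lambda>z. U.R z $ (i, l) - U.W z $ (i, l)) \<longlongrightarrow> 0) in_prob"
    using tendsto_vec_nth[OF U.R_minus_W_tendsto, of "(i, l)"] by simp
  from tendstoD[OF RW zero_less_one]
  have "\<forall>\<^sub>F z in in_prob. \<bar>(U.R z $ (i, l) + s) - U.W z $ (i, l)\<bar> \<le> \<bar>s\<bar> + 1"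
    by eventually_elim (simp add: dist_real_def)
  from U.A_tendsto_random[OF this]
  have "((\<lambda>z. (U.A i l (U.R z $ (i, l) + s) z + \<phi> i l * (U.W z $ (i, l) - (U.R z $ (i, l) + s)))
      + (\<phi> i l * (U.R z $ (i, l) - U.W z $ (i, l)) + \<phi> i l * s)) \<longlongrightarrow> 0 + (\<phi> i l * 0 + \<phi> i l * s)) in_prob"
    by (intro tendsto_add tendsto_mult tendsto_const RW)
  then have "((\<lambda>z. U.A i l (U.R z $ (i, l) + s) z) \<longlongrightarrow> \<phi> i l * s) in_prob"
    by (simp add: algebra_simps)
  then show ?thesis
  proof (rule Lim_transform_eventually)
    show "\<forall>\<^sub>F z in in_prob. U.A i l (U.R z $ (i, l) + s) z
        = U.rn (fst z) * (emp_cdf (N (fst z)) (obs z) i l (emp_quantiles p (N (fst z)) (obs z) $ (i, l) + s / U.rn (fst z)) - p)"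
      using U.eventually_wp_fst[OF U.rn_pos]
    proof eventually_elim
      fix z :: "nat \<times> 'a" assume r: "0 < U.rn (fst z)"
      have "q $ (i, l) + (U.R z $ (i, l) + s) / U.rn (fst z) = emp_quantiles p (N (fst z)) (obs z) $ (i, l) + s / U.rn (fst z)"
        using r by (simp add: U.R_def add_divide_distrib)
      then show "U.A i l (U.R z $ (i, l) + s) z
        = U.rn (fst z) * (emp_cdf (N (fst z)) (obs z) i l (emp_quantiles p (N (fst z)) (obs z) $ (i, l) + s / U.rn (fst z)) - p)"
        by (simp add: U.A_def)
    qed
  qed
qed

lemma emp_cdf_at_quantile_tendsto:
  "((\<lambda>z. emp_cdf (N (fst z)) (obs z) i l (emp_quantiles p (N (fst z)) (obs z) $ (i, l))) \<longlongrightarrow> p) in_prob"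
proof -
  have "((\<lambda>z. 1 / U.rn (fst z) * (U.rn (fst z) * (emp_cdf (N (fst z)) (obs z) i l (emp_quantiles p (N (fst z)) (obs z) $ (i, l) + 0 / U.rn (fst z)) - p)) + p)
      \<longlongrightarrow> 0 * (\<phi> i l * 0) + p) in_prob"
    by (intro tendsto_add tendsto_mult tendsto_const emp_local filterlim_compose[OF U.inverse_rn U.filterlim_fst_wp])
  then have "((\<lambda>z. 1 / U.rn (fst z) * (U.rn (fst z) * (emp_cdf (N (fst z)) (obs z) i l (emp_quantiles p (N (fst z)) (obs z) $ (i, l) + 0 / U.rn (fst z)) - p)) + p)
      \<longlongrightarrow> p) in_prob" by simp
  then show ?thesis
    by (rule Lim_transform_eventually) (use U.eventually_wp_fst[OF U.rn_pos] in eventually_elim, simp)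
qed

text \<open>Weak law of large numbers, from tightness of the empirical process at one fixed
  indicator.\<close>

lemma emp_joint_at_q_tendsto:
  "((\<lambda>z. (\<Sum>j<N (fst z) i. of_bool (obs z (i, j) $ l \<le> q $ (i, l) \<and> obs z (i, j) $ m \<le> q $ (i, m))) / real (N (fst z) i))
    \<longlongrightarrow> J i l m) in_prob"
proof -
  define g :: "real^'d \<Rightarrow> real" where "g v = of_bool (v $ l \<le> q $ (i, l) \<and> v $ m \<le> q $ (i, m))" for v
  have [measurable]: "g \<in> borel_measurable borel" unfolding g_def of_bool_def by measurable
  have t: "tight_wp sequentially (\<lambda>_. M) (\<lambda>z. U.fluct (fst z) (snd z) i g)"
    by (rule U.tight_fluct[of "\<lambda>_. g" 1]) (auto simp: g_def)
  have Jg: "integral\<^sup>L (P i) g = J i l m"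
  proof -
    have [measurable_cong]: "sets (P i) = sets borel" by (rule sets_P)
    have "integral\<^sup>L (P i) g = (\<integral>v. indicator {x \<in> space (P i). x $ l \<le> q $ (i, l) \<and> x $ m \<le> q $ (i, m)} v \<partial>P i)"
      by (intro Bochner_Integration.integral_cong) (auto simp: g_def)
    also have "\<dots> = J i l m" by (simp add: J_def joint_cdf_def)
    finally show ?thesis .
  qed
  have "((\<lambda>z. (1 / U.rn (fst z)) *\<^sub>R U.fluct (fst z) (snd z) i g + J i l m) \<longlongrightarrow> 0 + J i l m) in_prob"
    by (intro tendsto_add tendsto_const U.tendsto_wp_tight_mult[OF filterlim_compose[OF U.inverse_rn U.filterlim_fst_wp] t])
  then have "((\<lambda>z. (1 / U.rn (fst z)) *\<^sub>R U.fluct (fst z) (snd z) i g + J i l m) \<longlongrightarrow> J i l m) in_prob" by simp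
  then show ?thesis
    by (rule Lim_transform_eventually)
      (use U.eventually_wp_fst[OF U.rn_pos] in eventually_elim, simp add: U.fluct_def Jg g_def)
qed

text \<open>Moving both thresholds changes the joint frequency by at most the sum of the changes of
  the marginal frequencies, and these tend to p - p = 0.\<close>

lemma emp_joint_at_quantile_tendsto:
  "((\<lambda>z. (\<Sum>j<N (fst z) i. of_bool (obs z (i, j) $ l \<le> emp_quantiles p (N (fst z)) (obs z) $ (i, l) \<and>
      obs z (i, j) $ m \<le> emp_quantiles p (N (fst z)) (obs z) $ (i, m))) / real (N (fst z) i)) \<longlongrightarrow> J i l m) in_prob"
proof -
  have nested: "\<bar>(\<Sum>j<n. of_bool (a j \<le> s \<and> b j \<le> t)) / real n - (\<Sum>j<n. of_bool (a j \<le> s' \<and> b j \<le> t')) / real n\<bar>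
      \<le> \<bar>(\<Sum>j<n. of_bool (a j \<le> s)) / real n - (\<Sum>j<n. of_bool (a j \<le> s')) / real n\<bar>
        + \<bar>(\<Sum>j<n. of_bool (b j \<le> t)) / real n - (\<Sum>j<n. of_bool (b j \<le> t')) / real n\<bar>"
    for a b :: "nat \<Rightarrow> real" and s t s' t' and n :: nat
  proof -
    \<comment> \<open>The half-lines are nested, so all differences have the same sign and the
      absolute value passes through the sum.\<close>
    have one: "(\<Sum>j<n. \<bar>of_bool (a j \<le> s) - of_bool (a j \<le> s') :: real\<bar>) = \<bar>\<Sum>j<n. of_bool (a j \<le> s) - of_bool (a j \<le> s')\<bar>"
      for a :: "nat \<Rightarrow> real" and s s'
    proof (cases "s \<le> s'")
      case True
      then have "\<bar>of_bool (a j \<le> s) - of_bool (a j \<le> s') :: real\<bar> = - (of_bool (a j \<le> s) - of_bool (a j \<le> s'))" for j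
        by (auto simp: of_bool_def)
      then have e: "(\<Sum>j<n. \<bar>of_bool (a j \<le> s) - of_bool (a j \<le> s') :: real\<bar>) = - (\<Sum>j<n. of_bool (a j \<le> s) - of_bool (a j \<le> s'))"
        by (simp only: sum_negf)
      moreover have "0 \<le> (\<Sum>j<n. \<bar>of_bool (a j \<le> s) - of_bool (a j \<le> s') :: real\<bar>)" by (intro sum_nonneg) simp
      ultimately show ?thesis by linarith
    next
      case False
      then have "\<bar>of_bool (a j \<le> s) - of_bool (a j \<le> s') :: real\<bar> = of_bool (a j \<le> s) - of_bool (a j \<le> s')" for j
        by (auto simp: of_bool_def)
      then have e: "(\<Sum>j<n. \<bar>of_bool (a j \<le> s) - of_bool (a j \<le> s') :: real\<bar>) = (\<Sum>j<n. of_bool (a j \<le> s) - of_bool (a j \<le> s'))"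
        by (simp only:)
      moreover have "0 \<le> (\<Sum>j<n. \<bar>of_bool (a j \<le> s) - of_bool (a j \<le> s') :: real\<bar>)" by (intro sum_nonneg) simp
      ultimately show ?thesis by linarith
    qed
    have "\<bar>\<Sum>j<n. of_bool (a j \<le> s \<and> b j \<le> t) - of_bool (a j \<le> s' \<and> b j \<le> t') :: real\<bar>
        \<le> (\<Sum>j<n. \<bar>of_bool (a j \<le> s \<and> b j \<le> t) - of_bool (a j \<le> s' \<and> b j \<le> t') :: real\<bar>)"
      by (rule sum_abs)
    also have "\<dots> \<le> (\<Sum>j<n. \<bar>of_bool (a j \<le> s) - of_bool (a j \<le> s')\<bar> + \<bar>of_bool (b j \<le> t) - of_bool (b j \<le> t')\<bar>)"
      by (intro sum_mono) (auto simp: of_bool_def)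
    also have "\<dots> = \<bar>\<Sum>j<n. of_bool (a j \<le> s) - of_bool (a j \<le> s')\<bar> + \<bar>\<Sum>j<n. of_bool (b j \<le> t) - of_bool (b j \<le> t')\<bar>"
      by (simp only: sum.distrib one)
    finally have "\<bar>\<Sum>j<n. of_bool (a j \<le> s \<and> b j \<le> t) - of_bool (a j \<le> s' \<and> b j \<le> t') :: real\<bar> / real n
        \<le> (\<bar>\<Sum>j<n. of_bool (a j \<le> s) - of_bool (a j \<le> s')\<bar> + \<bar>\<Sum>j<n. of_bool (b j \<le> t) - of_bool (b j \<le> t')\<bar>) / real n"
      by (rule divide_right_mono) simp
    then show ?thesis
      by (simp only: sum_subtractf add_divide_distrib diff_divide_distrib[symmetric] abs_divide abs_of_nat)
  qed
  let ?n = "\<lambda>z. N (fst z) i" and ?Q = "\<lambda>z. emp_quantiles p (N (fst z)) (obs z)"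
  have "((\<lambda>z. (\<Sum>j<?n z. of_bool (obs z (i, j) $ l \<le> ?Q z $ (i, l) \<and> obs z (i, j) $ m \<le> ?Q z $ (i, m))) / real (?n z)
      - (\<Sum>j<?n z. of_bool (obs z (i, j) $ l \<le> q $ (i, l) \<and> obs z (i, j) $ m \<le> q $ (i, m))) / real (?n z)) \<longlongrightarrow> 0) in_prob"
  proof (rule Lim_null_comparison)
    have "((\<lambda>z. \<bar>emp_cdf (N (fst z)) (obs z) i l (?Q z $ (i, l)) - emp_cdf (N (fst z)) (obs z) i l (q $ (i, l))\<bar>
        + \<bar>emp_cdf (N (fst z)) (obs z) i m (?Q z $ (i, m)) - emp_cdf (N (fst z)) (obs z) i m (q $ (i, m))\<bar>)
        \<longlongrightarrow> \<bar>p - p\<bar> + \<bar>p - p\<bar>) in_prob"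
      by (intro tendsto_intros emp_cdf_at_quantile_tendsto emp_cdf_at_q_tendsto)
    then show "((\<lambda>z. \<bar>emp_cdf (N (fst z)) (obs z) i l (?Q z $ (i, l)) - emp_cdf (N (fst z)) (obs z) i l (q $ (i, l))\<bar>
        + \<bar>emp_cdf (N (fst z)) (obs z) i m (?Q z $ (i, m)) - emp_cdf (N (fst z)) (obs z) i m (q $ (i, m))\<bar>) \<longlongrightarrow> 0) in_prob"
      by simp
    show "\<forall>\<^sub>F z in in_prob. norm ((\<Sum>j<?n z. of_bool (obs z (i, j) $ l \<le> ?Q z $ (i, l) \<and> obs z (i, j) $ m \<le> ?Q z $ (i, m))) / real (?n z)
        - (\<Sum>j<?n z. of_bool (obs z (i, j) $ l \<le> q $ (i, l) \<and> obs z (i, j) $ m \<le> q $ (i, m))) / real (?n z))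
      \<le> \<bar>emp_cdf (N (fst z)) (obs z) i l (?Q z $ (i, l)) - emp_cdf (N (fst z)) (obs z) i l (q $ (i, l))\<bar>
        + \<bar>emp_cdf (N (fst z)) (obs z) i m (?Q z $ (i, m)) - emp_cdf (N (fst z)) (obs z) i m (q $ (i, m))\<bar>"
      unfolding emp_cdf_def real_norm_def by (intro always_eventually allI nested)
  qed
  from tendsto_add[OF this emp_joint_at_q_tendsto[of i l m]] show ?thesis by (simp only: diff_add_cancel add_0)
qed

abbreviation boot :: "nat \<times> 'a \<Rightarrow> ('k \<times> nat \<Rightarrow> real^'d) measure" where
  "boot z \<equiv> measure_pmf (bootstrap (N (fst z)) (obs z))"

lemma eventually_N_pos: "\<forall>\<^sub>F z in in_prob. \<forall>i. 0 < N (fst z) i"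
  by (rule U.eventually_wp_fst[OF U.N_pos])

text \<open>The second level: the index is the pair of stage and outcome, and the array hypotheses
  hold along \<open>in_prob\<close>, that is, in probability, by the first-level results
  above.\<close>

sublocale B: array_sampling boot in_prob "\<lambda>z. N (fst z)" "\<lambda>_ y. y" "\<lambda>z. emp_measure (N (fst z)) (obs z)"
    "\<lambda>z. emp_quantiles p (N (fst z)) (obs z)" p \<kappa> \<phi> J
proof (intro array_sampling.intro prob_family.intro array_sampling_axioms.intro)
  fix z :: "nat \<times> 'a"
  show "prob_space (boot z)" by (rule prob_space_measure_pmf)
  \<comment> \<open>Independence with respect to all subsets implies independence with respect to
    the Borel sets.\<close>
  have "prob_space.indep_vars (boot z) (\<lambda>_. count_space UNIV) (\<lambda>a y. y a) (obs_index (N (fst z)))"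
    unfolding bootstrap_def by (rule indep_vars_Pi_pmf) simp
  then show "prob_space.indep_vars (boot z) (\<lambda>_. borel) (\<lambda>a y. y a) (obs_index (N (fst z)))"
    by (rule prob_space.indep_vars_compose2[OF prob_space_measure_pmf, where Y = "\<lambda>_ v. v"]) simp
next
  fix j i and z :: "nat \<times> 'a" assume "j < N (fst z) i"
  then have a: "(i, j) \<in> obs_index (N (fst z))" by (simp add: obs_index_def)
  have "distr (boot z) borel (\<lambda>y. y (i, j)) = distr (measure_pmf (map_pmf (\<lambda>y. y (i, j)) (bootstrap (N (fst z)) (obs z)))) borel (\<lambda>v. v)"
    unfolding map_pmf_rep_eq by (subst distr_distr) (auto simp: o_def)
  also have "map_pmf (\<lambda>y. y (i, j)) (bootstrap (N (fst z)) (obs z)) = map_pmf (\<lambda>h. obs z (i, h)) (pmf_of_set {..<N (fst z) i})"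
    unfolding bootstrap_def using a by (subst Pi_pmf_component) auto
  also have "distr (measure_pmf \<dots>) borel (\<lambda>v. v) = emp_measure (N (fst z)) (obs z) i"
    unfolding map_pmf_rep_eq emp_measure_def by (subst distr_distr) (auto simp: o_def)
  finally show "distr (boot z) borel (\<lambda>y. y (i, j)) = emp_measure (N (fst z)) (obs z) i" .
next
  fix i l s
  have "((\<lambda>z. U.rn (fst z) * (emp_cdf (N (fst z)) (obs z) i l (emp_quantiles p (N (fst z)) (obs z) $ (i, l) + s / U.rn (fst z)) - p))
    \<longlongrightarrow> \<phi> i l * s) in_prob" by (rule emp_local)
  then show "((\<lambda>z. sqrt (real (total_size (N (fst z)))) * (marginal_cdf (emp_measure (N (fst z)) (obs z) i) l
        (emp_quantiles p (N (fst z)) (obs z) $ (i, l) + s / sqrt (real (total_size (N (fst z))))) - p)) \<longlongrightarrow> \<phi> i l * s) in_prob"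
    by (rule Lim_transform_eventually)
      (use eventually_N_pos in eventually_elim, simp add: U.rn_def emp_cdf_eq_marginal_cdf)
next
  fix i l m
  show "((\<lambda>z. measure (emp_measure (N (fst z)) (obs z) i) {v. v $ l \<le> emp_quantiles p (N (fst z)) (obs z) $ (i, l) \<and>
      v $ m \<le> emp_quantiles p (N (fst z)) (obs z) $ (i, m)}) \<longlongrightarrow> J i l m) in_prob"
    using emp_joint_at_quantile_tendsto[of i l m]
  proof (rule Lim_transform_eventually)
    have meas: "{v :: real^'d. v $ l \<le> s \<and> v $ m \<le> t} \<in> sets borel" for s t by measurable
    show "\<forall>\<^sub>F z in in_prob. (\<Sum>j<N (fst z) i. of_bool (obs z (i, j) $ l \<le> emp_quantiles p (N (fst z)) (obs z) $ (i, l) \<and>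
      obs z (i, j) $ m \<le> emp_quantiles p (N (fst z)) (obs z) $ (i, m))) / real (N (fst z) i)
      = measure (emp_measure (N (fst z)) (obs z) i) {v. v $ l \<le> emp_quantiles p (N (fst z)) (obs z) $ (i, l) \<and>
      v $ m \<le> emp_quantiles p (N (fst z)) (obs z) $ (i, m)}"
      using eventually_N_pos by eventually_elim (simp add: measure_emp_measure[OF _ meas])
  qed
next
  show "filterlim (\<lambda>z. total_size (N (fst z))) at_top in_prob"
    by (rule filterlim_compose[OF size_N U.filterlim_fst_wp])
  show "((\<lambda>z. real (N (fst z) i) / real (total_size (N (fst z)))) \<longlongrightarrow> \<kappa> i) in_prob" for i
    by (rule filterlim_compose[OF ratio_N U.filterlim_fst_wp])
qed (rule prob_space_emp_measure sets_emp_measure p01 \<kappa>_pos \<phi>_pos)+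

text \<open>\<open>\<Sigma> = L L\<^sup>T\<close>, where \<open>L\<close> has a column for every group and every pattern
  \<open>u = {l. X\<^sub>l \<le> q\<^sub>l}\<close> of components below their quantiles, weighted by the
  square root of its probability.\<close>

lemma limit_cov_factor:
  obtains L :: "real^('k \<times> 'd set)^('k \<times> 'd)" where "limit_cov p \<kappa> \<phi> J = L ** transpose L"
proof -
  define pat where "pat i v = {l. v $ l \<le> q $ (i, l)}" for i and v :: "real^'d"
  define \<pi> where "\<pi> i u = measure (P i) {v. pat i v = u}" for i u
  define h where "h l u = (of_bool (l \<in> u) - p :: real)" for l and u :: "'d set"
  define L :: "real^('k \<times> 'd set)^('k \<times> 'd)" where
    "L = (\<chi> a b. if fst a = fst b then sqrt (inverse (\<kappa> (fst a))) * inverse (\<phi> (fst a) (snd a)) * sqrt (\<pi> (fst a) (snd b)) * h (snd a) (snd b) else 0)"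
  have \<pi>0: "0 \<le> \<pi> i u" for i u by (simp add: \<pi>_def)
  \<comment> \<open>Summing over patterns gives the expectation of the product of two centred
    indicators. As each indicator has mean p, this is their covariance J - p^2.\<close>
  have key: "(\<Sum>u\<in>UNIV. \<pi> i u * (h l u * h m u)) = J i l m - p\<^sup>2" for i l m
  proof -
    interpret P: prob_space "P i" by (rule prob_space_P)
    have [measurable_cong]: "sets (P i) = sets borel" by (rule sets_P)
    have sp: "space (P i) = UNIV" using sets_eq_imp_space_eq[OF sets_P, of i] by simp
    have patm: "{v. pat i v = u} \<in> sets (P i)" for u
    proof -
      have "{v. pat i v = u} = (\<Inter>l\<in>UNIV. {v \<in> space (P i). (v $ l \<le> q $ (i, l)) = (l \<in> u)})"
        by (auto simp: pat_def sp)
      also have "\<dots> \<in> sets (P i)" by (intro sets.finite_INT) auto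
      finally show ?thesis .
    qed
    have "(\<Sum>u\<in>UNIV. \<pi> i u * (h l u * h m u)) = (\<Sum>u\<in>UNIV. (h l u * h m u) * (\<integral>v. indicator {v. pat i v = u} v \<partial>P i))"
      using patm by (simp add: \<pi>_def sp mult.commute)
    also have "\<dots> = (\<integral>v. (\<Sum>u\<in>UNIV. (h l u * h m u) * indicator {v. pat i v = u} v) \<partial>P i)"
      using patm by (subst Bochner_Integration.integral_sum) (auto simp: sp P.emeasure_eq_measure intro!: integrable_mult_right integrable_real_indicator)
    also have "\<dots> = (\<integral>v. (of_bool (v $ l \<le> q $ (i, l)) - p) * (of_bool (v $ m \<le> q $ (i, m)) - p) \<partial>P i)"
    proof (rule Bochner_Integration.integral_cong[OF refl])
      fix v
      have "(\<Sum>u\<in>UNIV. (h l u * h m u) * indicator {v. pat i v = u} v) = (\<Sum>u\<in>UNIV. if pat i v = u then h l u * h m u else 0)"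
        by (intro sum.cong) (auto simp: indicator_def)
      then show "(\<Sum>u\<in>UNIV. (h l u * h m u) * indicator {v. pat i v = u} v)
          = (of_bool (v $ l \<le> q $ (i, l)) - p) * (of_bool (v $ m \<le> q $ (i, m)) - p)"
        by (simp add: h_def pat_def)
    qed
    also have "\<dots> = (\<integral>v. indicator {v \<in> space (P i). v $ l \<le> q $ (i, l) \<and> v $ m \<le> q $ (i, m)} v
        - p * indicator {v. v $ l \<le> q $ (i, l)} v - p * indicator {v. v $ m \<le> q $ (i, m)} v + p\<^sup>2 \<partial>P i)"
      by (intro Bochner_Integration.integral_cong) (auto simp: indicator_def of_bool_def power2_eq_square algebra_simps)
    also have "\<dots> = J i l m - p * p - p * p + p\<^sup>2"
    proof -
      have half: "{v. v $ l' \<le> t} \<in> sets (P i)" for l' t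
      proof -
        have "{v \<in> space (P i). v $ l' \<le> t} \<in> sets (P i)" by measurable
        then show ?thesis by (simp add: sp)
      qed
      have joint: "{v \<in> space (P i). v $ l \<le> q $ (i, l) \<and> v $ m \<le> q $ (i, m)} \<in> sets (P i)" by measurable
      have ii: "integrable (P i) (indicator S :: _ \<Rightarrow> real)" if "S \<in> sets (P i)" for S
        using that by (intro integrable_real_indicator) (auto simp: P.emeasure_eq_measure)
      have c: "measure (P i) {v. v $ l' \<le> q $ (i, l')} = p" for l'
        using cdf_q[of i l'] by (simp add: marginal_cdf_eq[OF sets_P])
      note I = ii[OF joint] ii[OF half]
      show ?thesis
        using I joint half
        using P.prob_space by (simp add: c J_def joint_cdf_def sp)
    qed
    finally show ?thesis by (simp add: power2_eq_square)
  qed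
  have "limit_cov p \<kappa> \<phi> J = L ** transpose L"
  proof -
    have "(L ** transpose L) $ (i, l) $ (j, m) = limit_cov p \<kappa> \<phi> J $ (i, l) $ (j, m)" for i l j m
    proof -
      have "(L ** transpose L) $ (i, l) $ (j, m) = (\<Sum>i'\<in>UNIV. \<Sum>u\<in>UNIV. L $ (i, l) $ (i', u) * L $ (j, m) $ (i', u))"
        unfolding matrix_matrix_mult_def transpose_def UNIV_Times_UNIV[symmetric] by (simp add: sum.cartesian_product)
      \<comment> \<open>Every column of L is supported in a single group, so rows of different
        groups are orthogonal.\<close>
      also have "\<dots> = (\<Sum>i'\<in>UNIV. if i = i' then (if i = j then inverse (\<kappa> i) * inverse (\<phi> i l * \<phi> i m) * (\<Sum>u\<in>UNIV. \<pi> i u * (h l u * h m u)) else 0) else 0)"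
      proof (intro sum.cong refl)
        fix i'
        have "L $ (i, l) $ (i, u) * L $ (i, m) $ (i, u) = inverse (\<kappa> i) * inverse (\<phi> i l * \<phi> i m) * (\<pi> i u * (h l u * h m u))" for u
        proof -
          have "L $ (i, l) $ (i, u) * L $ (i, m) $ (i, u) = (sqrt (inverse (\<kappa> i)) * sqrt (inverse (\<kappa> i))) * inverse (\<phi> i l * \<phi> i m)
              * ((sqrt (\<pi> i u) * sqrt (\<pi> i u)) * (h l u * h m u))"
            by (simp add: L_def mult_ac)
          then show ?thesis using \<kappa>_pos[of i] \<pi>0[of i u] by simp
        qed
        then show "(\<Sum>u\<in>UNIV. L $ (i, l) $ (i', u) * L $ (j, m) $ (i', u))
            = (if i = i' then (if i = j then inverse (\<kappa> i) * inverse (\<phi> i l * \<phi> i m) * (\<Sum>u\<in>UNIV. \<pi> i u * (h l u * h m u)) else 0) else 0)"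
          by (cases "i = i'"; cases "i = j") (auto simp: sum_distrib_left, auto simp: L_def)
      qed
      also have "\<dots> = limit_cov p \<kappa> \<phi> J $ (i, l) $ (j, m)"
        by (simp add: key limit_cov_def)
      finally show ?thesis .
    qed
    then show ?thesis by (simp add: vec_eq_iff split_paired_all)
  qed
  then show thesis by (rule that)
qed

end

section \<open>Asymptotics of the bootstrap test\<close>

context quantile_bootstrap
begin

text \<open>\<open>conv_in_prob\<close> makes events \<open>dist > \<epsilon>\<close> negligible,
  whereas the filter limit asks for \<open>dist < e\<close>; a value d strictly between 0 and e
  bridges the two.\<close>

lemma conv_in_prob_tendsto:
  fixes Z :: "nat \<Rightarrow> 'a \<Rightarrow> 'b::{metric_space,second_countable_topology}"
  assumes Z [measurable]: "\<And>\<nu>. Z \<nu> \<in> borel_measurable M" and conv: "conv_in_prob M Z c"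
  shows "((\<lambda>z. Z (fst z) (snd z)) \<longlongrightarrow> c) in_prob"
proof (rule tendstoI)
  fix e :: real assume "e > 0"
  then obtain d where d: "0 < d" "d < e" by (rule dense[THEN exE]) blast
  have "\<forall>\<^sub>F z in in_prob. dist (Z (fst z) (snd z)) c \<le> d"
  proof (rule U.eventually_wp_if_prob)
    show "(\<lambda>\<nu>. prob {\<omega> \<in> space M. \<not> dist (Z (fst (\<nu>, \<omega>)) (snd (\<nu>, \<omega>))) c \<le> d}) \<longlonglongrightarrow> 0"
      using conv d unfolding conv_in_prob_def by (simp add: not_le)
    show "\<forall>\<^sub>F \<nu> in sequentially. {\<omega> \<in> space M. dist (Z (fst (\<nu>, \<omega>)) (snd (\<nu>, \<omega>))) c \<le> d} \<in> events"
      unfolding fst_conv snd_conv by (intro always_eventually allI) measurable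
  qed
  then show "\<forall>\<^sub>F z in in_prob. dist (Z (fst z) (snd z)) c < e"
    by eventually_elim (use d in simp)
qed

lemma consistent_estimator_tendsto:
  fixes S :: "nat \<Rightarrow> ('k \<times> nat \<Rightarrow> real^'d) \<Rightarrow> 'b::{metric_space,second_countable_topology}"
  assumes S: "\<And>\<nu>. S \<nu> \<in> borel_measurable (sample_space (N \<nu>))" and cons: "consistent_estimator M X N S \<theta>"
  shows "((\<lambda>z. S (fst z) (obs z)) \<longlongrightarrow> \<theta>) in_prob"
  using cons unfolding consistent_estimator_def
  by (rule conv_in_prob_tendsto[rotated]) (rule measurable_compose[OF measurable_observed S])

text \<open>A conditional probability tending to 0 in probability becomes a limit along the iterated
  filter. Its measurability in the data, required on the outer level, comes from the representation
  by index functions.\<close>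

lemma bootstrap_consistent_tendsto:
  fixes S :: "nat \<Rightarrow> ('k \<times> nat \<Rightarrow> real^'d) \<Rightarrow> 'b::{metric_space,second_countable_topology}"
  assumes S: "\<And>\<nu>. S \<nu> \<in> borel_measurable (sample_space (N \<nu>))" and cons: "bootstrap_consistent M X N S \<theta>"
  shows "((\<lambda>z. S (fst (fst z)) (snd z)) \<longlongrightarrow> \<theta>) (wp in_prob boot)"
proof (rule tendstoI)
  fix e :: real assume "e > 0"
  then obtain d where d: "0 < d" "d < e" by (rule dense[THEN exE]) blast
  let ?D = "\<lambda>\<nu> y. dist (S \<nu> y) \<theta> > d"
  have "(\<lambda>x. measure_pmf.prob (bootstrap (N \<nu>) x) {y. ?D \<nu> y}) \<in> borel_measurable (sample_space (N \<nu>))" for \<nu>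
  proof (rule borel_measurable_prob_bootstrap)
    fix h assume "h \<in> set_pmf (resample_pmf (N \<nu>))"
    from measurable_compose[OF measurable_resample[OF this] S]
    have [measurable]: "(\<lambda>x. S \<nu> (resample (N \<nu>) x h)) \<in> borel_measurable (sample_space (N \<nu>))" .
    show "{x \<in> space (sample_space (N \<nu>)). ?D \<nu> (resample (N \<nu>) x h)} \<in> sets (sample_space (N \<nu>))"
      by measurable
  qed
  from measurable_compose[OF measurable_observed this]
  have "((\<lambda>z. measure_pmf.prob (bootstrap (N (fst z)) (obs z)) {y. ?D (fst z) y}) \<longlongrightarrow> 0) in_prob"
    using cons d unfolding bootstrap_consistent_def by (intro conv_in_prob_tendsto) auto
  then have "\<forall>\<^sub>F z in wp in_prob boot. \<not> ?D (fst (fst z)) (snd z)"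
    by (intro B.eventually_wp_if_prob) (auto simp: not_le)
  then show "\<forall>\<^sub>F z in wp in_prob boot. dist (S (fst (fst z)) (snd z)) \<theta> < e"
    by eventually_elim (use d in simp)
qed

text \<open>Hypothesis: the statistic and its conditional bootstrap law share the limit
  \<open>gauss_quad_cdf (B ** L)\<close>, continuous by nondegeneracy. Alternative: the bootstrap
  bounds hold whatever T q is, so the critical value stays bounded above with probability tending to
  one, while the statistic divided by the total size tends to |B q|^2 > 0.\<close>

theorem boot_test_asymptotics:
  fixes S :: "nat \<Rightarrow> ('k \<times> nat \<Rightarrow> real^'d) \<Rightarrow> real^('k \<times> 'd)^('k \<times> 'd)"
    and T \<Sigma> B :: "real^('k \<times> 'd)^('k \<times> 'd)"
    and E :: "real^('k \<times> 'd)^('k \<times> 'd) \<Rightarrow> real^('k \<times> 'd)^('k \<times> 'd) \<Rightarrow> real^('k \<times> 'd)^('k \<times> 'd)"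
  assumes \<Sigma>: "\<Sigma> = limit_cov p \<kappa> \<phi> J"
    and S: "\<And>\<nu>. S \<nu> \<in> borel_measurable (sample_space (N \<nu>))"
    and cons: "consistent_estimator M X N S \<Sigma>" and bcons: "bootstrap_consistent M X N S \<Sigma>"
    and Em: "E T \<in> borel_measurable borel" and Ec: "isCont (E T) \<Sigma>"
    and quad: "\<And>v. (T *v v) \<bullet> (E T \<Sigma> *v (T *v v)) = (norm (B *v v))\<^sup>2"
    and ker: "\<And>v. B *v v = 0 \<longleftrightarrow> T *v v = 0"
    and \<alpha>: "0 < \<alpha>" "\<alpha> < 1"
  shows "T *v q = 0 \<Longrightarrow> T ** \<Sigma> ** T \<noteq> 0 \<Longrightarrow>
      (\<lambda>\<nu>. expectation (\<lambda>\<omega>. boot_test E p (N \<nu>) (S \<nu>) T \<alpha> (observed X (N \<nu>) \<omega>))) \<longlonglongrightarrow> \<alpha>"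
    and "T *v q \<noteq> 0 \<Longrightarrow>
      (\<lambda>\<nu>. expectation (\<lambda>\<omega>. boot_test E p (N \<nu>) (S \<nu>) T \<alpha> (observed X (N \<nu>) \<omega>))) \<longlonglongrightarrow> 1"
proof -
  define stat where "stat \<nu> \<omega> = test_stat E p (N \<nu>) (S \<nu>) T (observed X (N \<nu>) \<omega>)" for \<nu> \<omega>
  define crit where "crit \<nu> \<omega> = boot_critical_value E p (N \<nu>) (S \<nu>) T \<alpha> (observed X (N \<nu>) \<omega>)" for \<nu> \<omega>
  define H where "H z s = measure_pmf.prob (bootstrap (N (fst z)) (obs z))
    {y. boot_stat E p (N (fst z)) (S (fst z)) T (obs z) y \<le> s}" for z s
  obtain L :: "real^('k \<times> 'd set)^('k \<times> 'd)" where L: "limit_cov p \<kappa> \<phi> J = L ** transpose L"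
    by (rule limit_cov_factor)
  let ?F = "gauss_quad_cdf (B ** L)"
  have stat_m [measurable]: "stat \<nu> \<in> borel_measurable M" for \<nu>
    unfolding stat_def using borel_measurable_test_stat[where E = E and T = T, OF p01 Em S]
    by (intro measurable_compose[OF measurable_observed]) auto
  have crit_m [measurable]: "crit \<nu> \<in> borel_measurable M" for \<nu>
    unfolding crit_def using borel_measurable_boot_critical_value[where E = E and T = T, OF p01 Em S \<alpha>]
    by (intro measurable_compose[OF measurable_observed]) auto
  have crit_le: "crit \<nu> \<omega> \<le> s \<longleftrightarrow> 1 - \<alpha> \<le> H (\<nu>, \<omega>) s" for \<nu> \<omega> s
    unfolding crit_def H_def by (simp add: boot_critical_value_le_iff[OF \<alpha>])
  have expect: "expectation (\<lambda>\<omega>. boot_test E p (N \<nu>) (S \<nu>) T \<alpha> (observed X (N \<nu>) \<omega>))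
      = prob {\<omega> \<in> space M. stat \<nu> \<omega> > crit \<nu> \<omega>}" for \<nu>
  proof -
    have "expectation (\<lambda>\<omega>. boot_test E p (N \<nu>) (S \<nu>) T \<alpha> (observed X (N \<nu>) \<omega>))
        = expectation (indicator {\<omega> \<in> space M. stat \<nu> \<omega> > crit \<nu> \<omega>})"
      by (intro Bochner_Integration.integral_cong) (auto simp: boot_test_def stat_def crit_def)
    then show ?thesis by simp
  qed
  have Vlim: "((\<lambda>z. E T (S (fst z) (obs z))) \<longlongrightarrow> E T \<Sigma>) in_prob"
    by (rule isCont_tendsto_compose[OF Ec consistent_estimator_tendsto[OF S cons]])
  have Vlim': "((\<lambda>z. E T (S (fst (fst z)) (snd z))) \<longlongrightarrow> E T \<Sigma>) (wp in_prob boot)"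
    by (rule isCont_tendsto_compose[OF Ec bootstrap_consistent_tendsto[OF S bcons]])
  have boot_bounds: "\<forall>\<^sub>F z in in_prob. H z s < ?F (s + e) + e" "\<forall>\<^sub>F z in in_prob. H z s > ?F (s - e) - e"
    if e: "e > 0" for s e
  proof -
    let ?U = "\<lambda>z. boot_stat E p (N (fst (fst z))) (S (fst (fst z))) T (obs (fst z)) (snd z)"
    have eq: "?U z = real (total_size (N (fst (fst z)))) *
       ((T *v (emp_quantiles p (N (fst (fst z))) (snd z) - emp_quantiles p (N (fst (fst z))) (obs (fst z)))) \<bullet>
        (E T (S (fst (fst z)) (snd z)) *v (T *v (emp_quantiles p (N (fst (fst z))) (snd z) - emp_quantiles p (N (fst (fst z))) (obs (fst z))))))" for z
      by (simp add: boot_stat_def quad_stat_def)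
    note b = B.quadratic_statistic_tendsto[OF L Vlim' quad eq _ e, of s]
    show "\<forall>\<^sub>F z in in_prob. H z s < ?F (s + e) + e" "\<forall>\<^sub>F z in in_prob. H z s > ?F (s - e) - e"
      using b by (simp_all add: H_def)
  qed
  show "(\<lambda>\<nu>. expectation (\<lambda>\<omega>. boot_test E p (N \<nu>) (S \<nu>) T \<alpha> (observed X (N \<nu>) \<omega>))) \<longlonglongrightarrow> \<alpha>"
    if H0: "T *v q = 0" and nd: "T ** \<Sigma> ** T \<noteq> 0"
  proof -
    \<comment> \<open>Otherwise T would vanish on the range of L, and T \<Sigma> T = T L L^T T would
      be 0.\<close>
    have BL: "B ** L \<noteq> 0"
    proof
      assume "B ** L = 0"
      then have "B *v (L *v h) = 0" for h by (simp add: matrix_vector_mul_assoc)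
      then have "T *v (L *v h) = 0" for h using ker by blast
      then have "T ** L = 0" unfolding matrix_eq by (simp add: matrix_vector_mul_assoc)
      then have "T ** L ** transpose L ** T = 0" by simp
      with nd show False by (simp add: \<Sigma> L matrix_mul_assoc)
    qed
    \<comment> \<open>Since T q = 0, centring at q leaves the statistic unchanged and the array
      theorem applies.\<close>
    have eq: "stat (fst z) (snd z) = real (total_size (N (fst z))) *
       ((T *v (emp_quantiles p (N (fst z)) (obs z) - q)) \<bullet>
        (E T (S (fst z) (obs z)) *v (T *v (emp_quantiles p (N (fst z)) (obs z) - q))))" for z
      using H0 by (simp add: stat_def test_stat_def quad_stat_def matrix_vector_mult_diff_distrib)
    have m: "(\<lambda>\<omega>. stat (fst (\<nu>, \<omega>)) (snd (\<nu>, \<omega>))) \<in> borel_measurable M" for \<nu> by simp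
    note F = isCont_gauss_quad_cdf[OF BL] gauss_quad_cdf_limits[of "B ** L"]
    have "(\<lambda>\<nu>. prob {\<omega> \<in> space M. stat \<nu> \<omega> > crit \<nu> \<omega>}) \<longlonglongrightarrow> \<alpha>"
    proof (rule test_level_tendsto[OF prob_space_axioms stat_m crit_m F _ _ crit_le \<alpha>])
      fix s
      show "(\<lambda>\<nu>. prob {\<omega> \<in> space M. stat \<nu> \<omega> \<le> s}) \<longlonglongrightarrow> ?F s"
      proof (rule tendsto_if_shifted_bounds[OF F(1)])
        fix e :: real assume e: "e > 0"
        note b = U.quadratic_statistic_tendsto[OF L Vlim quad eq m e, of s]
        show "\<forall>\<^sub>F \<nu> in sequentially. prob {\<omega> \<in> space M. stat \<nu> \<omega> \<le> s} < ?F (s + e) + e"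
          "\<forall>\<^sub>F \<nu> in sequentially. prob {\<omega> \<in> space M. stat \<nu> \<omega> \<le> s} > ?F (s - e) - e"
          using b by simp_all
      qed
      show "((\<lambda>z. H z s) \<longlongrightarrow> ?F s) in_prob"
        by (rule tendsto_if_shifted_bounds[OF F(1)]) (rule boot_bounds, assumption)+
    qed
    then show ?thesis unfolding expect .
  qed
  show "(\<lambda>\<nu>. expectation (\<lambda>\<omega>. boot_test E p (N \<nu>) (S \<nu>) T \<alpha> (observed X (N \<nu>) \<omega>))) \<longlonglongrightarrow> 1"
    if H1: "T *v q \<noteq> 0"
  proof -
    \<comment> \<open>The shifted lower bound with e = \<alpha> / 2 turns a limit value above 1 -
      \<alpha> / 2 into a bootstrap probability above 1 - \<alpha>, hence into an upper bound for
      the critical value.\<close>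
    have "1 - \<alpha> / 2 < 1" using \<alpha> by simp
    from order_tendstoD(1)[OF gauss_quad_cdf_limits(1)[of "B ** L"] this]
    obtain K where K: "1 - \<alpha> / 2 < ?F K" by (auto simp: eventually_at_top_linorder)
    have "\<forall>\<^sub>F z in in_prob. H z (K + \<alpha> / 2) > ?F (K + \<alpha> / 2 - \<alpha> / 2) - \<alpha> / 2"
      using \<alpha> by (intro boot_bounds) simp
    then have crit_bdd: "\<forall>\<^sub>F z in in_prob. crit (fst z) (snd z) \<le> K + \<alpha> / 2"
      by eventually_elim (use K in \<open>simp add: crit_le\<close>)
    have "((\<lambda>z. emp_quantiles p (N (fst z)) (obs z)) \<longlongrightarrow> q) in_prob"
      using U.quantiles_tendsto by (simp add: Lim_null[symmetric])
    from tendsto_Pair[OF this Vlim]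
    have lim: "((\<lambda>z. (emp_quantiles p (N (fst z)) (obs z), E T (S (fst z) (obs z)))) \<longlongrightarrow> (q, E T \<Sigma>)) in_prob" .
    have "continuous_on UNIV (\<lambda>u :: (real^('k \<times> 'd)) \<times> (real^('k \<times> 'd)^('k \<times> 'd)). (T *v fst u) \<bullet> (snd u *v (T *v fst u)))"
      by (intro continuous_intros)
    then have "isCont (\<lambda>u :: (real^('k \<times> 'd)) \<times> (real^('k \<times> 'd)^('k \<times> 'd)). (T *v fst u) \<bullet> (snd u *v (T *v fst u))) (q, E T \<Sigma>)"
      by (simp add: continuous_on_eq_continuous_at)
    from isCont_tendsto_compose[OF this lim]
    have qlim: "((\<lambda>z. (T *v emp_quantiles p (N (fst z)) (obs z)) \<bullet> (E T (S (fst z) (obs z)) *v (T *v emp_quantiles p (N (fst z)) (obs z))))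
        \<longlongrightarrow> (norm (B *v q))\<^sup>2) in_prob"
      by (simp add: quad)
    have pos: "(norm (B *v q))\<^sup>2 > 0" using H1 ker by simp
    have n: "filterlim (\<lambda>z. real (total_size (N (fst z)))) at_top in_prob"
      by (intro filterlim_compose[OF filterlim_real_sequentially] filterlim_compose[OF size_N U.filterlim_fst_wp])
    have "filterlim (\<lambda>z. stat (fst z) (snd z)) at_top in_prob"
      using filterlim_tendsto_pos_mult_at_top[OF qlim pos n]
      by (simp add: stat_def test_stat_def quad_stat_def mult.commute)
    then have "\<forall>\<^sub>F z in in_prob. K + \<alpha> / 2 < stat (fst z) (snd z)"
      unfolding filterlim_at_top_dense by blast
    with crit_bdd have ev: "\<forall>\<^sub>F z in in_prob. stat (fst z) (snd z) > crit (fst z) (snd z)"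
      by eventually_elim simp
    have "(\<lambda>\<nu>. prob {\<omega> \<in> space M. stat \<nu> \<omega> > crit \<nu> \<omega>}) \<longlonglongrightarrow> 1"
    proof (rule tendstoI)
      fix e :: real assume e: "e > 0"
      then have "e / 2 > 0" by simp
      from U.eventually_wp_prob[OF ev _ this]
      have "\<forall>\<^sub>F \<nu> in sequentially. 1 - e / 2 \<le> prob {\<omega> \<in> space M. stat \<nu> \<omega> > crit \<nu> \<omega>}" by simp
      then show "\<forall>\<^sub>F \<nu> in sequentially. dist (prob {\<omega> \<in> space M. stat \<nu> \<omega> > crit \<nu> \<omega>}) 1 < e"
      proof eventually_elim
        fix \<nu> assume "1 - e / 2 \<le> prob {\<omega> \<in> space M. stat \<nu> \<omega> > crit \<nu> \<omega>}"
        then show "dist (prob {\<omega> \<in> space M. stat \<nu> \<omega> > crit \<nu> \<omega>}) 1 < e"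
          using prob_le_1[of "{\<omega> \<in> space M. stat \<nu> \<omega> > crit \<nu> \<omega>}"] e unfolding dist_real_def by linarith
      qed
    qed
    then show ?thesis unfolding expect .
  qed
qed

end

text \<open>ATS and MATS enter through three properties of \<open>E T\<close>: Borel measurability,
  continuity at \<Sigma>, and a factorisation of the quadratic form at \<Sigma> whose kernel is that
  of T. Nondegeneracy gives ATS a positive trace, and both choices a continuous limit law under the
  hypothesis.\<close>

theorem mainTheorem3:
  fixes M :: "'a measure"
    and X :: "'k::finite \<Rightarrow> nat \<Rightarrow> 'a \<Rightarrow> real^'d"
    and P :: "'k \<Rightarrow> (real^'d) measure"
    and f :: "'k \<Rightarrow> 'd \<Rightarrow> real \<Rightarrow> real"
    and N :: "nat \<Rightarrow> 'k \<Rightarrow> nat"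
    and \<kappa> :: "'k \<Rightarrow> real"
    and p \<alpha> :: real
    and H :: "real^('k \<times> 'd)^'r"
    and T \<Sigma> :: "real^('k \<times> 'd)^('k \<times> 'd)"
    and q :: "real^('k \<times> 'd)"
    and S :: "nat \<Rightarrow> ('k \<times> nat \<Rightarrow> real^'d) \<Rightarrow> real^('k \<times> 'd)^('k \<times> 'd)"
    and E :: "real^('k \<times> 'd)^('k \<times> 'd) \<Rightarrow> real^('k \<times> 'd)^('k \<times> 'd) \<Rightarrow> real^('k \<times> 'd)^('k \<times> 'd)"
  assumes prob_space: "prob_space M"
    and indep: "prob_space.indep_vars M (\<lambda>_. borel) (\<lambda>(i, j). X i j) UNIV"
    and law: "\<And>i j. distr M borel (X i j) = P i"
    and density: "\<And>i l. distributed (P i) lborel (\<lambda>x. x $ l) (\<lambda>t. ennreal (f i l t))"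
    and density_nonneg: "\<And>i l t. f i l t \<ge> 0"
    and p: "0 < p" "p < 1"
    and q_def: "q = pop_quantiles p P"
    and \<Sigma>_def: "\<Sigma> = asymp_cov p \<kappa> P f"
    and contrast: "contrast_matrix H"
    and T_def: "T = projection_of H"
    and size_tendsto: "filterlim (\<lambda>\<nu>. total_size (N \<nu>)) at_top sequentially"
    and A1: "\<And>i. (\<lambda>\<nu>. real (N \<nu> i) / real (total_size (N \<nu>))) \<longlonglongrightarrow> \<kappa> i" "\<And>i. \<kappa> i > 0"
    and A2: "\<And>i l. cont_differentiable_at (marginal_cdf (P i) l) (q $ (i, l))"
            "\<And>i l. (marginal_cdf (P i) l has_real_derivative f i l (q $ (i, l))) (at (q $ (i, l)))"
            "\<And>i l. f i l (q $ (i, l)) > 0"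
    and estimator: "\<And>\<nu>. S \<nu> \<in> borel_measurable (sample_space (N \<nu>))"
    and consistent: "consistent_estimator M X N S \<Sigma>"
    and boot_consistent: "bootstrap_consistent M X N S \<Sigma>"
    and \<alpha>: "0 < \<alpha>" "\<alpha> < 1"
    and E: "E = E_ATS \<or> E = E_MATS"
    and nondegenerate: "E = E_ATS \<or> T *v q = 0 \<Longrightarrow> T ** \<Sigma> ** T \<noteq> 0"
  shows "(T *v q = 0 \<longrightarrow>
            (\<lambda>\<nu>. prob_space.expectation M
                    (\<lambda>\<omega>. boot_test E p (N \<nu>) (S \<nu>) T \<alpha> (observed X (N \<nu>) \<omega>))) \<longlonglongrightarrow> \<alpha>) \<and>
         (T *v q \<noteq> 0 \<longrightarrow>
            (\<lambda>\<nu>. prob_space.expectation M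
                    (\<lambda>\<omega>. boot_test E p (N \<nu>) (S \<nu>) T \<alpha> (observed X (N \<nu>) \<omega>))) \<longlonglongrightarrow> 1)"
proof -
  define \<phi> where "\<phi> i l = f i l (q $ (i, l))" for i l
  define J where "J i l m = joint_cdf (P i) l m (q $ (i, l)) (q $ (i, m))" for i l m
  interpret quantile_bootstrap M X P N \<kappa> p \<phi> q J
    by (intro quantile_bootstrap.intro quantile_bootstrap_axioms.intro)
      (use prob_space indep law p q_def size_tendsto A1 A2 in \<open>simp_all add: \<phi>_def J_def\<close>)
  have q: "q $ (i, l) = pop_quantile p P i l" for i l
    by (simp add: q_def pop_quantiles_def)
  \<comment> \<open>This turns J - p^2 on the diagonal into the p - p^2 of
    \<open>asymp_cov\<close>.\<close>
  have diag: "J i l l = p" for i l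
  proof -
    have "J i l l = marginal_cdf (P i) l (q $ (i, l))"
      using sets_eq_imp_space_eq[OF sets_P] by (simp add: J_def joint_cdf_def marginal_cdf_eq[OF sets_P])
    then show ?thesis by (simp add: cdf_q)
  qed
  have \<Sigma>: "\<Sigma> = limit_cov p \<kappa> \<phi> J"
    using diag
    by (auto simp: \<Sigma>_def asymp_cov_def limit_cov_def vec_eq_iff Let_def q[symmetric] \<phi>_def J_def power2_eq_square)
  have T: "transpose T = T" "T ** T = T"
    by (simp_all add: T_def projection_of_symmetric projection_of_idempotent)
  \<comment> \<open>Positive because p^2 < p on (0, 1); it supplies the coercivity behind the MATS
    weight matrix.\<close>
  have pos: "\<Sigma> $ a $ a > 0" for a
  proof -
    have "p\<^sup>2 < p" using p by (simp add: power2_eq_square)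
    then show ?thesis using A1(2) \<phi>_pos by (simp add: \<Sigma> limit_cov_def diag)
  qed
  obtain B :: "real^('k \<times> 'd)^('k \<times> 'd)" where B: "\<And>v. (T *v v) \<bullet> (E T \<Sigma> *v (T *v v)) = (norm (B *v v))\<^sup>2"
      "\<And>v. B *v v = 0 \<longleftrightarrow> T *v v = 0" and Em: "E T \<in> borel_measurable borel" and Ec: "isCont (E T) \<Sigma>"
    using E
  proof
    assume E: "E = E_ATS"
    obtain L :: "real^('k \<times> 'd set)^('k \<times> 'd)" where L: "limit_cov p \<kappa> \<phi> J = L ** transpose L"
      by (rule limit_cov_factor)
    \<comment> \<open>In this form the trace is a sum of squares, so a nonzero matrix has positive
      trace.\<close>
    have TST: "T ** \<Sigma> ** T = (T ** L) ** transpose (T ** L)"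
      using T by (simp add: \<Sigma> L matrix_transpose_mul matrix_mul_assoc)
    have "T ** L \<noteq> 0" using nondegenerate E TST by auto
    then have tr: "trace (T ** \<Sigma> ** T) > 0" unfolding TST by (rule trace_mult_transpose_pos)
    obtain B :: "real^('k \<times> 'd)^('k \<times> 'd)" where "\<And>v. (T *v v) \<bullet> (E_ATS T \<Sigma> *v (T *v v)) = (norm (B *v v))\<^sup>2"
      "\<And>v. B *v v = 0 \<longleftrightarrow> T *v v = 0"
      using E_ATS_quadratic[OF tr] by blast
    then show thesis
      using tr by (intro that[of B]) (simp_all add: E borel_measurable_E_ATS isCont_E_ATS)
  next
    assume E: "E = E_MATS"
    obtain B :: "real^('k \<times> 'd)^('k \<times> 'd)" where "\<And>v. (T *v v) \<bullet> (E_MATS T \<Sigma> *v (T *v v)) = (norm (B *v v))\<^sup>2"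
      "\<And>v. B *v v = 0 \<longleftrightarrow> T *v v = 0"
      using E_MATS_quadratic[OF T pos] by blast
    then show thesis
      by (intro that[of B]) (simp_all add: E borel_measurable_E_MATS isCont_E_MATS[OF T pos])
  qed
  note main = boot_test_asymptotics[where E = E, OF \<Sigma> estimator consistent boot_consistent Em Ec B \<alpha>]
  show ?thesis using main nondegenerate by blast
qed

end
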